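(* Let $F \in L^2([0,T],L^2(\Omega))$, $U_0 \in H^1_0(\Omega)$ and $V_0 \in L^2(\Omega)$. There is at most one weak solution $u$ of the single-phase-lag problem with data $(F,U_0,V_0)$ satisfying in addition $\partial_t u\in L^\infty((0,T),L^2(\Omega))$. That is, there is at most one function $u$ with $u \in L^\infty((0,T),H^1_0(\Omega))\cap C([0,T],L^2(\Omega))$, $\partial_t u \in L^\infty((0,T),L^2(\Omega))$, $\partial_t\left(g_\alpha \ast (\partial_t u - V_0)\right) \in L^2((0,T),H^1_0(\Omega)^\ast)$ and $u(0)=U_0$, such that for a.a. $t\in(0,T)$ $$\rho c\, \tau_q^\alpha \left\langle \partial_t\left(g_\alpha\ast(\partial_t u - V_0)\right)(t),\varphi\right\rangle + a \tau_q^\alpha \left((g_\alpha\ast \partial_t u)(t),\varphi\right) + \rho c \left(\partial_t u(t),\varphi\right) + \mathcal{L}(u(t),\varphi) = (F(t),\varphi)$$ for all $\varphi\in H^1_0(\Omega)$.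
   Context: Setting: $\Omega\subset\mathbb{R}^d$ ($d\in\mathbb{N}$) is a bounded domain with Lipschitz continuous boundary, $T>0$, $\alpha\in(0,1)$, $\rho,c,\tau_q>0$ and $a\ge 0$ are constants. $\boldsymbol{k}=(k_{i,j}(x))\in (L^\infty(\Omega))^{d\times d}$ is a symmetric matrix-valued function that is uniformly elliptic: there is $\widetilde{k}>0$ with $\xi^\top \boldsymbol{k}(x)\xi\ge \widetilde{k}|\xi|^2$ for all $x\in\Omega$, $\xi\in\mathbb{R}^d$. Notation: $(\cdot,\cdot)$ is the $L^2(\Omega)$ inner product (also for vector-valued functions), $\langle\cdot,\cdot\rangle$ is the duality pairing between $H^1_0(\Omega)^\ast$ and $H^1_0(\Omega)$, regarded as a continuous extension of $(\cdot,\cdot)$. $\mathcal{L}(u,\varphi):=(\boldsymbol{k}\nabla u,\nabla\varphi)+a(u,\varphi)$ for $u,\varphi\in H^1_0(\Omega)$. $g_\alpha(t)=\frac{t^{-\alpha}}{\Gamma(1-\alpha)}$ for $t>0$, and $(\kappa\ast z)(t)=\int_0^t\kappa(t-s)z(s)\,ds$. Time derivatives are weak derivatives in $t$. The equation is the weak form of the problem $\rho c\tau_q^\alpha \mathcal{D}_t^\alpha\partial_t u+a\tau_q^\alpha\mathcal{D}_t^\alpha u+\rho c\,\partial_t u+au-\nabla\cdot(\boldsymbol{k}\nabla u)=F$ in $\Omega\times(0,T]$, $u(\cdot,0)=U_0$, $\partial_t u(\cdot,0)=V_0$, with $u=0$ on $\partial\Omega\times(0,T]$, where $\mathcal{D}_t^\alpha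 f=\partial_t\left(g_\alpha\ast(f-f(0))\right)$ is the Caputo derivative. The initial velocity $V_0$ enters through the first term of the weak formulation. *)

theory Defs
  imports "HOL-Analysis.Analysis"
begin

section \<open>The space of square integrable functions\<close>

text \<open>
  The type \<open>('a, 'b) L2\<close> consists of the Lebesgue square integrable functions from
  \<open>'a\<close> to \<open>'b\<close> modulo equality almost everywhere. It is made an instance of
  \<^class>\<open>real_inner\<close>, \<^class>\<open>banach\<close> and \<^class>\<open>second_countable_topology\<close>, so that the
  Bochner integral of the library applies to functions with values in it.
\<close>

definition square_integrable :: "('a::euclidean_space \<Rightarrow> 'b::euclidean_space) \<Rightarrow> bool" where
  "square_integrable f \<longleftrightarrow>
     f \<in> borel_measurable lebesgue \<and> integrable lebesgue (\<lambda>x. (norm (f x))\<^sup>2)"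

lemma square_integrable_inner:
  assumes "square_integrable f" "square_integrable g"
  shows "integrable lebesgue (\<lambda>x. f x \<bullet> g x)"
proof (rule Bochner_Integration.integrable_bound)
  show "integrable lebesgue (\<lambda>x. (norm (f x))\<^sup>2 + (norm (g x))\<^sup>2)"
    using assms by (auto simp: square_integrable_def)
  show "(\<lambda>x. f x \<bullet> g x) \<in> borel_measurable lebesgue"
    using assms by (auto simp: square_integrable_def)
  have "\<bar>f x \<bullet> g x\<bar> \<le> (norm (f x))\<^sup>2 + (norm (g x))\<^sup>2" for x
  proof -
    have "\<bar>f x \<bullet> g x\<bar> \<le> norm (f x) * norm (g x)" by (rule Cauchy_Schwarz_ineq2)
    moreover have "2 * norm (f x) * norm (g x) \<le> (norm (f x))\<^sup>2 + (norm (g x))\<^sup>2"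
      by (rule sum_squares_bound)
    moreover have "0 \<le> norm (f x) * norm (g x)" by simp
    ultimately show ?thesis by linarith
  qed
  then show "AE x in lebesgue. norm (f x \<bullet> g x) \<le> norm ((norm (f x))\<^sup>2 + (norm (g x))\<^sup>2)"
    by simp
qed

lemma square_integrable_zero: "square_integrable (\<lambda>x. 0)"
  by (simp add: square_integrable_def)

lemma square_integrable_scaleR:
  "square_integrable f \<Longrightarrow> square_integrable (\<lambda>x. c *\<^sub>R f x)"
  by (auto simp: square_integrable_def power_mult_distrib intro!: borel_measurable_scaleR)

lemma square_integrable_add:
  assumes "square_integrable f" "square_integrable g"
  shows "square_integrable (\<lambda>x. f x + g x)"
proof -
  have "integrable lebesgue (\<lambda>x. (norm (f x))\<^sup>2 + (norm (g x))\<^sup>2 + 2 * (f x \<bullet> g x))"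
    using assms square_integrable_inner[OF assms]
    by (auto simp: square_integrable_def)
  moreover have "(norm (f x + g x))\<^sup>2 = (norm (f x))\<^sup>2 + (norm (g x))\<^sup>2 + 2 * (f x \<bullet> g x)" for x
    by (simp add: power2_norm_eq_inner inner_add_left inner_add_right inner_commute)
  ultimately show ?thesis
    using assms by (auto simp: square_integrable_def)
qed

lemma square_integrable_uminus: "square_integrable f \<Longrightarrow> square_integrable (\<lambda>x. - f x)"
  by (simp add: square_integrable_def)

lemma square_integrable_diff:
  assumes "square_integrable f" "square_integrable g"
  shows "square_integrable (\<lambda>x. f x - g x)"
  using square_integrable_add[OF assms(1) square_integrable_uminus[OF assms(2)]] by simp

definition L2_rel :: "('a::euclidean_space \<Rightarrow> 'b::euclidean_space) \<Rightarrow> ('a \<Rightarrow> 'b) \<Rightarrow> bool" where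
  "L2_rel f g \<longleftrightarrow> square_integrable f \<and> square_integrable g \<and> (AE x in lebesgue. f x = g x)"

quotient_type (overloaded) ('a, 'b) L2 = "'a::euclidean_space \<Rightarrow> 'b::euclidean_space"
  / partial: L2_rel
proof (rule part_equivpI)
  show "\<exists>x::'a \<Rightarrow> 'b. L2_rel x x"
    using square_integrable_zero by (auto simp: L2_rel_def)
  show "symp (L2_rel :: ('a \<Rightarrow> 'b) \<Rightarrow> _)"
    by (rule sympI) (auto simp: L2_rel_def)
  show "transp (L2_rel :: ('a \<Rightarrow> 'b) \<Rightarrow> _)"
    by (rule transpI) (auto simp: L2_rel_def elim: AE_mp)
qed

instantiation L2 :: (euclidean_space, euclidean_space) real_inner
begin

lift_definition zero_L2 :: "('a, 'b) L2" is "\<lambda>x. 0"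
  by (simp add: L2_rel_def square_integrable_zero)

lift_definition plus_L2 :: "('a, 'b) L2 \<Rightarrow> ('a, 'b) L2 \<Rightarrow> ('a, 'b) L2" is "\<lambda>f g x. f x + g x"
  by (auto simp: L2_rel_def square_integrable_add)

lift_definition uminus_L2 :: "('a, 'b) L2 \<Rightarrow> ('a, 'b) L2" is "\<lambda>f x. - f x"
  by (auto simp: L2_rel_def square_integrable_uminus)

lift_definition minus_L2 :: "('a, 'b) L2 \<Rightarrow> ('a, 'b) L2 \<Rightarrow> ('a, 'b) L2" is "\<lambda>f g x. f x - g x"
  by (auto simp: L2_rel_def square_integrable_diff)

lift_definition scaleR_L2 :: "real \<Rightarrow> ('a, 'b) L2 \<Rightarrow> ('a, 'b) L2" is "\<lambda>c f x. c *\<^sub>R f x"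
  by (auto simp: L2_rel_def square_integrable_scaleR)

lift_definition inner_L2 :: "('a, 'b) L2 \<Rightarrow> ('a, 'b) L2 \<Rightarrow> real"
  is "\<lambda>f g. LINT x|lebesgue. f x \<bullet> g x"
  by (rule integral_cong_AE)
     (auto simp: L2_rel_def square_integrable_def intro!: borel_measurable_inner)

definition norm_L2 :: "('a, 'b) L2 \<Rightarrow> real" where
  "norm_L2 x = sqrt (x \<bullet> x)"

definition dist_L2 :: "('a, 'b) L2 \<Rightarrow> ('a, 'b) L2 \<Rightarrow> real" where
  "dist_L2 x y = norm (x - y)"

definition sgn_L2 :: "('a, 'b) L2 \<Rightarrow> ('a, 'b) L2" where
  "sgn_L2 x = scaleR (inverse (norm x)) x"

definition uniformity_L2 :: "(('a, 'b) L2 \<times> ('a, 'b) L2) filter" where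
  "uniformity_L2 = (INF e\<in>{0<..}. principal {(x, y). dist x y < e})"

definition open_L2 :: "('a, 'b) L2 set \<Rightarrow> bool" where
  "open_L2 U = (\<forall>x\<in>U. \<forall>\<^sub>F (x', y) in uniformity. x' = x \<longrightarrow> y \<in> U)"

instance
proof
  fix a b c :: "('a, 'b) L2" and r s :: real and U :: "('a, 'b) L2 set"
  show "a + b + c = a + (b + c)"
    by transfer (auto simp: L2_rel_def square_integrable_add add.assoc)
  show "a + b = b + a"
    by transfer (auto simp: L2_rel_def square_integrable_add add.commute)
  show "0 + a = a"
    by transfer (auto simp: L2_rel_def)
  show "- a + a = 0"
    by transfer (auto simp: L2_rel_def square_integrable_zero)
  show "a - b = a + - b"
    by transfer (auto simp: L2_rel_def square_integrable_diff)
  show "scaleR r (a + b) = scaleR r a + scaleR r b"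
    by transfer (auto simp: L2_rel_def square_integrable_add square_integrable_scaleR scaleR_add_right)
  show "scaleR (r + s) a = scaleR r a + scaleR s a"
    by transfer (auto simp: L2_rel_def square_integrable_add square_integrable_scaleR scaleR_add_left)
  show "scaleR r (scaleR s a) = scaleR (r * s) a"
    by transfer (auto simp: L2_rel_def square_integrable_scaleR)
  show "scaleR 1 a = a"
    by transfer (auto simp: L2_rel_def)
  show "dist a b = norm (a - b)" by (simp add: dist_L2_def)
  show "sgn a = scaleR (inverse (norm a)) a" by (simp add: sgn_L2_def)
  show "(uniformity :: (('a, 'b) L2 \<times> _) filter) = (INF e\<in>{0<..}. principal {(x, y). dist x y < e})"
    by (rule uniformity_L2_def)
  show "open U = (\<forall>x\<in>U. \<forall>\<^sub>F (x', y) in uniformity. x' = x \<longrightarrow> y \<in> U)"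
    by (rule open_L2_def)
  show "a \<bullet> b = b \<bullet> a"
    by transfer (simp add: inner_commute)
  show "(a + b) \<bullet> c = a \<bullet> c + b \<bullet> c"
    by transfer (auto simp: L2_rel_def inner_add_left square_integrable_inner
        intro!: Bochner_Integration.integral_add)
  show "inner (scaleR r a) b = r * (a \<bullet> b)"
    by transfer (auto simp: L2_rel_def)
  show "0 \<le> a \<bullet> a"
    by transfer (auto intro!: Bochner_Integration.integral_nonneg)
  show "(a \<bullet> a = 0) = (a = 0)"
  proof transfer
    fix f :: "'a \<Rightarrow> 'b" assume f: "L2_rel f f"
    then have "integrable lebesgue (\<lambda>x. f x \<bullet> f x)"
      by (auto simp: L2_rel_def intro: square_integrable_inner)
    then have "(LINT x|lebesgue. f x \<bullet> f x) = 0 \<longleftrightarrow> (AE x in lebesgue. f x \<bullet> f x = 0)"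
      by (intro integral_nonneg_eq_0_iff_AE) auto
    with f show "((LINT x|lebesgue. f x \<bullet> f x) = 0) = L2_rel f (\<lambda>x. 0)"
      by (auto simp: L2_rel_def square_integrable_zero)
  qed
  show "norm a = sqrt (a \<bullet> a)" by (rule norm_L2_def)
qed

end

lemma square_integrable_rep: "square_integrable (rep_L2 f)"
  using Quotient_rep_reflp[OF Quotient_L2] by (auto simp: L2_rel_def)

lemma abs_rep_L2: "abs_L2 (rep_L2 f) = f"
  by (rule Quotient_abs_rep[OF Quotient_L2])

lemma rep_abs_L2:
  assumes "square_integrable f"
  shows "AE x in lebesgue. rep_L2 (abs_L2 f) x = f x"
  using Quotient_rep_abs[OF Quotient_L2, of f] assms by (auto simp: L2_rel_def)

lemma L2_eq_iff: "f = g \<longleftrightarrow> (AE x in lebesgue. rep_L2 f x = rep_L2 g x)"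
proof -
  have "f = g \<longleftrightarrow> L2_rel (rep_L2 f) (rep_L2 g)"
    using Quotient_rel_rep[OF Quotient_L2] by metis
  then show ?thesis by (simp add: L2_rel_def square_integrable_rep)
qed

lemma inner_L2_eq: "f \<bullet> g = (LINT x|lebesgue. rep_L2 f x \<bullet> rep_L2 g x)"
  using inner_L2.rep_eq by metis

lemma rep_L2_minus: "AE x in lebesgue. rep_L2 (f - g) x = rep_L2 f x - rep_L2 g x"
proof -
  have "f - g = abs_L2 (\<lambda>x. rep_L2 f x - rep_L2 g x)"
    using minus_L2.abs_eq[of "rep_L2 f" "rep_L2 g"]
    by (simp add: L2_rel_def square_integrable_rep abs_rep_L2)
  then show ?thesis
    using rep_abs_L2[OF square_integrable_diff[OF square_integrable_rep square_integrable_rep]]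
    by metis
qed

lemma dist_abs_L2:
  assumes "square_integrable f" "square_integrable g"
  shows "(dist (abs_L2 f) (abs_L2 g))\<^sup>2 = (LINT x|lebesgue. (norm (f x - g x))\<^sup>2)"
proof -
  have d: "square_integrable (\<lambda>x. f x - g x)"
    using assms by (rule square_integrable_diff)
  have "abs_L2 f - abs_L2 g = abs_L2 (\<lambda>x. f x - g x)"
    using assms by (intro minus_L2.abs_eq) (auto simp: L2_rel_def)
  moreover have "abs_L2 (\<lambda>x. f x - g x) \<bullet> abs_L2 (\<lambda>x. f x - g x)
      = (LINT x|lebesgue. (f x - g x) \<bullet> (f x - g x))"
    using d by (intro inner_L2.abs_eq) (auto simp: L2_rel_def)
  ultimately show ?thesis
    by (simp add: dist_norm power2_norm_eq_inner)
qed

lemma square_integrableI_nn_integral: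
  assumes "f \<in> borel_measurable lebesgue"
    and "(\<integral>\<^sup>+x. ennreal ((norm (f x))\<^sup>2) \<partial>lebesgue) < \<infinity>"
  shows "square_integrable f"
  using assms by (auto simp: square_integrable_def intro!: integrableI_bounded)

instance L2 :: (euclidean_space, euclidean_space) complete_space
proof
  fix X :: "nat \<Rightarrow> ('a, 'b) L2" assume X: "Cauchy X"
  have "\<forall>n. \<exists>N. \<forall>m\<ge>N. \<forall>k\<ge>N. dist (X m) (X k) < (1/4)^n"
    using X by (auto simp: Cauchy_def)
  then obtain N where N: "\<And>n m k. m \<ge> N n \<Longrightarrow> k \<ge> N n \<Longrightarrow> dist (X m) (X k) < (1/4)^n"
    by metis
  define r where "r n = (\<Sum>i\<le>n. Suc (N i))" for n
  have r_mono: "strict_mono r"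
    by (rule strict_monoI_Suc) (simp add: r_def)
  have r_ge: "r n \<ge> N n" for n
    by (cases n) (auto simp: r_def)
  have close: "dist (X (r m)) (X (r n)) < (1/4)^n" if "m \<ge> n" for m n
    using N[of n "r m" "r n"] r_ge[of n] strict_mono_leD[OF r_mono that] by linarith
  define f where "f n = rep_L2 (X (r n))" for n
  have sq: "square_integrable (f n)" for n
    by (simp add: f_def square_integrable_rep)
  have [measurable]: "f n \<in> borel_measurable lebesgue" for n
    using sq by (simp add: square_integrable_def)
  have nn: "(\<integral>\<^sup>+x. ennreal ((norm (f m x - f n x))\<^sup>2) \<partial>lebesgue) \<le> ennreal ((1/16)^n)"
    if "m \<ge> n" for m n
  proof -
    have "(\<integral>\<^sup>+x. ennreal ((norm (f m x - f n x))\<^sup>2) \<partial>lebesgue)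
        = ennreal (LINT x|lebesgue. (norm (f m x - f n x))\<^sup>2)"
      using square_integrable_diff[OF sq sq, of m n]
      by (intro nn_integral_eq_integral) (auto simp: square_integrable_def)
    also have "(LINT x|lebesgue. (norm (f m x - f n x))\<^sup>2) = (dist (X (r m)) (X (r n)))\<^sup>2"
      using dist_abs_L2[OF sq sq, of m n] by (simp add: f_def abs_rep_L2)
    also have "(dist (X (r m)) (X (r n)))\<^sup>2 \<le> ((1/4)^n)\<^sup>2"
      using close[OF that] by (intro power_mono) auto
    also have "((1/4)^n)\<^sup>2 = ((1/16)^n :: real)"
      by (simp add: power_mult_distrib[symmetric] power2_eq_square)
    finally show ?thesis by (simp add: ennreal_leI)
  qed
  have "(\<integral>\<^sup>+x. (\<Sum>n. ennreal (4^n * (norm (f (Suc n) x - f n x))\<^sup>2)) \<partial>lebesgue)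
      = (\<Sum>n. \<integral>\<^sup>+x. ennreal (4^n * (norm (f (Suc n) x - f n x))\<^sup>2) \<partial>lebesgue)"
    by (rule nn_integral_suminf) measurable
  also have "\<dots> \<le> (\<Sum>n. ennreal ((1/4)^n))"
  proof (rule suminf_le)
    fix n
    have "(\<integral>\<^sup>+x. ennreal (4^n * (norm (f (Suc n) x - f n x))\<^sup>2) \<partial>lebesgue)
        = ennreal (4^n) * (\<integral>\<^sup>+x. ennreal ((norm (f (Suc n) x - f n x))\<^sup>2) \<partial>lebesgue)"
      by (simp add: ennreal_mult' nn_integral_cmult)
    also have "\<dots> \<le> ennreal (4^n) * ennreal ((1/16)^n)"
      by (intro mult_left_mono nn) auto
    also have "\<dots> = ennreal ((1/4)^n)"
      by (simp add: ennreal_mult'[symmetric] power_mult_distrib[symmetric])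
    finally show "(\<integral>\<^sup>+x. ennreal (4^n * (norm (f (Suc n) x - f n x))\<^sup>2) \<partial>lebesgue)
        \<le> ennreal ((1/4)^n)" .
  qed auto
  also have "\<dots> < \<infinity>"
  proof -
    have "summable (\<lambda>n. (1/4)^n :: real)" by (rule summable_geometric) simp
    then have "(\<Sum>n. ennreal ((1/4)^n)) \<noteq> top" by (rule ennreal_suminf_neq_top) simp
    then show ?thesis by (metis infinity_ennreal_def less_top)
  qed
  finally have "AE x in lebesgue. (\<Sum>n. ennreal (4^n * (norm (f (Suc n) x - f n x))\<^sup>2)) \<noteq> \<infinity>"
    by (intro nn_integral_noteq_infinite) auto
  then have conv: "AE x in lebesgue. convergent (\<lambda>n. f n x)"
  proof (rule AE_mp, intro AE_I2 impI)
    fix x assume fin: "(\<Sum>n. ennreal (4^n * (norm (f (Suc n) x - f n x))\<^sup>2)) \<noteq> \<infinity>"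
    define C where "C = enn2real (\<Sum>n. ennreal (4^n * (norm (f (Suc n) x - f n x))\<^sup>2))"
    have C: "C \<ge> 0" "(\<Sum>n. ennreal (4^n * (norm (f (Suc n) x - f n x))\<^sup>2)) = ennreal C"
      unfolding C_def using fin by (simp_all only: enn2real_nonneg infinity_ennreal_def
          less_top ennreal_enn2real)
    have bound: "norm (f (Suc n) x - f n x) \<le> sqrt C * (1/2)^n" for n
    proof -
      have "ennreal (4^n * (norm (f (Suc n) x - f n x))\<^sup>2) \<le> ennreal C"
        using sum_le_suminf[of "\<lambda>n. ennreal (4^n * (norm (f (Suc n) x - f n x))\<^sup>2)" "{n}"] C
        by auto
      then have "4^n * (norm (f (Suc n) x - f n x))\<^sup>2 \<le> C"
        using C by simp
      moreover have "(2^n * norm (f (Suc n) x - f n x))\<^sup>2 = 4^n * (norm (f (Suc n) x - f n x))\<^sup>2"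
        by (simp add: power_mult_distrib power_mult[symmetric] mult.commute[of n] power_mult[of "2::real" 2])
      ultimately have "(2^n * norm (f (Suc n) x - f n x))\<^sup>2 \<le> C" by simp
      then have "2^n * norm (f (Suc n) x - f n x) \<le> sqrt C"
        by (rule real_le_rsqrt)
      then show ?thesis
        by (simp add: power_one_over field_simps)
    qed
    have "summable (\<lambda>n. sqrt C * (1/2)^n)"
      by (intro summable_mult summable_geometric) auto
    then have "summable (\<lambda>n. f (Suc n) x - f n x)"
      by (rule summable_comparison_test') (rule bound)
    then have "convergent (\<lambda>n. \<Sum>i<n. f (Suc i) x - f i x)"
      by (simp add: summable_iff_convergent)
    then have "convergent (\<lambda>n. (f n x - f 0 x) + f 0 x)"
      by (intro convergent_add convergent_const) (simp only: sum_lessThan_telescope[of "\<lambda>n. f n x"])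
    then show "convergent (\<lambda>n. f n x)" by simp
  qed
  define g where "g x = lim (\<lambda>n. f n x)" for x
  have [measurable]: "g \<in> borel_measurable lebesgue"
    unfolding g_def by measurable
  have lim: "AE x in lebesgue. (\<lambda>n. f n x) \<longlonglongrightarrow> g x"
    using conv by (auto simp: g_def convergent_LIMSEQ_iff)
  have nn_g: "(\<integral>\<^sup>+x. ennreal ((norm (g x - f n x))\<^sup>2) \<partial>lebesgue) \<le> ennreal ((1/16)^n)" for n
  proof -
    have "AE x in lebesgue. ennreal ((norm (g x - f n x))\<^sup>2)
        = liminf (\<lambda>m. ennreal ((norm (f m x - f n x))\<^sup>2))"
      using lim
    proof (rule AE_mp, intro AE_I2 impI)
      fix x assume "(\<lambda>n. f n x) \<longlonglongrightarrow> g x"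
      then have "(\<lambda>m. ennreal ((norm (f m x - f n x))\<^sup>2)) \<longlonglongrightarrow> ennreal ((norm (g x - f n x))\<^sup>2)"
        by (intro tendsto_intros)
      then show "ennreal ((norm (g x - f n x))\<^sup>2)
          = liminf (\<lambda>m. ennreal ((norm (f m x - f n x))\<^sup>2))"
        by (intro lim_imp_Liminf[symmetric]) auto
    qed
    then have "(\<integral>\<^sup>+x. ennreal ((norm (g x - f n x))\<^sup>2) \<partial>lebesgue)
        = (\<integral>\<^sup>+x. liminf (\<lambda>m. ennreal ((norm (f m x - f n x))\<^sup>2)) \<partial>lebesgue)"
      by (rule nn_integral_cong_AE)
    also have "\<dots> \<le> liminf (\<lambda>m. \<integral>\<^sup>+x. ennreal ((norm (f m x - f n x))\<^sup>2) \<partial>lebesgue)"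
      by (rule nn_integral_liminf) measurable
    also have "\<dots> \<le> ennreal ((1/16)^n)"
      by (rule Liminf_le) (auto simp: eventually_sequentially intro!: exI[of _ n] nn)
    finally show ?thesis .
  qed
  have "square_integrable (\<lambda>x. g x - f n x)" for n
    using nn_g[of n] by (intro square_integrableI_nn_integral) (auto intro: le_less_trans)
  from square_integrable_add[OF this sq, of 0 0] have g: "square_integrable g"
    by simp
  have "dist (X (r n)) (abs_L2 g) \<le> (1/4)^n" for n
  proof -
    have "(dist (abs_L2 g) (X (r n)))\<^sup>2 = (LINT x|lebesgue. (norm (g x - f n x))\<^sup>2)"
      using dist_abs_L2[OF g sq, of n] by (simp add: f_def abs_rep_L2)
    also have "\<dots> \<le> (1/16)^n"
    proof -
      have "ennreal (LINT x|lebesgue. (norm (g x - f n x))\<^sup>2)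
          = (\<integral>\<^sup>+x. ennreal ((norm (g x - f n x))\<^sup>2) \<partial>lebesgue)"
        using square_integrable_diff[OF g sq, of n]
        by (intro nn_integral_eq_integral[symmetric]) (auto simp: square_integrable_def)
      with nn_g[of n] have "ennreal (LINT x|lebesgue. (norm (g x - f n x))\<^sup>2) \<le> ennreal ((1/16)^n)"
        by (simp only:)
      then show ?thesis by (subst (asm) ennreal_le_iff) auto
    qed
    also have "\<dots> = ((1/4)^n)\<^sup>2"
      by (simp add: power_mult_distrib[symmetric] power2_eq_square)
    finally show ?thesis
      by (subst dist_commute) (rule power2_le_imp_le, auto)
  qed
  then have "(\<lambda>n. dist (X (r n)) (abs_L2 g)) \<longlonglongrightarrow> 0"
    by (intro tendsto_sandwich[OF _ _ tendsto_const LIMSEQ_realpow_zero[of "1/4"]]) auto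
  then have "(X \<circ> r) \<longlonglongrightarrow> abs_L2 g"
    by (simp add: tendsto_dist_iff[symmetric] o_def)
  with X r_mono have "X \<longlonglongrightarrow> abs_L2 g"
    by (rule Cauchy_converges_subseq)
  then show "convergent X" by (auto simp: convergent_def)
qed

instance L2 :: (euclidean_space, euclidean_space) banach ..

lemma tendsto_abs_L2:
  fixes f :: "'a::euclidean_space \<Rightarrow> 'b::euclidean_space"
    and w :: "'a \<Rightarrow> 'c::euclidean_space"
  assumes F: "\<And>i. square_integrable (F i)" and f: "square_integrable f"
    and w: "square_integrable w" and bound: "\<And>i x. norm (F i x - f x) \<le> norm (w x)"
    and lim: "\<And>x. (\<lambda>i. F i x) \<longlonglongrightarrow> f x"
  shows "(\<lambda>i. abs_L2 (F i)) \<longlonglongrightarrow> abs_L2 f"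
proof -
  have [measurable]: "F i \<in> borel_measurable lebesgue" "f \<in> borel_measurable lebesgue" for i
    using F f by (auto simp: square_integrable_def)
  have "(\<lambda>i. LINT x|lebesgue. (norm (F i x - f x))\<^sup>2) \<longlonglongrightarrow> (LINT x|(lebesgue :: 'a measure). (0::real))"
  proof (rule integral_dominated_convergence[where w = "\<lambda>x. (norm (w x))\<^sup>2"])
    show "integrable lebesgue (\<lambda>x. (norm (w x))\<^sup>2)"
      using w by (simp add: square_integrable_def)
    show "AE x in lebesgue. (\<lambda>i. (norm (F i x - f x))\<^sup>2) \<longlonglongrightarrow> 0"
    proof (rule AE_I2)
      fix x
      have "(\<lambda>i. (norm (F i x - f x))\<^sup>2) \<longlonglongrightarrow> (norm (f x - f x))\<^sup>2"
        by (intro tendsto_intros lim)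
      then show "(\<lambda>i. (norm (F i x - f x))\<^sup>2) \<longlonglongrightarrow> 0" by simp
    qed
    show "AE x in lebesgue. norm ((norm (F i x - f x))\<^sup>2) \<le> (norm (w x))\<^sup>2" for i
      by (auto intro!: AE_I2 power_mono bound)
  qed measurable
  then have "(\<lambda>i. (dist (abs_L2 (F i)) (abs_L2 f))\<^sup>2) \<longlonglongrightarrow> 0"
    by (simp add: dist_abs_L2 F f)
  then have "(\<lambda>i. sqrt ((dist (abs_L2 (F i)) (abs_L2 f))\<^sup>2)) \<longlonglongrightarrow> sqrt 0"
    by (rule tendsto_real_sqrt)
  then show ?thesis
    by (subst tendsto_dist_iff) simp
qed

lemma square_integrable_indicator:
  assumes "A \<in> lmeasurable"
  shows "square_integrable (\<lambda>x. indicator A x *\<^sub>R b)"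
proof -
  have "(\<lambda>x. (norm (indicator A x *\<^sub>R b))\<^sup>2) = (\<lambda>x. indicator A x * (norm b)\<^sup>2)"
    by (auto simp: indicator_def)
  moreover have "integrable lebesgue (\<lambda>x. indicator A x * (norm b)\<^sup>2)"
    using assms by (intro integrable_mult_left) (auto simp: fmeasurable_def integrable_real_indicator)
  moreover have "(\<lambda>x. indicator A x *\<^sub>R b) \<in> borel_measurable lebesgue"
    using assms by (intro borel_measurable_scaleR borel_measurable_indicator) auto
  ultimately show ?thesis by (simp add: square_integrable_def)
qed

definition rational_combinations :: "'a::real_vector set \<Rightarrow> 'a set" where
  "rational_combinations S = (\<lambda>l. \<Sum>(q, s)\<leftarrow>l. q *\<^sub>R s) ` lists (\<rat> \<times> S)"

lemma countable_rational_combinations: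
  "countable S \<Longrightarrow> countable (rational_combinations S)"
  by (auto simp: rational_combinations_def intro!: countable_image countable_lists countable_SIGMA countable_rat)

lemma subset_rational_combinations: "S \<subseteq> rational_combinations S"
proof
  fix s assume "s \<in> S"
  then have "[(1, s)] \<in> lists (\<rat> \<times> S)" by auto
  then have "(\<Sum>(q, s)\<leftarrow>[(1, s)]. q *\<^sub>R s) \<in> rational_combinations S"
    unfolding rational_combinations_def by (rule imageI)
  then show "s \<in> rational_combinations S" by simp
qed

lemma subspace_closure_rational_combinations:
  fixes S :: "'a::real_normed_vector set"
  shows "subspace (closure (rational_combinations S))"
proof (rule subspaceI)
  let ?D = "rational_combinations S"
  have "(\<Sum>(q, s)\<leftarrow>[]. q *\<^sub>R s) \<in> ?D"
    unfolding rational_combinations_def by (rule imageI) auto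
  then show "0 \<in> closure ?D"
    using closure_subset by fastforce
  have add: "x + y \<in> ?D" if "x \<in> ?D" "y \<in> ?D" for x y
  proof -
    from that obtain l m where lm: "l \<in> lists (\<rat> \<times> S)" "m \<in> lists (\<rat> \<times> S)"
      "x = (\<Sum>(q, s)\<leftarrow>l. q *\<^sub>R s)" "y = (\<Sum>(q, s)\<leftarrow>m. q *\<^sub>R s)"
      by (auto simp: rational_combinations_def)
    then have "x + y = (\<Sum>(q, s)\<leftarrow>l @ m. q *\<^sub>R s)" "l @ m \<in> lists (\<rat> \<times> S)" by auto
    then show ?thesis unfolding rational_combinations_def by blast
  qed
  have scale: "p *\<^sub>R x \<in> ?D" if "x \<in> ?D" "p \<in> \<rat>" for x p
  proof -
    from that obtain l where l: "l \<in> lists (\<rat> \<times> S)" "x = (\<Sum>(q, s)\<leftarrow>l. q *\<^sub>R s)"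
      by (auto simp: rational_combinations_def)
    have "p *\<^sub>R (\<Sum>(q, s)\<leftarrow>l. q *\<^sub>R s) = (\<Sum>(q, s)\<leftarrow>map (\<lambda>(q, s). (p * q, s)) l. q *\<^sub>R s)"
      by (induction l) (auto simp: scaleR_add_right)
    moreover have "map (\<lambda>(q, s). (p * q, s)) l \<in> lists (\<rat> \<times> S)"
      using l(1) \<open>p \<in> \<rat>\<close> by (induction l) auto
    ultimately show ?thesis unfolding rational_combinations_def using l(2) by blast
  qed
  show "x + y \<in> closure ?D" if xy: "x \<in> closure ?D" "y \<in> closure ?D" for x y
  proof -
    from xy obtain s t where "\<And>n. s n \<in> ?D" "s \<longlonglongrightarrow> x" "\<And>n. t n \<in> ?D" "t \<longlonglongrightarrow> y"
      by (auto simp: closure_sequential)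
    then show ?thesis
      unfolding closure_sequential
      by (intro exI[of _ "\<lambda>n. s n + t n"]) (auto intro: add tendsto_add)
  qed
  show "c *\<^sub>R x \<in> closure ?D" if x: "x \<in> closure ?D" for c x
  proof -
    from x obtain s where s: "\<And>n. s n \<in> ?D" "s \<longlonglongrightarrow> x"
      by (auto simp: closure_sequential)
    have "c \<in> closure \<rat>" by (simp add: Rats_closure_real)
    then obtain p where "\<And>n. p n \<in> \<rat>" "p \<longlonglongrightarrow> c"
      by (auto simp: closure_sequential)
    with s show ?thesis
      unfolding closure_sequential
      by (intro exI[of _ "\<lambda>n. p n *\<^sub>R s n"]) (auto intro: scale tendsto_scaleR)
  qed
qed

lemma L2_countable_dense:
  "\<exists>D :: ('a::euclidean_space, 'b::euclidean_space) L2 set. countable D \<and> closure D = UNIV"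
proof -
  obtain \<B> :: "'a set set" where \<B>: "countable \<B>" "topological_basis \<B>"
    using ex_countable_basis by blast
  define I where "I A b = abs_L2 (\<lambda>x. indicator A x *\<^sub>R b)" for A :: "'a set" and b :: 'b
  define S where "S = (\<lambda>(F, b). I (\<Union>F) b) ` ({F. finite F \<and> F \<subseteq> \<B>} \<times> Basis)"
  define W where "W = closure (rational_combinations S)"
  have "countable S"
    unfolding S_def using \<B>(1)
    by (intro countable_image countable_SIGMA countable_Collect_finite_subset)
       (auto intro: countable_finite)
  have W: "subspace W" "closed W"
    unfolding W_def by (rule subspace_closure_rational_combinations) simp
  have S_W: "S \<subseteq> W"
    unfolding W_def using subset_rational_combinations closure_subset by blast
  have open_W: "I U b \<in> W" if U: "open U" "U \<in> lmeasurable" and b: "b \<in> Basis" for U b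
  proof -
    obtain C where C: "C \<subseteq> \<B>" "U = \<Union>C"
      using \<B>(2) U(1) by (auto simp: topological_basis_def)
    show ?thesis
    proof (cases "C = {}")
      case True
      then have "I U b = I (\<Union>{}) b" using C by simp
      also have "\<dots> \<in> S" unfolding S_def using b by (intro image_eqI[of _ _ "({}, b)"]) auto
      finally show ?thesis using S_W by blast
    next
      case False
      have "countable C" using C(1) \<B>(1) by (rule countable_subset)
      define V where "V n = \<Union>(from_nat_into C ` {..<n})" for n
      have V_sub: "V n \<subseteq> U" for n
        unfolding V_def using C(2) from_nat_into[OF False] by blast
      have V_open: "open (V n)" for n
        unfolding V_def using C(1) from_nat_into[OF False] topological_basis_open[OF \<B>(2)]
        by (intro open_Union) auto
      have V_meas: "V n \<in> lmeasurable" for n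
        using V_sub[of n] U(2) V_open[of n] by (meson fmeasurableI2 lborelD borel_open sets_completionI_sets)
      have "(\<lambda>n. I (V n) b) \<longlonglongrightarrow> I U b"
        unfolding I_def
      proof (rule tendsto_abs_L2[where w = "\<lambda>x. indicator U x *\<^sub>R b"])
        show "norm (indicator (V i) x *\<^sub>R b - indicator U x *\<^sub>R b) \<le> norm (indicator U x *\<^sub>R b)" for i x
          using V_sub[of i] by (auto simp: indicator_def)
        show "(\<lambda>i. indicator (V i) x *\<^sub>R b) \<longlonglongrightarrow> indicator U x *\<^sub>R b" for x
        proof (cases "x \<in> U")
          case True
          then obtain B where B: "B \<in> C" "x \<in> B" using C(2) by blast
          then obtain k where "from_nat_into C k = B"
            using from_nat_into_surj[OF \<open>countable C\<close> B(1)] by metis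
          then have "x \<in> V n" if "n \<ge> Suc k" for n
            unfolding V_def using that B by (auto intro!: bexI[of _ k])
          then show ?thesis
            using True by (intro tendsto_eventually)
              (auto simp: eventually_sequentially indicator_def intro!: exI[of _ "Suc k"])
        next
          case False
          then have "x \<notin> V n" for n using V_sub by blast
          then show ?thesis using False by simp
        qed
      qed (intro square_integrable_indicator V_meas U(2))+
      moreover have "I (V n) b \<in> W" for n
      proof -
        have "from_nat_into C ` {..<n} \<subseteq> \<B>"
          using C(1) from_nat_into[OF False] by blast
        then have "I (V n) b \<in> S"
          unfolding S_def V_def using b
          by (intro image_eqI[of _ _ "(from_nat_into C ` {..<n}, b)"]) auto
        then show ?thesis using S_W by blast
      qed
      ultimately show ?thesis
        by - (rule closed_sequentially[OF W(2), of "\<lambda>n. I (V n) b"])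
    qed
  qed
  have meas_W: "I A b \<in> W" if A: "A \<in> lmeasurable" and b: "b \<in> Basis" for A b
  proof -
    have "\<exists>y\<in>W. dist y (I A b) < e" if "e > 0" for e
    proof -
      obtain U where U: "open U" "A \<subseteq> U" "U - A \<in> lmeasurable"
        "emeasure lebesgue (U - A) < ennreal (e\<^sup>2)"
        using sets_lebesgue_outer_open[of A "e\<^sup>2"] A \<open>e > 0\<close> by (auto simp: fmeasurable_def)
      have "U = A \<union> (U - A)" using U(2) by blast
      then have Um: "U \<in> lmeasurable"
        using fmeasurable.Un[OF A U(3)] by simp
      have "(dist (I U b) (I A b))\<^sup>2
          = (LINT x|lebesgue. (norm (indicator U x *\<^sub>R b - indicator A x *\<^sub>R b))\<^sup>2)"
        unfolding I_def by (intro dist_abs_L2 square_integrable_indicator A Um)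
      also have "(\<lambda>x. (norm (indicator U x *\<^sub>R b - indicator A x *\<^sub>R b))\<^sup>2) = indicator (U - A)"
        using U(2) b by (auto simp: indicator_def fun_eq_iff)
      also have "(LINT x|lebesgue. indicator (U - A) x) = measure lebesgue (U - A)"
        by simp
      also have "\<dots> < e\<^sup>2"
        using U(3,4) \<open>e > 0\<close> by (simp add: emeasure_eq_measure2 ennreal_less_iff)
      finally have "dist (I U b) (I A b) < e"
        by (rule power_less_imp_less_base) (use \<open>e > 0\<close> in simp)
      then show ?thesis by (rule bexI) (rule open_W[OF U(1) Um b])
    qed
    then have "I A b \<in> closure W" by (simp add: closure_approachable)
    then show ?thesis using W(2) by simp
  qed
  have "f \<in> W" for f
  proof -
    have sq: "square_integrable (rep_L2 f)" by (rule square_integrable_rep)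
    then have "rep_L2 f \<in> borel_measurable lebesgue" by (simp add: square_integrable_def)
    from borel_measurable_implies_sequence_metric[OF this, of 0]
    obtain s where s: "\<And>i. simple_function lebesgue (s i)" "\<And>x. (\<lambda>i. s i x) \<longlonglongrightarrow> rep_L2 f x"
      "\<And>i x. norm (s i x) \<le> 2 * norm (rep_L2 f x)"
      by auto
    have s_meas: "s i \<in> borel_measurable lebesgue" for i
      using s(1) by (rule borel_measurable_simple_function)
    have s_sq: "square_integrable (s i)" for i
      unfolding square_integrable_def
    proof
      show "integrable lebesgue (\<lambda>x. (norm (s i x))\<^sup>2)"
      proof (rule Bochner_Integration.integrable_bound)
        show "integrable lebesgue (\<lambda>x. (norm (2 *\<^sub>R rep_L2 f x))\<^sup>2)"
          using square_integrable_scaleR[OF sq, of 2] by (simp add: square_integrable_def)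
        show "AE x in lebesgue. norm ((norm (s i x))\<^sup>2) \<le> norm ((norm (2 *\<^sub>R rep_L2 f x))\<^sup>2)"
        proof (rule AE_I2)
          fix x
          have "norm (s i x) \<le> norm (2 *\<^sub>R rep_L2 f x)" using s(3)[of i x] by simp
          then have "(norm (s i x))\<^sup>2 \<le> (norm (2 *\<^sub>R rep_L2 f x))\<^sup>2" by (rule power_mono) simp
          then show "norm ((norm (s i x))\<^sup>2) \<le> norm ((norm (2 *\<^sub>R rep_L2 f x))\<^sup>2)"
            by (simp only: real_norm_def abs_of_nonneg zero_le_power2)
        qed
        show "(\<lambda>x. (norm (s i x))\<^sup>2) \<in> borel_measurable lebesgue"
          by (intro borel_measurable_power measurable_compose[OF s_meas borel_measurable_norm])
      qed
    qed (rule s_meas)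
    have s_W: "abs_L2 (s i) \<in> W" for i
    proof -
      let ?A = "\<lambda>y. s i -` {y}"
      have fin: "finite (range (s i))"
        using s(1)[of i] by (simp add: simple_function_def)
      have A: "?A y \<in> lmeasurable" if "y \<noteq> 0" for y
      proof -
        have m: "?A y \<in> sets lebesgue"
          using simple_functionD(2)[OF s(1), of i "{y}"] by simp
        have "integrable lebesgue (\<lambda>x. (norm (s i x))\<^sup>2 / (norm y)\<^sup>2)"
          using s_sq[of i] by (simp add: square_integrable_def)
        then have "integrable lebesgue (indicator (?A y) :: _ \<Rightarrow> real)"
          by (rule Bochner_Integration.integrable_bound)
             (use m that in \<open>auto simp: indicator_def intro!: borel_measurable_indicator\<close>)
        then show ?thesis
          using m by (auto simp: fmeasurable_def integrable_indicator_iff)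
      qed
      have repr: "s i = (\<lambda>x. \<Sum>y\<in>range (s i) - {0}. \<Sum>b\<in>Basis. (y \<bullet> b) *\<^sub>R (indicator (?A y) x *\<^sub>R b))"
      proof
        fix x
        have "(\<Sum>y\<in>range (s i) - {0}. \<Sum>b\<in>Basis. (y \<bullet> b) *\<^sub>R (indicator (?A y) x *\<^sub>R b))
            = (\<Sum>y\<in>range (s i) - {0}. if y = s i x then y else 0)"
          by (rule sum.cong) (auto simp: indicator_def euclidean_representation)
        also have "\<dots> = s i x"
          using fin by (simp add: sum.delta')
        finally show "s i x = (\<Sum>y\<in>range (s i) - {0}. \<Sum>b\<in>Basis.
            (y \<bullet> b) *\<^sub>R (indicator (?A y) x *\<^sub>R b))" ..
      qed
      have sum_abs: "square_integrable (\<lambda>x. \<Sum>j\<in>J. h j x)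
          \<and> abs_L2 (\<lambda>x. \<Sum>j\<in>J. h j x) = (\<Sum>j\<in>J. abs_L2 (h j))"
        if "finite J" "\<And>j. j \<in> J \<Longrightarrow> square_integrable (h j)"
        for J :: "'j set" and h :: "'j \<Rightarrow> 'a \<Rightarrow> 'b"
        using that
      proof (induction J rule: finite_induct)
        case empty
        then show ?case by (simp add: square_integrable_zero zero_L2_def)
      next
        case (insert j J)
        then have *: "square_integrable (h j)" "square_integrable (\<lambda>x. \<Sum>j\<in>J. h j x)" by auto
        then have "abs_L2 (h j) + abs_L2 (\<lambda>x. \<Sum>j\<in>J. h j x) = abs_L2 (\<lambda>x. h j x + (\<Sum>j\<in>J. h j x))"
          by (intro plus_L2.abs_eq) (auto simp: L2_rel_def)
        with insert * show ?case by (auto intro: square_integrable_add)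
      qed
      have scale_abs: "abs_L2 (\<lambda>x. c *\<^sub>R h x) = c *\<^sub>R abs_L2 h"
        if "square_integrable h" for c and h :: "'a \<Rightarrow> 'b"
        using that by (intro scaleR_L2.abs_eq[symmetric]) (auto simp: L2_rel_def)
      have sq1: "square_integrable (\<lambda>x. (y \<bullet> b) *\<^sub>R (indicator (?A y) x *\<^sub>R b))" if "y \<noteq> 0" for y b
        using A[OF that] by (intro square_integrable_scaleR square_integrable_indicator)
      have in1: "abs_L2 (\<lambda>x. (y \<bullet> b) *\<^sub>R (indicator (?A y) x *\<^sub>R b)) \<in> W"
        if "y \<noteq> 0" "b \<in> Basis" for y b
        using meas_W[OF A[OF that(1)] that(2)] W(1)
        by (subst scale_abs)
           (auto simp: I_def intro: square_integrable_indicator[OF A[OF that(1)]] subspace_scale)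
      let ?H = "\<lambda>(y, b) x. (y \<bullet> b) *\<^sub>R (indicator (?A y) x *\<^sub>R b)"
      let ?J = "(range (s i) - {0}) \<times> (Basis :: 'b set)"
      have "s i = (\<lambda>x. \<Sum>j\<in>?J. ?H j x)"
        by (subst repr) (simp add: sum.cartesian_product case_prod_unfold)
      moreover have "abs_L2 (\<lambda>x. \<Sum>j\<in>?J. ?H j x) = (\<Sum>j\<in>?J. abs_L2 (?H j))"
        using fin sq1 by (intro sum_abs[THEN conjunct2]) auto
      moreover have "(\<Sum>j\<in>?J. abs_L2 (?H j)) \<in> W"
        using in1 by (intro subspace_sum[OF W(1)]) auto
      ultimately show ?thesis by simp
    qed
    have "(\<lambda>i. abs_L2 (s i)) \<longlonglongrightarrow> abs_L2 (rep_L2 f)"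
    proof (rule tendsto_abs_L2[where w = "\<lambda>x. 3 *\<^sub>R rep_L2 f x"])
      show "norm (s i x - rep_L2 f x) \<le> norm (3 *\<^sub>R rep_L2 f x)" for i x
        using norm_triangle_ineq4[of "s i x" "rep_L2 f x"] s(3)[of i x] by simp
    qed (use s_sq s(2) sq in \<open>auto intro: square_integrable_scaleR\<close>)
    then show "f \<in> W"
      using closed_sequentially[OF W(2), of "\<lambda>i. abs_L2 (s i)"] s_W by (simp add: abs_rep_L2)
  qed
  then have "closure (rational_combinations S) = UNIV"
    unfolding W_def by blast
  with countable_rational_combinations[OF \<open>countable S\<close>] show ?thesis by blast
qed

instance L2 :: (euclidean_space, euclidean_space) second_countable_topology
proof
  obtain D :: "('a, 'b) L2 set" where D: "countable D" "closure D = UNIV"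
    using L2_countable_dense by blast
  define B where "B = (\<lambda>(d, n). ball d (1 / real (Suc n))) ` (D \<times> (UNIV :: nat set))"
  have "topological_basis B"
  proof (rule topological_basisI)
    show "open U" if "U \<in> B" for U using that by (auto simp: B_def)
    fix U :: "('a, 'b) L2 set" and x assume "open U" "x \<in> U"
    then obtain e where e: "e > 0" "ball x e \<subseteq> U" by (auto simp: open_contains_ball)
    obtain n where n: "1 / real (Suc n) < e / 2"
      using nat_approx_posE[of "e/2"] e(1) by auto
    have "x \<in> closure D" using D by simp
    then obtain d where d: "d \<in> D" "dist d x < 1 / real (Suc n)"
      by (metis closure_approachable of_nat_0_less_iff zero_less_Suc zero_less_divide_1_iff)
    have "ball d (1 / real (Suc n)) \<subseteq> ball x e"
    proof
      fix y assume "y \<in> ball d (1 / real (Suc n))"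
      then show "y \<in> ball x e"
        using d n dist_triangle[of x y d] by (simp add: dist_commute)
    qed
    with d e(2) show "\<exists>V\<in>B. x \<in> V \<and> V \<subseteq> U"
      by (intro bexI[of _ "ball d (1 / real (Suc n))"]) (auto simp: B_def)
  qed
  moreover have "countable B"
    unfolding B_def using D(1) by (intro countable_image countable_SIGMA) auto
  ultimately show "\<exists>B :: ('a, 'b) L2 set set. countable B \<and> open = generate_topology B"
    using topological_basis_imp_subbasis by blast
qed


section \<open>Sobolev spaces on a domain\<close>

text \<open>
  Functions on \<open>\<Omega>\<close> are identified with their extension by zero, so that
  \<open>L\<^sup>2(\<Omega>)\<close> is a closed subspace of \<open>L\<^sup>2(\<real>\<^sup>d)\<close>, with the inner product of the latter.
\<close>

definition L2_on :: "'a::euclidean_space set \<Rightarrow> ('a, 'b::euclidean_space) L2 set" where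
  "L2_on \<Omega> = {f. AE x in lebesgue. x \<notin> \<Omega> \<longrightarrow> rep_L2 f x = 0}"

primrec C_k :: "nat \<Rightarrow> ('a::euclidean_space \<Rightarrow> real) \<Rightarrow> bool" where
  "C_k 0 f \<longleftrightarrow> continuous_on UNIV f"
| "C_k (Suc k) f \<longleftrightarrow>
     (\<forall>x. f differentiable (at x)) \<and> (\<forall>v. C_k k (\<lambda>x. frechet_derivative f (at x) v))"

definition test_functions :: "'a::euclidean_space set \<Rightarrow> ('a \<Rightarrow> real) set" where
  "test_functions \<Omega> =
     {\<phi>. (\<forall>k. C_k k \<phi>) \<and> compact (closure {x. \<phi> x \<noteq> 0}) \<and> closure {x. \<phi> x \<noteq> 0} \<subseteq> \<Omega>}"

definition partial_derivative :: "'n::finite \<Rightarrow> (real^'n \<Rightarrow> real) \<Rightarrow> real^'n \<Rightarrow> real" where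
  "partial_derivative i \<phi> x = frechet_derivative \<phi> (at x) (axis i 1)"

definition gradient :: "(real^'n \<Rightarrow> real) \<Rightarrow> real^'n \<Rightarrow> real^'n" where
  "gradient \<phi> x = (\<chi> i. partial_derivative i \<phi> x)"

text \<open>
  An element of \<open>H\<^sup>1(\<Omega>)\<close> is represented as the pair \<open>(u, \<nabla>u)\<close> of the function and its weak
  gradient. The norm of the product type \<open>L2 \<times> L2\<close>, which is
  \<open>sqrt ((norm u)\<^sup>2 + (norm (\<nabla>u))\<^sup>2)\<close>, is then the \<open>H\<^sup>1\<close> norm. Note that \<open>abs_L2\<close> yields the class
  of a function only if the function is square integrable; test functions and
  their derivatives are, being continuous with compact support.
\<close>

type_synonym 'n H1 = "(real^'n, real) L2 \<times> (real^'n, real^'n) L2"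

definition H1 :: "(real^'n) set \<Rightarrow> 'n::finite H1 set" where
  "H1 \<Omega> = {(u, g). u \<in> L2_on \<Omega> \<and> g \<in> L2_on \<Omega> \<and>
     (\<forall>\<phi>\<in>test_functions \<Omega>. \<forall>i.
        u \<bullet> abs_L2 (partial_derivative i \<phi>) = - (g \<bullet> abs_L2 (\<lambda>x. \<phi> x *\<^sub>R axis i 1)))}"

definition H1_0 :: "(real^'n) set \<Rightarrow> 'n::finite H1 set" where
  "H1_0 \<Omega> = H1 \<Omega> \<inter> closure ((\<lambda>\<phi>. (abs_L2 \<phi>, abs_L2 (gradient \<phi>))) ` test_functions \<Omega>)"

text \<open>
  The boundary is locally the graph of a Lipschitz function over the hyperplane
  orthogonal to a unit vector \<open>e\<close>, and the set lies on one side of the graph.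
\<close>

definition lipschitz_boundary :: "'a::euclidean_space set \<Rightarrow> bool" where
  "lipschitz_boundary \<Omega> \<longleftrightarrow>
     (\<forall>x\<in>frontier \<Omega>. \<exists>r>0. \<exists>e. norm e = 1 \<and>
        (\<exists>\<gamma> :: 'a \<Rightarrow> real. \<exists>C. C-lipschitz_on {y. y \<bullet> e = 0} \<gamma> \<and>
           \<Omega> \<inter> ball x r = {y \<in> ball x r. \<gamma> (y - (y \<bullet> e) *\<^sub>R e) < y \<bullet> e}))"

definition bounded_lipschitz_domain :: "'a::euclidean_space set \<Rightarrow> bool" where
  "bounded_lipschitz_domain \<Omega> \<longleftrightarrow>
     open \<Omega> \<and> connected \<Omega> \<and> \<Omega> \<noteq> {} \<and> bounded \<Omega> \<and> lipschitz_boundary \<Omega>"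


section \<open>Bochner spaces and weak time derivatives\<close>

text \<open>
  For the separable target spaces below, Borel measurability is strong measurability,
  and the integrals of the library are Bochner integrals.
\<close>

definition bochner_Linf ::
    "real set \<Rightarrow> 'b::{banach, second_countable_topology} set \<Rightarrow> (real \<Rightarrow> 'b) set" where
  "bochner_Linf I V = {f. f \<in> borel_measurable (lebesgue_on I) \<and>
     (AE t in lebesgue_on I. f t \<in> V) \<and> (\<exists>C. AE t in lebesgue_on I. norm (f t) \<le> C)}"

definition bochner_L2 ::
    "real set \<Rightarrow> 'b::{banach, second_countable_topology} set \<Rightarrow> (real \<Rightarrow> 'b) set" where
  "bochner_L2 I V = {f. f \<in> borel_measurable (lebesgue_on I) \<and>
     (AE t in lebesgue_on I. f t \<in> V) \<and> integrable (lebesgue_on I) (\<lambda>t. (norm (f t))\<^sup>2)}"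

text \<open>
  Elements of the dual of a subspace \<open>V\<close> are functions of which only the values on \<open>V\<close>
  matter; the pairing is function application.
\<close>

definition dual_space :: "'h::real_normed_vector set \<Rightarrow> ('h \<Rightarrow> real) set" where
  "dual_space V = {f. (\<forall>x\<in>V. \<forall>y\<in>V. f (x + y) = f x + f y) \<and>
     (\<forall>r. \<forall>x\<in>V. f (r *\<^sub>R x) = r * f x) \<and> (\<exists>C. \<forall>x\<in>V. \<bar>f x\<bar> \<le> C * norm x)}"

definition dual_norm :: "'h::real_normed_vector set \<Rightarrow> ('h \<Rightarrow> real) \<Rightarrow> real" where
  "dual_norm V f = (SUP x\<in>{x \<in> V. norm x \<le> 1}. \<bar>f x\<bar>)"

definition bochner_L2_dual ::
    "real set \<Rightarrow> 'h::real_normed_vector set \<Rightarrow> (real \<Rightarrow> 'h \<Rightarrow> real) set" where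
  "bochner_L2_dual I V = {f.
     (\<exists>s. (\<forall>n. simple_function (lebesgue_on I) (s n) \<and> (\<forall>t\<in>I. s n t \<in> dual_space V)) \<and>
        (AE t in lebesgue_on I. (\<lambda>n. dual_norm V (\<lambda>x. s n t x - f t x)) \<longlonglongrightarrow> 0)) \<and>
     (AE t in lebesgue_on I. f t \<in> dual_space V) \<and>
     integrable (lebesgue_on I) (\<lambda>t. (dual_norm V (f t))\<^sup>2)}"

definition weak_time_derivative ::
    "real \<Rightarrow> (real \<Rightarrow> 'b::{banach, second_countable_topology}) \<Rightarrow> (real \<Rightarrow> 'b) \<Rightarrow> bool" where
  "weak_time_derivative T f g \<longleftrightarrow>
     (\<forall>s t. 0 < s \<longrightarrow> t < T \<longrightarrow>
        integrable (lebesgue_on {s..t}) f \<and> integrable (lebesgue_on {s..t}) g) \<and>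
     (\<forall>\<psi>\<in>test_functions {0<..<T}.
        (LINT t|lebesgue_on {0<..<T}. deriv \<psi> t *\<^sub>R f t)
          = - (LINT t|lebesgue_on {0<..<T}. \<psi> t *\<^sub>R g t))"

text \<open>
  For functions with values in the dual of \<open>V\<close>, the defining identity is an identity
  between Bochner integrals in the dual; two elements of the dual are equal iff they
  agree at each point of \<open>V\<close>, and evaluation at a point commutes with the integral.
\<close>

definition weak_time_derivative_dual ::
    "real \<Rightarrow> 'h set \<Rightarrow> (real \<Rightarrow> 'h \<Rightarrow> real) \<Rightarrow> (real \<Rightarrow> 'h \<Rightarrow> real) \<Rightarrow> bool" where
  "weak_time_derivative_dual T V f g \<longleftrightarrow>
     (\<forall>x\<in>V. weak_time_derivative T (\<lambda>t. f t x) (\<lambda>t. g t x))"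

definition convolution ::
    "(real \<Rightarrow> real) \<Rightarrow> (real \<Rightarrow> 'b::{banach, second_countable_topology}) \<Rightarrow> real \<Rightarrow> 'b" where
  "convolution \<kappa> z t = (LINT s|lebesgue_on {0<..<t}. \<kappa> (t - s) *\<^sub>R z s)"

definition g_kernel :: "real \<Rightarrow> real \<Rightarrow> real" where
  "g_kernel \<alpha> t = t powr (- \<alpha>) / Gamma (1 - \<alpha>)"


section \<open>The single-phase-lag problem\<close>

definition symmetric_elliptic_coefficient :: "(real^'n) set \<Rightarrow> (real^'n \<Rightarrow> real^'n^'n) \<Rightarrow> bool" where
  "symmetric_elliptic_coefficient \<Omega> k \<longleftrightarrow>
     (\<forall>i j. (\<lambda>x. k x $ i $ j) \<in> borel_measurable (lebesgue_on \<Omega>) \<and>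
        (\<exists>C. AE x in lebesgue_on \<Omega>. \<bar>k x $ i $ j\<bar> \<le> C)) \<and>
     (\<forall>x\<in>\<Omega>. transpose (k x) = k x) \<and>
     (\<exists>k0>0. \<forall>x\<in>\<Omega>. \<forall>\<xi>. \<xi> \<bullet> (k x *v \<xi>) \<ge> k0 * (norm \<xi>)\<^sup>2)"

definition spl_form ::
    "(real^'n) set \<Rightarrow> (real^'n \<Rightarrow> real^'n^'n) \<Rightarrow> real \<Rightarrow> 'n::finite H1 \<Rightarrow> 'n H1 \<Rightarrow> real" where
  "spl_form \<Omega> k a = (\<lambda>(u, Du) (\<phi>, D\<phi>).
     (LINT x|lebesgue_on \<Omega>. (k x *v rep_L2 Du x) \<bullet> rep_L2 D\<phi> x) + a * (u \<bullet> \<phi>))"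

text \<open>The embedding of \<open>L\<^sup>2(\<Omega>)\<close> into the dual of \<open>H1_0 \<Omega>\<close>.\<close>

definition L2_functional :: "(real^'n, real) L2 \<Rightarrow> 'n::finite H1 \<Rightarrow> real" where
  "L2_functional f = (\<lambda>(\<phi>, D\<phi>). f \<bullet> \<phi>)"

text \<open>
  In the following definition \<open>Du t\<close> is \<open>\<nabla>u(t)\<close>, \<open>u'\<close> is \<open>\<partial>\<^sub>t u\<close>, and \<open>w\<close> is
  \<open>\<partial>\<^sub>t (g\<^sub>\<alpha> * (\<partial>\<^sub>t u - V\<^sub>0))\<close>; the test functions are pairs \<open>(\<phi>, \<nabla>\<phi>)\<close>.
  Values of \<open>u\<close> outside \<open>[0, T]\<close> are irrelevant.
\<close>

definition spl_weak_solution ::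
    "(real^'n) set \<Rightarrow> real \<Rightarrow> real \<Rightarrow> real \<Rightarrow> real \<Rightarrow> real \<Rightarrow> real \<Rightarrow> (real^'n \<Rightarrow> real^'n^'n) \<Rightarrow>
     (real \<Rightarrow> (real^'n::finite, real) L2) \<Rightarrow> (real^'n, real) L2 \<Rightarrow> (real^'n, real) L2 \<Rightarrow>
     (real \<Rightarrow> (real^'n, real) L2) \<Rightarrow> bool" where
  "spl_weak_solution \<Omega> T \<alpha> \<rho> c \<tau>\<^sub>q a k F U\<^sub>0 V\<^sub>0 u \<longleftrightarrow>
     continuous_on {0..T} u \<and> (\<forall>t\<in>{0..T}. u t \<in> L2_on \<Omega>) \<and> u 0 = U\<^sub>0 \<and>
     (\<exists>Du u' w.
        (\<lambda>t. (u t, Du t)) \<in> bochner_Linf {0<..<T} (H1_0 \<Omega>) \<and>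
        u' \<in> bochner_Linf {0<..<T} (L2_on \<Omega>) \<and> weak_time_derivative T u u' \<and>
        w \<in> bochner_L2_dual {0<..<T} (H1_0 \<Omega>) \<and>
        weak_time_derivative_dual T (H1_0 \<Omega>)
          (\<lambda>t. L2_functional (convolution (g_kernel \<alpha>) (\<lambda>s. u' s - V\<^sub>0) t)) w \<and>
        (AE t in lebesgue_on {0<..<T}. \<forall>(\<phi>, D\<phi>)\<in>H1_0 \<Omega>.
           \<rho> * c * \<tau>\<^sub>q powr \<alpha> * w t (\<phi>, D\<phi>)
             + a * \<tau>\<^sub>q powr \<alpha> * (convolution (g_kernel \<alpha>) u' t \<bullet> \<phi>)
             + \<rho> * c * (u' t \<bullet> \<phi>) + spl_form \<Omega> k a (u t, Du t) (\<phi>, D\<phi>)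
           = F t \<bullet> \<phi>))"

end

theory Submission
  imports Defs
begin

text \<open>
  Let \<open>u\<close> be the difference of two weak solutions, so that the data of \<open>u\<close> vanish, and put
  \<open>A = \<rho> c \<tau>\<^sub>q powr \<alpha>\<close>, \<open>B = a \<tau>\<^sub>q powr \<alpha>\<close>, \<open>C = \<rho> c\<close>; let \<open>g\<close> be the kernel \<open>g_kernel \<alpha>\<close>, \<open>L\<close>
  the elliptic form and \<open>*\<close> the convolution in time. The natural test function \<open>\<partial>\<^sub>t u\<close> need not
  belong to \<open>H1_0 \<Omega>\<close>. The remedy is to lower the order in time: the equation for \<open>u\<close> is
  integrated twice. Since \<open>g * \<partial>\<^sub>t u\<close> vanishes at time \<open>0\<close> and convolutions commute with
  integration, the result is \<open>A (g * u)(t) \<bullet> \<phi> + B (g * y)(t) \<bullet> \<phi> + C y(t) \<bullet> \<phi> + L (Z t) \<phi> = 0\<close>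
  for every time \<open>t\<close>, where \<open>y\<close> is the primitive of \<open>u\<close>, \<open>Y\<close> the primitive of the pair
  \<open>(u, \<nabla>u)\<close> and \<open>Z\<close> the primitive of \<open>Y\<close>. All functions are now continuous in time.

  Testing with \<open>\<phi> = Y t\<close> and integrating over \<open>(0, s)\<close> gives a sum of nonnegative terms
  (\<open>energy_uniqueness\<close>). The term with \<open>L\<close> is \<open>L (Z s) (Z s) / 2\<close>, because \<open>Z\<close> has the
  derivative \<open>Y\<close> and \<open>L\<close> is symmetric. The two terms with \<open>g\<close> are nonnegative because \<open>g\<close> is a
  mixture of exponentials \<open>exp (- l t)\<close> with nonnegative weights (\<open>Laplace_transform_powr\<close>,
  \<open>powr_kernel_nonneg\<close>), and for an exponential kernel the convolution solves a first order
  linear differential equation, from which the sign is read off (\<open>exp_kernel_nonneg\<close>). Hence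
  the integral of \<open>C y \<bullet> y\<close> is \<open>0\<close>, so \<open>y\<close> and its derivative \<open>u\<close> vanish.

  Two points make this rigorous. For a fixed test element \<open>\<phi>\<close> all time-dependent quantities are
  real functions, and the weak derivative with values in the dual space becomes a scalar one. A
  scalar weak derivative is integrated by testing with smooth approximations of the positive
  part of \<open>t - x\<close> (\<open>weak_derivative_weighted_integral\<close>, \<open>fractional_equation_integrated\<close>).
  Secondly, the values of the two given solutions, not their integrals, are the elements of
  \<open>H1_0 \<Omega>\<close> that are inserted for \<open>\<phi>\<close>; as the left-hand side is a bounded linear functional of
  \<open>\<phi>\<close>, subtracting and integrating the resulting identities produces the test element \<open>Y t\<close>
  (\<open>uniqueness_of_integrated_equation\<close>).
\<close>

section \<open>Smooth cutoff functions on the line\<close>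

lemma C_k_cmult:
  fixes f :: "real \<Rightarrow> real"
  assumes "C_k k f" shows "C_k k (\<lambda>x. c * f x)"
  using assms
proof (induction k arbitrary: f)
  case 0
  then show ?case by (auto intro: continuous_intros)
next
  case (Suc k)
  then have d: "f differentiable (at x)" for x by simp
  have "frechet_derivative (\<lambda>x. c * f x) (at x) v = c * frechet_derivative f (at x) v" for x v
    using frechet_derivative_at[OF has_derivative_mult_right[OF d[unfolded frechet_derivative_works],
        of c]]
    by (metis (no_types))
  with Suc d show ?case
    by (auto intro!: differentiable_mult)
qed

lemma C_k_SucI:
  fixes f f' :: "real \<Rightarrow> real"
  assumes "\<And>x. (f has_real_derivative f' x) (at x)" "C_k k f'"
  shows "C_k (Suc k) f"
proof -
  have "frechet_derivative f (at x) v = v * f' x" for x v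
    using frechet_derivative_at[OF assms(1)[of x, unfolded has_field_derivative_def]]
    by (metis mult.commute)
  then show ?thesis
    using assms(1) C_k_cmult[OF assms(2)] by (auto simp: real_differentiable_def)
qed

lemma C_k_SucE:
  fixes f :: "real \<Rightarrow> real"
  assumes "C_k (Suc k) f"
  obtains "\<And>x. (f has_real_derivative deriv f x) (at x)" "C_k k (deriv f)"
proof
  show d: "(f has_real_derivative deriv f x) (at x)" for x
    using assms by (auto simp: DERIV_deriv_iff_real_differentiable)
  have "deriv f x = frechet_derivative f (at x) 1" for x
    using frechet_derivative_at[OF d[of x, unfolded has_field_derivative_def]]
    by (metis mult.right_neutral)
  then have "deriv f = (\<lambda>x. frechet_derivative f (at x) 1)" by auto
  then show "C_k k (deriv f)" using assms by simp
qed

lemma C_k_SucD: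
  fixes f :: "real \<Rightarrow> real"
  shows "C_k (Suc k) f \<Longrightarrow> C_k k f"
proof (induction k arbitrary: f)
  case 0
  then show ?case 
    by (auto simp: differentiable_imp_continuous_within intro!: continuous_at_imp_continuous_on)
next
  case (Suc k)
  show ?case
    by (rule C_k_SucE[OF Suc.prems]) (rule C_k_SucI, auto intro: Suc.IH)
qed

lemma C_k_add:
  fixes f g :: "real \<Rightarrow> real"
  shows "C_k k f \<Longrightarrow> C_k k g \<Longrightarrow> C_k k (\<lambda>x. f x + g x)"
proof (induction k arbitrary: f g)
  case 0
  then show ?case by (auto intro: continuous_intros)
next
  case (Suc k)
  show ?case
    by (rule C_k_SucE[OF Suc.prems(1)], rule C_k_SucE[OF Suc.prems(2)],
        rule C_k_SucI[where f' = "\<lambda>x. deriv f x + deriv g x"])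
       (auto intro: Suc.IH derivative_intros)
qed

lemma C_k_mult:
  fixes f g :: "real \<Rightarrow> real"
  shows "C_k k f \<Longrightarrow> C_k k g \<Longrightarrow> C_k k (\<lambda>x. f x * g x)"
proof (induction k arbitrary: f g)
  case 0
  then show ?case by (auto intro: continuous_intros)
next
  case (Suc k)
  show ?case
    by (rule C_k_SucE[OF Suc.prems(1)], rule C_k_SucE[OF Suc.prems(2)],
        rule C_k_SucI[where f' = "\<lambda>x. deriv f x * g x + deriv g x * f x"])
       (auto intro!: Suc.IH C_k_add derivative_intros intro: C_k_SucD Suc.prems)
qed

lemma C_k_affine:
  fixes f :: "real \<Rightarrow> real"
  shows "C_k k f \<Longrightarrow> C_k k (\<lambda>x. f (m * x + b))"
proof (induction k arbitrary: f)
  case 0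
  then show ?case by (auto intro!: continuous_intros continuous_on_compose2[of UNIV f])
next
  case (Suc k)
  obtain d: "\<And>x. (f has_real_derivative deriv f x) (at x)" and f': "C_k k (deriv f)"
    using C_k_SucE[OF Suc.prems] by blast
  have "((\<lambda>x. f (m * x + b)) has_real_derivative m * deriv f (m * x + b)) (at x)" for x
  proof -
    have "((\<lambda>x. m * x + b) has_real_derivative m) (at x)"
      by (auto intro!: derivative_eq_intros)
    from DERIV_chain2[OF d this] show ?thesis
      by (simp add: mult.commute)
  qed
  moreover have "C_k k (\<lambda>x. m * deriv f (m * x + b))"
    by (intro C_k_cmult Suc.IH f')
  ultimately show ?case by (rule C_k_SucI)
qed

text \<open>
  The derivatives of \<open>exp (- 1 / x)\<close> are linear combinations of these functions. The family is
  thus closed under differentiation up to linear combinations, and smoothness follows by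
  induction on the order, for all \<open>n\<close> simultaneously.
\<close>

definition flat_fun :: "nat \<Rightarrow> real \<Rightarrow> real" where
  "flat_fun n x = (if x > 0 then (1/x)^n * exp (- 1 / x) else 0)"

text \<open>
  One term of the exponential series gives \<open>exp (1/x) \<ge> (1/x)^(n+2) / (n+2)!\<close>. The exponent
  \<open>n + 2\<close> leaves a factor \<open>x\<^sup>2\<close>, which makes the difference quotient at \<open>0\<close> tend to \<open>0\<close>.
\<close>

lemma flat_fun_bound: "\<bar>flat_fun n x\<bar> \<le> fact (n + 2) * x\<^sup>2"
proof (cases "x > 0")
  case True
  define y where "y = 1 / x"
  have y: "y > 0" using True by (simp add: y_def)
  have "y ^ (n+2) / fact (n+2) \<le> exp y"
  proof -
    have "(\<Sum>i\<in>{n+2}. inverse (fact i) * y ^ i) \<le> exp y"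
      unfolding exp_first_terms[of y "n+3"] using y
      by (intro order.trans[OF sum_mono2[of "{..<n+3}" "{n+2}"]])
         (auto intro!: add_increasing2 suminf_nonneg summable_exp summable_ignore_initial_segment simp:
             scaleR_conv_of_real)
    then show ?thesis by (simp add: divide_inverse mult.commute)
  qed
  then have "y ^ (n+2) * exp (-y) \<le> fact (n+2)"
    by (simp add: exp_minus field_simps del: fact_Suc power_Suc power_add add_2_eq_Suc')
  then have "x\<^sup>2 * (y ^ (n+2) * exp (-y)) \<le> x\<^sup>2 * fact (n+2)"
    by (intro mult_left_mono) auto
  moreover have "x\<^sup>2 * (y ^ (n+2) * exp (-y)) = flat_fun n x"
    using True by (simp add: flat_fun_def y_def power_add field_simps power2_eq_square)
  ultimately have "flat_fun n x \<le> x\<^sup>2 * fact (n + 2)" by linarith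
  moreover have "flat_fun n x \<ge> 0" by (simp add: flat_fun_def)
  ultimately show ?thesis by (simp add: mult.commute del: fact_Suc add_2_eq_Suc')
qed (simp add: flat_fun_def)

lemma flat_fun_has_derivative:
  "(flat_fun n has_real_derivative flat_fun (n+2) x - n * flat_fun (n+1) x) (at x)"
proof -
  consider "x > 0" | "x < 0" | "x = 0" by linarith
  then show ?thesis
  proof cases
    case 1
    have "((\<lambda>x. (1/x)^n * exp (- 1 / x)) has_real_derivative flat_fun (n+2) x - n * flat_fun (n+1) x)
        (at x)"
    proof (cases n)
      case 0
      then show ?thesis
        using 1 by (auto intro!: derivative_eq_intros simp: flat_fun_def field_simps power2_eq_square)
    next
      case (Suc m)
      have inv: "((\<lambda>x. 1 / x) has_real_derivative - ((1/x)\<^sup>2)) (at x)"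
        using 1 by (auto intro!: derivative_eq_intros simp: field_simps power2_eq_square)
      have "((\<lambda>x. exp (- (1 / x))) has_real_derivative exp (- (1 / x)) * (- (- ((1/x)\<^sup>2)))) (at x)"
        by (intro DERIV_fun_exp DERIV_minus inv)
      from DERIV_mult[OF DERIV_power[OF inv, of n] this] show ?thesis
        using 1 Suc by (simp add: flat_fun_def algebra_simps power2_eq_square)
    qed
    moreover have "\<forall>\<^sub>F z in nhds x. flat_fun n z = (1/z)^n * exp (- 1 / z)"
      using eventually_nhds_in_open[of "{0<..}" x] 1 
      by (auto elim!: eventually_mono simp: flat_fun_def)
    ultimately show ?thesis
      by (subst DERIV_cong_ev[OF refl _ refl])
  next
    case 2
    have "((\<lambda>x. 0) has_real_derivative flat_fun (n+2) x - n * flat_fun (n+1) x) (at x)"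
      using 2 by (simp add: flat_fun_def)
    moreover have "\<forall>\<^sub>F z in nhds x. flat_fun n z = 0"
      using eventually_nhds_in_open[of "{..<0}" x] 2
      by (auto elim!: eventually_mono simp: flat_fun_def)
    ultimately show ?thesis
      by (subst DERIV_cong_ev[OF refl _ refl])
  next
    case 3
    have "((\<lambda>y. flat_fun n y / y) \<longlongrightarrow> 0) (at 0)"
    proof (rule Lim_null_comparison)
      show "\<forall>\<^sub>F y in at 0. norm (flat_fun n y / y) \<le> fact (n+2) * \<bar>y\<bar>"
      proof (rule eventually_at_filter[THEN iffD2], rule always_eventually, intro allI impI)
        fix y :: real assume "y \<noteq> 0"
        then show "norm (flat_fun n y / y) \<le> fact (n+2) * \<bar>y\<bar>"
          using flat_fun_bound[of n y]
          by (simp add: divide_simps power2_eq_square abs_mult del: fact_Suc) 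
      qed
      show "((\<lambda>y. fact (n+2) * \<bar>y\<bar>) \<longlongrightarrow> (0::real)) (at 0)"
        by (auto intro!: tendsto_eq_intros)
    qed
    then show ?thesis using 3 by (simp add: has_field_derivative_iff flat_fun_def)
  qed
qed

lemma C_k_flat_fun: "C_k k (flat_fun n)"
proof (induction k arbitrary: n)
  case 0
  show ?case
    by (auto intro!: continuous_at_imp_continuous_on DERIV_isCont flat_fun_has_derivative)
next
  case (Suc k)
  have "C_k k (\<lambda>x. flat_fun (n+2) x + (- real n) * flat_fun (n+1) x)"
    by (intro C_k_add C_k_cmult Suc)
  then show ?case
    by (intro C_k_SucI[OF flat_fun_has_derivative]) simp
qed

text \<open>
  The integral starts at \<open>-1\<close>, to the left of the support, so that it is differentiable at
  every point of the line, \<open>0\<close> included.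
\<close>

lemma primitive_from_zero:
  fixes b :: "real \<Rightarrow> real"
  assumes b: "continuous_on UNIV b" and b_0: "\<And>x. x \<le> 0 \<Longrightarrow> b x = 0"
  obtains J where "\<And>x. (J has_real_derivative b x) (at x)" "\<And>x. x \<le> 0 \<Longrightarrow> J x = 0"
proof
  define J where "J x = integral {-1..x} b" for x
  show J_eq: "J x = 0" if "x \<le> 0" for x
    unfolding J_def using b_0 that by (subst integral_cong[where g = "\<lambda>x. 0"]) auto
  show "(J has_real_derivative b x) (at x)" for x
  proof (cases "x < 0")
    case True
    have "((\<lambda>x. 0) has_real_derivative b x) (at x)" using True b_0 by simp
    moreover have "\<forall>\<^sub>F z in nhds x. J z = 0"
      using eventually_nhds_in_open[of "{..<0}" x] True by (auto elim!: eventually_mono simp: J_eq)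
    ultimately show ?thesis by (subst DERIV_cong_ev[OF refl _ refl])
  next
    case False
    have "(J has_real_derivative b x) (at x within {-1..x+1})"
      unfolding J_def using False 
      by (intro integral_has_real_derivative continuous_on_subset[OF b]) auto
    then show ?thesis using False by (subst (asm) at_within_interior) auto
  qed
qed

text \<open>
  The normalised primitive of the bump \<open>exp (-1/x) exp (-1/(1-x))\<close>, which is supported in
  \<open>[0, 1]\<close>.
\<close>

lemma smooth_step_exists:
  obtains S s :: "real \<Rightarrow> real" and K where
    "\<And>x. (S has_real_derivative s x) (at x)" "\<And>k. C_k k S"  "\<And>x. x \<le> 0 \<Longrightarrow> S x = 0"
    "\<And>x. x \<ge> 1 \<Longrightarrow> S x = 1" "\<And>x. S x \<ge> 0" "\<And>x. S x \<le> 1"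
    "continuous_on UNIV s" "\<And>x. 0 \<le> s x" "\<And>x. s x \<le> K" "\<And>x. x \<le> 0 \<or> x \<ge> 1 \<Longrightarrow> s x = 0"
proof -
  define b where "b x = flat_fun 0 x * flat_fun 0 (1 - x)" for x
  have b_Ck: "C_k k b" for k
    unfolding b_def using C_k_affine[of k "flat_fun 0" "-1" 1]
    by (intro C_k_mult C_k_flat_fun) (simp add: C_k_flat_fun)
  have b_cont: "continuous_on A b" for A
    using b_Ck[of 0] continuous_on_subset by auto
  have b_nonneg: "b x \<ge> 0" for x by (simp add: b_def flat_fun_def)
  have b_le: "b x \<le> 1" for x
    unfolding b_def by (intro mult_le_one) (auto simp: flat_fun_def)
  have b_0: "b x = 0" if "x \<le> 0 \<or> x \<ge> 1" for x using that by (auto simp: b_def flat_fun_def)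
  obtain J where J_deriv: "\<And>x. (J has_real_derivative b x) (at x)"
      and J_eq: "\<And>x. x \<le> 0 \<Longrightarrow> J x = 0"
    using primitive_from_zero[of b] b_cont b_0 by blast
  have J_mono: "J x \<le> J y" if "x \<le> y" for x y
    using DERIV_nonneg_imp_nondecreasing[OF that, of J] J_deriv b_nonneg by blast
  have J_const: "J x = J 1" if "x \<ge> 1" for x
  proof (cases "x = 1")
    case False
    have "continuous_on {1..x} J"
      by (auto intro!: continuous_at_imp_continuous_on DERIV_isCont J_deriv)
    moreover have "(J has_real_derivative 0) (at y)" if "1 < y" for y
      using J_deriv[of y] b_0[of y] that by simp
    ultimately show ?thesis
      using DERIV_isconst_end[of 1 x J] that False by simp
  qed simp
  \<comment> \<open>The total mass of the bump, by which the step is normalised.\<close>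
  have J1: "J 1 > 0"
  proof -
    have "\<exists>z>0. z < 1 \<and> J 1 - J 0 = (1 - 0) * b z"
      using MVT2[of 0 1 J b] J_deriv by auto
    moreover have "b z > 0" if "0 < z" "z < 1" for z
      using that by (simp add: b_def flat_fun_def)
    ultimately show ?thesis by (auto simp: J_eq)
  qed
  define S where "S x = (1 / J 1) * J x" for x
  define s where "s x = (1 / J 1) * b x" for x
  show ?thesis
  proof (rule that[of S s "1 / J 1"])
    show Sd: "(S has_real_derivative s x) (at x)" for x
      unfolding S_def s_def by (intro DERIV_cmult J_deriv)
    show "C_k k S" for k
      unfolding S_def using C_k_SucI[OF J_deriv b_Ck, THEN C_k_SucD] by (rule C_k_cmult)
    show "S x = 0" if "x \<le> 0" for x using that by (simp add: S_def J_eq)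
    show "S x = 1" if "x \<ge> 1" for x using that J_const[OF that] J1 by (simp add: S_def)
    show "S x \<ge> 0" for x using J_mono[of 0 x] J_eq[of 0] J_eq[of x] J1
        by (cases "x \<ge> 0") (auto simp: S_def)
    show "S x \<le> 1" for x using J_mono[of x 1] J_const[of x] J1 by (cases "x \<le> 1") (auto simp: S_def)
    show "continuous_on UNIV s" unfolding s_def by (intro continuous_intros b_cont)
    show "0 \<le> s x" "s x \<le> 1 / J 1" for x using b_nonneg b_le[of x] J1 by (auto simp: s_def divide_simps)
    show "s x = 0" if "x \<le> 0 \<or> x \<ge> 1" for x using b_0[OF that] by (simp add: s_def)
  qed
qed

section \<open>Iterated integrals of convolutions\<close>

text \<open>
  Writing \<open>1\<close> for the constant function, this is \<open>1 * (\<kappa> * q) = \<kappa> * (1 * q)\<close>: both sides are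
  the integral of \<open>\<kappa> x q y\<close> over the triangle \<open>x > 0\<close>, \<open>y > 0\<close>, \<open>x + y < t\<close>.
\<close>

lemma Fubini_convolution:
  fixes \<kappa> q :: "real \<Rightarrow> real"
  assumes \<kappa>: "integrable lborel \<kappa>" and q: "integrable lborel q"
  shows "(LBINT s:{0<..<t}. LBINT r:{0<..<s}. \<kappa> (s - r) * q r)
    = (LBINT s:{0<..<t}. \<kappa> (t - s) * (LBINT r:{0<..<s}. q r))"
proof -
  have [measurable]: "\<kappa> \<in> borel_measurable borel" "q \<in> borel_measurable borel"
    using \<kappa> q by auto
  define G where "G x y = indicator {0<..} x * indicator {0<..} y * indicator {..<t} (x + y)
      * (\<kappa> x * q y)" for x y :: real
  have G_int: "integrable lborel (\<lambda>x. G x y)" for y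
    unfolding G_def by (intro Bochner_Integration.integrable_bound[OF integrable_mult_left[OF \<kappa>, of
        "q y"]])
      (auto simp: indicator_def)
  have G_shift: "(LBINT s. \<bar>G (s - r) r\<bar>) = (LBINT x. \<bar>G x r\<bar>)"
      "(LBINT s. G (s - r) r) = (LBINT x. G x r)" for r
    using lborel_integral_real_affine[of 1 "\<lambda>x. \<bar>G x r\<bar>" "-r"] lborel_integral_real_affine[of 1
        "\<lambda>x. G x r" "-r"] by simp_all
  \<comment> \<open>In the order \<open>r\<close>, \<open>s\<close> the inner integral is bounded by a multiple of \<open>\<bar>q r\<bar>\<close>.\<close>
  have swapped: "integrable (lborel \<Otimes>\<^sub>M lborel) (\<lambda>(r, s). G (s - r) r)"
  proof (rule lborel_pair.Fubini_integrable)
    show "(\<lambda>(r, s). G (s - r) r) \<in> borel_measurable (lborel \<Otimes>\<^sub>M lborel)"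
      unfolding G_def by measurable
    show "integrable lborel (\<lambda>r. LBINT s. norm (case (r, s) of (r, s) \<Rightarrow> G (s - r) r))"
    proof (rule Bochner_Integration.integrable_bound)
      show "integrable lborel (\<lambda>r. (LBINT x. \<bar>\<kappa> x\<bar>) * \<bar>q r\<bar>)"
        using q by auto
      show "AE r in lborel. norm (LBINT s. norm (case (r, s) of (r, s) \<Rightarrow> G (s - r) r))
          \<le> norm ((LBINT x. \<bar>\<kappa> x\<bar>) * \<bar>q r\<bar>)"
      proof (rule AE_I2)
        fix r
        have "(LBINT x. \<bar>G x r\<bar>) \<le> (LBINT x. \<bar>\<kappa> x\<bar> * \<bar>q r\<bar>)"
          using \<kappa> integrable_abs[OF G_int[of r]]
          by (intro integral_mono) (auto simp: G_def abs_mult indicator_def)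
        then show "norm (LBINT s. norm (case (r, s) of (r, s) \<Rightarrow> G (s - r) r))
          \<le> norm ((LBINT x. \<bar>\<kappa> x\<bar>) * \<bar>q r\<bar>)"
          by (simp add: G_shift)
      qed
    qed (unfold G_def, measurable)
    show "AE r in lborel. integrable lborel (\<lambda>s. case (r, s) of (r, s) \<Rightarrow> G (s - r) r)"
      using lborel_integrable_real_affine[OF G_int, of 1 "- r" for r] by (intro AE_I2) simp
  qed
  have unswapped: "integrable (lborel \<Otimes>\<^sub>M lborel) (\<lambda>(x, y). G x y)"
  proof (rule lborel_pair.Fubini_integrable)
    show "(\<lambda>(x, y). G x y) \<in> borel_measurable (lborel \<Otimes>\<^sub>M lborel)"
      unfolding G_def by measurable
    have "integrable lborel (\<lambda>y. G x y)" for x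
      unfolding G_def by (intro Bochner_Integration.integrable_bound[OF integrable_mult_right[OF q, of
          "\<kappa> x"]])
        (auto simp: indicator_def)
    note G_int' = this
    then show "AE x in lborel. integrable lborel (\<lambda>y. case (x, y) of (x, y) \<Rightarrow> G x y)"
      by simp
    show "integrable lborel (\<lambda>x. LBINT y. norm (case (x, y) of (x, y) \<Rightarrow> G x y))"
    proof (rule Bochner_Integration.integrable_bound)
      show "integrable lborel (\<lambda>x. \<bar>\<kappa> x\<bar> * (LBINT x. \<bar>q x\<bar>))"
        using \<kappa> by auto
      show "AE x in lborel. norm (LBINT y. norm (case (x, y) of (x, y) \<Rightarrow> G x y))
          \<le> norm (\<bar>\<kappa> x\<bar> * (LBINT x. \<bar>q x\<bar>))"
      proof (rule AE_I2)
        fix x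
        have "(LBINT y. \<bar>G x y\<bar>) \<le> (LBINT y. \<bar>\<kappa> x\<bar> * \<bar>q y\<bar>)"
          using q integrable_abs[OF G_int'[of x]]
          by (intro integral_mono) (auto simp: G_def abs_mult indicator_def)
        then show "norm (LBINT y. norm (case (x, y) of (x, y) \<Rightarrow> G x y))
          \<le> norm (\<bar>\<kappa> x\<bar> * (LBINT x. \<bar>q x\<bar>))"
          by simp
      qed
    qed (unfold G_def, measurable)
  qed
  have "(LBINT s:{0<..<t}. LBINT r:{0<..<s}. \<kappa> (s - r) * q r) = (LBINT s. LBINT r. G (s - r) r)"
    unfolding set_lebesgue_integral_def
    by (intro Bochner_Integration.integral_cong refl, subst integral_scaleR_right[symmetric],
        intro Bochner_Integration.integral_cong)
       (auto simp: G_def indicator_def)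
  also have "\<dots> = (LBINT r. LBINT s. G (s - r) r)"
    using lborel_pair.Fubini_integral[of "\<lambda>r s. G (s - r) r"] swapped by simp
  also have "\<dots> = (LBINT y. LBINT x. G x y)"
    by (simp add: G_shift)
  also have "\<dots> = (LBINT x. LBINT y. G x y)"
    using lborel_pair.Fubini_integral[of G] unswapped by simp
  also have "\<dots> = (LBINT s. LBINT y. G (t - s) y)"
    using lborel_integral_real_affine[of "-1" "\<lambda>x. LBINT y. G x y" "t"] by simp
  also have "\<dots> = (LBINT s:{0<..<t}. \<kappa> (t - s) * (LBINT r:{0<..<s}. q r))"
    unfolding set_lebesgue_integral_def
    apply (intro Bochner_Integration.integral_cong refl)
    apply (simp flip: integral_mult_right_zero)
    apply (intro Bochner_Integration.integral_cong refl)
    by (auto simp: G_def indicator_def)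
  finally show ?thesis .
qed

text \<open>
  This is \<open>1 * (h * 1) = h * (1 * 1)\<close> with \<open>(1 * 1) s = s\<close>, up to reflections of the interval.
\<close>

lemma iterated_integral_eq_weighted:
  fixes h :: "real \<Rightarrow> real"
  assumes h: "integrable lborel h"
  shows "(LBINT s:{0<..<t}. LBINT r:{0<..<s}. h r) = (LBINT s:{0<..<t}. (t - s) * h s)"
proof -
  have reflect: "(LBINT r:{0<..<s}. f (s - r)) = (LBINT r:{0<..<s}. f r)" for s and f :: "real \<Rightarrow> real"
    unfolding set_lebesgue_integral_def
    by (subst (2) lborel_integral_real_affine[of "-1" _ s])
       (auto intro!: Bochner_Integration.integral_cong simp: indicator_def)
  let ?i = "indicator {0<..<t} :: real \<Rightarrow> real"
  have "(LBINT s:{0<..<t}. LBINT r:{0<..<s}. h r) = (LBINT s:{0<..<t}. LBINT r:{0<..<s}. h (s - r))"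
    by (simp add: reflect)
  also have "\<dots> = (LBINT s:{0<..<t}. LBINT r:{0<..<s}. h (s - r) * ?i r)"
    by (intro set_lebesgue_integral_cong allI impI) (auto simp: indicator_def)
  also have "\<dots> = (LBINT s:{0<..<t}. h (t - s) * (LBINT r:{0<..<s}. ?i r))"
    by (rule Fubini_convolution[OF h]) (cases "t \<ge> 0"; simp add: integrable_indicator_iff)
  also have "\<dots> = (LBINT s:{0<..<t}. h (t - s) * s)"
  proof (intro set_lebesgue_integral_cong allI impI)
    fix s assume s: "s \<in> {0<..<t}"
    have "(LBINT r:{0<..<s}. ?i r) = (LBINT r. indicator {0<..<s} r)"
      using s unfolding set_lebesgue_integral_def
      by (intro Bochner_Integration.integral_cong) (auto simp: indicator_def)
    then show "h (t - s) * (LBINT r:{0<..<s}. ?i r) = h (t - s) * s"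
      using s by simp
  qed simp
  also have "\<dots> = (LBINT s:{0<..<t}. (t - s) * h s)"
    using reflect[of t "\<lambda>s. (t - s) * h s"] by (simp add: mult.commute)
  finally show ?thesis .
qed

section \<open>Testing a weak derivative with a ramp\<close>

text \<open>
  A smooth substitute \<open>R\<close> for the positive part: since \<open>x - 1 \<le> R x \<le> x\<close> for \<open>x \<ge> 0\<close>, the
  function \<open>R (m (t - x)) / m\<close> differs from the positive part of \<open>t - x\<close> by at most \<open>1/m\<close>, and
  it vanishes for \<open>x \<ge> t\<close>, as the support of a test function on \<open>(0, T)\<close> requires.
\<close>

lemma smooth_ramp_exists:
  obtains R S :: "real \<Rightarrow> real" where
    "\<And>x. (R has_real_derivative S x) (at x)" "\<And>k. C_k k R" "\<And>x. x \<le> 0 \<Longrightarrow> R x = 0"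
    "\<And>x. 0 \<le> R x" "\<And>x. x - 1 \<le> R x" "\<And>x. 0 \<le> x \<Longrightarrow> R x \<le> x"
    "\<And>x. x \<le> 0 \<Longrightarrow> S x = 0" "\<And>x. x \<ge> 1 \<Longrightarrow> S x = 1" "\<And>x. S x \<ge> 0" "\<And>x. S x \<le> 1"
    "continuous_on UNIV S"
proof -
  obtain S s K where S: "\<And>x. (S has_real_derivative s x) (at x)" "\<And>k. C_k k S"  "\<And>x. x \<le> 0 \<Longrightarrow> S x = 0"
    "\<And>x. x \<ge> 1 \<Longrightarrow> S x = 1" "\<And>x. S x \<ge> 0" "\<And>x. S x \<le> 1"
    using smooth_step_exists by metis
  have S_cont: "continuous_on UNIV S" using S(2)[of 0] by simp
  then obtain R where R: "\<And>x. (R has_real_derivative S x) (at x)" "\<And>x. x \<le> 0 \<Longrightarrow> R x = 0"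
    using primitive_from_zero[of S] S(3) by blast
  have R_mono: "R x \<le> R y" if "x \<le> y" for x y
    using DERIV_nonneg_imp_nondecreasing[OF that, of R] R(1) S(5) by blast
  have R_nonneg: "0 \<le> R x" for x using R_mono[of 0 x] R(2)[of 0] R(2)[of x] by (cases "0 \<le> x") auto
  have R_lip: "y - R y \<ge> x - R x" if "x \<le> y" for x y
  proof (rule DERIV_nonneg_imp_nondecreasing[OF that])
    fix z show "\<exists>d. ((\<lambda>x. x - R x) has_real_derivative d) (at z) \<and> 0 \<le> d"
      using S(6)[of z] by (intro exI[of _ "1 - S z"]) (auto intro!: derivative_intros R)
  qed
  have R_1: "x - R x = 1 - R 1" if "x \<ge> 1" for x
  proof (cases "x = 1")
    case False
    have d: "((\<lambda>x. x - R x) has_real_derivative 1 - S y) (at y)" for y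
      by (auto intro!: derivative_intros R)
    then have "continuous_on {1..x} (\<lambda>x. x - R x)"
      by (meson continuous_at_imp_continuous_on DERIV_isCont)
    moreover have "((\<lambda>x. x - R x) has_real_derivative 0) (at y)" if "1 < y" for y
      using d[of y] S(4)[of y] that by simp
    ultimately show ?thesis
      using DERIV_isconst_end[of 1 x "\<lambda>x. x - R x"] that False by simp
  qed simp
  show ?thesis
  proof (rule that[of R S])
    show "C_k k R" for k using C_k_SucI[OF R(1) S(2)] by (rule C_k_SucD)
    show "x - 1 \<le> R x" for x 
      using R_1[of x] R_nonneg[of x] R_nonneg[of 1] by (cases "x \<ge> 1") auto
    show "R x \<le> x" if "0 \<le> x" for x using R_lip[OF that] R(2)[of 0] by simp
  qed (use R R_nonneg S S_cont in auto)
qed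

text \<open>
  The first factor vanishes to the left of \<open>1/m\<close>, the second to the right of \<open>t\<close>.
\<close>

lemma test_function_cutoff:
  fixes R S :: "real \<Rightarrow> real"
  assumes "\<And>k. C_k k R" "\<And>k. C_k k S"
    and R: "\<And>x. x \<le> 0 \<Longrightarrow> R x = 0" and S: "\<And>x. x \<le> 0 \<Longrightarrow> S x = 0"
    and "0 < t" "t < T" "m > 0"
  shows "(\<lambda>x. S (m * x - 1) * (c * R (m * (t - x)))) \<in> test_functions {0<..<T}" (is "?\<psi> \<in> _")
proof -
  have "C_k k ?\<psi>" for k
    using C_k_affine[OF assms(1), of k "-m" "m * t"] C_k_affine[OF assms(2), of k m "-1"]
    by (intro C_k_mult C_k_cmult) (simp_all add: algebra_simps)
  moreover have "closure {x. ?\<psi> x \<noteq> 0} \<subseteq> {1/m..t}"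
  proof (rule closure_minimal)
    have "x \<ge> 1/m \<and> x \<le> t" if "?\<psi> x \<noteq> 0" for x
    proof -
      have "m * x - 1 > 0" using that S[of "m * x - 1"] by force
      moreover have "m * (t - x) > 0" using that R[of "m * (t - x)"] by force
      ultimately show ?thesis using \<open>m > 0\<close> by (simp add: field_simps zero_less_mult_iff)
    qed
    then show "{x. ?\<psi> x \<noteq> 0} \<subseteq> {1/m..t}" by auto
  qed simp
  moreover have "{1/m..t} \<subseteq> {0<..<T}"
    using \<open>t < T\<close> less_le_trans[of 0 "1 / m"] \<open>m > 0\<close> by auto
  ultimately show ?thesis
    by (auto simp: test_functions_def compact_eq_bounded_closed intro: bounded_subset[of "{1/m..t}"])
qed

text \<open>
  The identity \<open>\<integral> \<psi>' f = - \<integral> \<psi> h\<close> is extended from test functions to the positive part of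
  \<open>t - x\<close>, whose derivative is \<open>-1\<close> on \<open>(0, t)\<close>. The approximating test functions are cut off
  on \<open>(1/m, 2/m)\<close>, where their derivative has size \<open>m\<close>; this part contributes an average of \<open>f\<close>
  near \<open>0\<close>, which tends to \<open>0\<close> because \<open>f\<close> does. It is here that the initial value \<open>0\<close> of \<open>f\<close>
  enters.
\<close>

lemma weak_derivative_weighted_integral:
  fixes f h b :: "real \<Rightarrow> real"
  assumes [measurable]: "f \<in> borel_measurable borel" "h \<in> borel_measurable borel"
    and f_b: "\<And>x. \<bar>f x\<bar> \<le> b x" and b_M: "\<And>x. b x \<le> M" and h_M: "\<And>x. \<bar>h x\<bar> \<le> M"
    and b_0: "(b \<longlongrightarrow> 0) (at_right 0)"
    and f_out: "\<And>x. x \<notin> {0<..<T} \<Longrightarrow> f x = 0" and h_out: "\<And>x. x \<notin> {0<..<T} \<Longrightarrow> h x = 0"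
    and weak: "\<And>\<psi>. \<psi> \<in> test_functions {0<..<T} \<Longrightarrow> (LBINT x. deriv \<psi> x * f x) = - (LBINT x. \<psi> x * h x)"
    and t: "0 < t" "t < T"
  shows "(LBINT x:{0<..<t}. f x) = (LBINT x:{0<..<t}. (t - x) * h x)"
proof -
  obtain R S where RS: "\<And>x. (R has_real_derivative S x) (at x)" "\<And>k. C_k k R" "\<And>x. x \<le> 0 \<Longrightarrow> R x = 0"
    "\<And>x. 0 \<le> R x" "\<And>x. x - 1 \<le> R x" "\<And>x. 0 \<le> x \<Longrightarrow> R x \<le> x"
    "\<And>x. x \<le> 0 \<Longrightarrow> S x = 0" "\<And>x. x \<ge> 1 \<Longrightarrow> S x = 1" "\<And>x. S x \<ge> 0" "\<And>x. S x \<le> 1" "continuous_on UNIV S"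
    by (rule smooth_ramp_exists, rule that)
  obtain \<Sigma> \<sigma> K where \<Sigma>: "\<And>x. (\<Sigma> has_real_derivative \<sigma> x) (at x)" "\<And>k. C_k k \<Sigma>"  "\<And>x. x \<le> 0 \<Longrightarrow> \<Sigma> x = 0"
    "\<And>x. x \<ge> 1 \<Longrightarrow> \<Sigma> x = 1" "\<And>x. \<Sigma> x \<ge> 0" "\<And>x. \<Sigma> x \<le> 1"
    "continuous_on UNIV \<sigma>" "\<And>x. 0 \<le> \<sigma> x" "\<And>x. \<sigma> x \<le> K" "\<And>x. x \<le> 0 \<or> x \<ge> 1 \<Longrightarrow> \<sigma> x = 0"
    by (rule smooth_step_exists, rule that)
  have cont: "continuous_on UNIV R" "continuous_on UNIV \<Sigma>"
    using RS(2)[of 0] \<Sigma>(2)[of 0] by simp_all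
  note [measurable] = borel_measurable_continuous_onI[OF RS(11)]
      borel_measurable_continuous_onI[OF \<Sigma>(7)]
    borel_measurable_continuous_onI[OF cont(1)] borel_measurable_continuous_onI[OF cont(2)]
  define m where "m n = real (Suc n)" for n
  have m: "m n > 0" for n by (simp add: m_def)
  have m_lim: "filterlim m at_top sequentially"
    unfolding m_def by (intro filterlim_compose[OF filterlim_real_sequentially filterlim_Suc])
  define \<omega> where "\<omega> n x = (1 / m n) * R (m n * (t - x))" for n x
  define \<psi> where "\<psi> n x = \<Sigma> (m n * x - 1) * \<omega> n x" for n x
  have [measurable]: "\<omega> n \<in> borel_measurable borel" for n unfolding \<omega>_def by measurable
  have \<omega>_nonneg: "\<omega> n x \<ge> 0" for n x using RS(4) m[of n] by (simp add: \<omega>_def)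
  have \<omega>_le: "\<omega> n x \<le> t" if "x \<ge> 0" for n x
  proof (cases "x \<le> t")
    case True
    then have "R (m n * (t - x)) \<le> m n * (t - x)" using RS(6) m[of n] by simp
    then have "\<omega> n x \<le> t - x" using m[of n] by (simp add: \<omega>_def field_simps)
    then show ?thesis using that by simp
  next
    case False
    then have "m n * (t - x) \<le> 0" using m[of n] by (simp add: mult_le_0_iff)
    then show ?thesis using RS(3) t by (simp add: \<omega>_def)
  qed
  have \<omega>_lim: "(\<lambda>n. \<omega> n x) \<longlonglongrightarrow> (if x < t then t - x else 0)" for x
  proof (cases "x < t")
    case True
    have lo: "t - x - 1 / m n \<le> \<omega> n x" for n
    proof -
      have "t - x - 1 / m n = (1 / m n) * (m n * (t - x) - 1)" using m[of n] by (simp add: field_simps)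
      also have "\<dots> \<le> \<omega> n x"
        unfolding \<omega>_def using RS(5)[of "m n * (t - x)"] m[of n] by (intro mult_left_mono) auto
      finally show ?thesis .
    qed
    have hi: "\<omega> n x \<le> t - x" for n
      using RS(6)[of "m n * (t - x)"] m[of n] True by (simp add: \<omega>_def field_simps)
    have "(\<lambda>n. t - x - 1 / m n) \<longlonglongrightarrow> t - x - 0"
      by (intro tendsto_intros tendsto_divide_0[OF tendsto_const]
          filterlim_at_top_imp_at_infinity m_lim)
    then have "(\<lambda>n. t - x - 1 / m n) \<longlonglongrightarrow> t - x" by simp
    from tendsto_sandwich[OF _ _ this tendsto_const] show ?thesis
      using True lo hi by simp
  next
    case False
    then have "m n * (t - x) \<le> 0" for n using m[of n] by (simp add: mult_le_0_iff)
    then show ?thesis using False RS(3) by (simp add: \<omega>_def)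
  qed
  have \<psi>_deriv: "deriv (\<psi> n) x = m n * \<sigma> (m n * x - 1) * \<omega> n x - \<Sigma> (m n * x - 1) * S (m n * (t - x))"
      for n x
  proof (rule DERIV_imp_deriv)
    have "((\<lambda>x. m n * x - 1) has_real_derivative m n) (at x)"
        "((\<lambda>x. m n * (t - x)) has_real_derivative - m n) (at x)"
      by (auto intro!: derivative_eq_intros)
    note d = DERIV_chain2[OF \<Sigma>(1) this(1)] DERIV_cmult[OF DERIV_chain2[OF RS(1) this(2)], of "1 / m n"]
    from DERIV_mult[OF d] show "(\<psi> n has_real_derivative m n * \<sigma> (m n * x - 1) * \<omega> n x
        - \<Sigma> (m n * x - 1) * S (m n * (t - x))) (at x)"
      unfolding \<psi>_def \<omega>_def using m[of n] by (simp add: algebra_simps)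
  qed
  have \<Sigma>_lim: "(\<lambda>n. \<Sigma> (m n * x - 1)) \<longlonglongrightarrow> 1" if "x > 0" for x
  proof (rule tendsto_eventually)
    have "\<forall>\<^sub>F n in sequentially. m n \<ge> 2 / x" using m_lim by (simp add: filterlim_at_top)
    then show "\<forall>\<^sub>F n in sequentially. \<Sigma> (m n * x - 1) = 1"
      by eventually_elim (use that \<Sigma>(4) in \<open>simp add: field_simps\<close>)
  qed
  have S_lim: "(\<lambda>n. S (m n * (t - x))) \<longlonglongrightarrow> (if x < t then 1 else 0)" for x
  proof (cases "x < t")
    case True
    have "\<forall>\<^sub>F n in sequentially. m n \<ge> 1 / (t - x)" using m_lim by (simp add: filterlim_at_top)
    then have "\<forall>\<^sub>F n in sequentially. S (m n * (t - x)) = 1"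
      by eventually_elim (use True RS(8) in \<open>simp add: field_simps\<close>)
    then show ?thesis using True by (simp add: tendsto_eventually)
  next
    case False
    then have "m n * (t - x) \<le> 0" for n using m[of n] by (simp add: mult_le_0_iff)
    then show ?thesis using False RS(7) by simp
  qed
  have M: "M \<ge> 0" using h_M[of 0] by linarith
  have T_int: "integrable lborel (\<lambda>x. c * indicator {0<..<T} x)" for c :: real
    using t by (intro integrable_mult_right) (simp add: integrable_indicator_iff)
  have lim_h: "(\<lambda>n. LBINT x. \<psi> n x * h x) \<longlonglongrightarrow> (LBINT x. indicator {0<..<t} x * ((t - x) * h x))"
  proof (rule integral_dominated_convergence[where w = "\<lambda>x. (t * M) * indicator {0<..<T} x"])
    show "AE x in lborel. (\<lambda>n. \<psi> n x * h x) \<longlonglongrightarrow> indicator {0<..<t} x * ((t - x) * h x)"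
    proof (rule AE_I2)
      fix x
      show "(\<lambda>n. \<psi> n x * h x) \<longlonglongrightarrow> indicator {0<..<t} x * ((t - x) * h x)"
      proof (cases "0 < x")
        case True
        show ?thesis
          using tendsto_mult[OF tendsto_mult[OF \<Sigma>_lim[OF True] \<omega>_lim[of x]] tendsto_const[of "h x"]]
              True
          by (auto simp: \<psi>_def indicator_def split: if_splits)
      qed (simp add: h_out)
    qed
    show "AE x in lborel. norm (\<psi> n x * h x) \<le> (t * M) * indicator {0<..<T} x" for n
    proof (rule AE_I2)
      fix x
      show "norm (\<psi> n x * h x) \<le> (t * M) * indicator {0<..<T} x"
      proof (cases "x \<in> {0<..<T}")
        case True
        have "\<bar>\<psi> n x\<bar> \<le> 1 * t"
          unfolding \<psi>_def abs_mult using \<Sigma>(5,6) \<omega>_nonneg \<omega>_le True 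
          by (intro mult_mono) auto
        then show ?thesis using True h_M[of x] M t by (auto simp: abs_mult intro!: mult_mono)
      qed (simp add: h_out)
    qed
  qed (use T_int in \<open>unfold \<psi>_def, measurable\<close>)
  have lim_f1: "(\<lambda>n. LBINT x. \<Sigma> (m n * x - 1) * S (m n * (t - x)) * f x)
      \<longlonglongrightarrow> (LBINT x. indicator {0<..<t} x * f x)"
  proof (rule integral_dominated_convergence[where w = "\<lambda>x. M * indicator {0<..<T} x"])
    show "AE x in lborel. (\<lambda>n. \<Sigma> (m n * x - 1) * S (m n * (t - x)) * f x) \<longlonglongrightarrow> indicator {0<..<t} x * f x"
    proof (rule AE_I2)
      fix x
      show "(\<lambda>n. \<Sigma> (m n * x - 1) * S (m n * (t - x)) * f x) \<longlonglongrightarrow> indicator {0<..<t} x * f x"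
      proof (cases "0 < x")
        case True
        show ?thesis
          using tendsto_mult[OF tendsto_mult[OF \<Sigma>_lim[OF True] S_lim[of x]] tendsto_const[of "f x"]]
              True
          by (auto simp: indicator_def split: if_splits)
      qed (simp add: f_out)
    qed
    show "AE x in lborel. norm (\<Sigma> (m n * x - 1) * S (m n * (t - x)) * f x) \<le> M * indicator {0<..<T} x"
        for n
    proof (rule AE_I2)
      fix x
      show "norm (\<Sigma> (m n * x - 1) * S (m n * (t - x)) * f x) \<le> M * indicator {0<..<T} x"
      proof (cases "x \<in> {0<..<T}")
        case True
        have "\<bar>\<Sigma> (m n * x - 1) * S (m n * (t - x)) * f x\<bar> \<le> 1 * 1 * M"
          unfolding abs_mult using \<Sigma>(5,6) RS(9,10) f_b[of x] b_M[of x] M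
          by (intro mult_mono) auto
        then show ?thesis using True by simp
      qed (simp add: f_out)
    qed
  qed (use T_int in measurable)
  \<comment> \<open>The substitution \<open>x = (z + 1) / m n\<close> absorbs the large factor \<open>m n\<close> of the cutoff derivative.\<close>
  have subst: "(LBINT x. m n * \<sigma> (m n * x - 1) * \<omega> n x * f x)
      = (LBINT z. \<sigma> z * \<omega> n ((z + 1) / m n) * f ((z + 1) / m n))" for n
    using lborel_integral_real_affine[of "1 / m n" "\<lambda>x. m n * \<sigma> (m n * x - 1) * \<omega> n x * f x"
        "1 / m n"] m[of n]
    by (simp add: add_divide_distrib[symmetric] add.commute mult.assoc flip: integral_mult_right_zero)
  have K: "0 \<le> K" using \<Sigma>(8,9)[of 0] by linarith
  have lim_f2: "(\<lambda>n. LBINT z. \<sigma> z * \<omega> n ((z + 1) / m n) * f ((z + 1) / m n)) \<longlonglongrightarrow> (LBINT z::real. 0)"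
  proof (rule integral_dominated_convergence[where w = "\<lambda>x. (K * t * M) * indicator {0<..<1} x"])
    have bd: "\<bar>\<sigma> z * \<omega> n ((z + 1) / m n) * f ((z + 1) / m n)\<bar> \<le> K * t * b ((z + 1) / m n)" if
        "0 < z" for n z
      unfolding abs_mult using \<Sigma>(8,9) \<omega>_nonneg \<omega>_le[of "(z + 1) / m n" n] f_b K t that m[of n]
      by (intro mult_mono mult_nonneg_nonneg) (auto intro: order.trans[OF abs_ge_zero])
    show "AE z in lborel. (\<lambda>n. \<sigma> z * \<omega> n ((z + 1) / m n) * f ((z + 1) / m n)) \<longlonglongrightarrow> 0"
    proof (rule AE_I2)
      fix z
      show "(\<lambda>n. \<sigma> z * \<omega> n ((z + 1) / m n) * f ((z + 1) / m n)) \<longlonglongrightarrow> 0"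
      proof (cases "0 < z")
        case True
        have "((\<lambda>n. (z + 1) / m n) \<longlongrightarrow> 0) sequentially"
          by (intro tendsto_divide_0[OF tendsto_const] filterlim_at_top_imp_at_infinity m_lim)
        then have "filterlim (\<lambda>n. (z + 1) / m n) (at_right 0) sequentially"
          using True m less_imp_neq[OF m] by (simp add: filterlim_at)
        then have "(\<lambda>n. b ((z + 1) / m n)) \<longlonglongrightarrow> 0"
          by (rule filterlim_compose[OF b_0])
        then have "(\<lambda>n. K * t * b ((z + 1) / m n)) \<longlonglongrightarrow> 0"
          by (auto intro!: tendsto_eq_intros)
        then show ?thesis
          by (rule Lim_null_comparison[rotated]) (use bd[OF True] in simp)
      qed (use \<Sigma>(10) in simp)
    qed
    show "AE z in lborel. norm (\<sigma> z * \<omega> n ((z + 1) / m n) * f ((z + 1) / m n))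
        \<le> (K * t * M) * indicator {0<..<1} z" for n
    proof (rule AE_I2)
      fix z
      show "norm (\<sigma> z * \<omega> n ((z + 1) / m n) * f ((z + 1) / m n)) \<le> (K * t * M) * indicator {0<..<1} z"
      proof (cases "z \<in> {0<..<1}")
        case True
        have "K * t * b ((z + 1) / m n) \<le> K * t * M"
          using K t b_M by (intro mult_left_mono) auto
        then show ?thesis using bd[of z n] True by auto
      qed (use \<Sigma>(10) in \<open>auto simp: not_less\<close>)
    qed
    show "integrable lborel (\<lambda>x::real. (K * t * M) * indicator {0<..<1} x)"
      by (intro integrable_mult_right) (simp add: integrable_indicator_iff)
  qed measurable
  have "(LBINT x. \<psi> n x * h x) = (LBINT x. \<Sigma> (m n * x - 1) * S (m n * (t - x)) * f x)
      - (LBINT z. \<sigma> z * \<omega> n ((z + 1) / m n) * f ((z + 1) / m n))" for n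
  proof -
    have "\<psi> n \<in> test_functions {0<..<T}"
      unfolding \<psi>_def \<omega>_def by (rule test_function_cutoff[OF RS(2) \<Sigma>(2) RS(3) \<Sigma>(3) t m])
    from weak[OF this] have "(LBINT x. \<psi> n x * h x) = - (LBINT x. deriv (\<psi> n) x * f x)" by simp
    also have "(LBINT x. deriv (\<psi> n) x * f x)
        = (LBINT x. m n * \<sigma> (m n * x - 1) * \<omega> n x * f x - \<Sigma> (m n * x - 1) * S (m n * (t - x)) * f x)"
      by (simp add: \<psi>_deriv algebra_simps)
    also have "\<dots> = (LBINT x. m n * \<sigma> (m n * x - 1) * \<omega> n x * f x)
        - (LBINT x. \<Sigma> (m n * x - 1) * S (m n * (t - x)) * f x)"
    proof (rule Bochner_Integration.integral_diff)
      show "integrable lborel (\<lambda>x. m n * \<sigma> (m n * x - 1) * \<omega> n x * f x)"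
      proof (rule Bochner_Integration.integrable_bound[OF T_int[of "m n * K * t * M"]])
        have "\<bar>m n * \<sigma> (m n * x - 1) * \<omega> n x * f x\<bar> \<le> m n * K * t * M" if "0 < x" for x
          unfolding abs_mult using \<Sigma>(8,9) \<omega>_nonneg \<omega>_le[of x n] order.trans[OF f_b b_M]
              K M t that m[of n]
          by (intro mult_mono mult_nonneg_nonneg) auto
        then show "AE x in lborel. norm (m n * \<sigma> (m n * x - 1) * \<omega> n x * f x)
            \<le> norm (m n * K * t * M * indicator {0<..<T} x)"
          using f_out by (intro AE_I2) (force simp: indicator_def)
      qed measurable
      show "integrable lborel (\<lambda>x. \<Sigma> (m n * x - 1) * S (m n * (t - x)) * f x)"
      proof (rule Bochner_Integration.integrable_bound[OF T_int[of M]])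
        have "\<bar>\<Sigma> (m n * x - 1) * S (m n * (t - x)) * f x\<bar> \<le> 1 * 1 * M" for x
          unfolding abs_mult using \<Sigma>(5,6) RS(9,10) f_b[of x] b_M[of x] M
          by (intro mult_mono) auto
        then show "AE x in lborel. norm (\<Sigma> (m n * x - 1) * S (m n * (t - x)) * f x)
            \<le> norm (M * indicator {0<..<T} x)"
          using f_out M by (intro AE_I2; case_tac "x \<in> {0<..<T}") simp_all
      qed measurable
    qed
    finally show ?thesis by (simp add: subst)
  qed
  with tendsto_diff[OF lim_f1 lim_f2] have
      "(\<lambda>n. LBINT x. \<psi> n x * h x) \<longlonglongrightarrow> (LBINT x. indicator {0<..<t} x * f x)"
    by simp
  from LIMSEQ_unique[OF this lim_h] show ?thesis
    by (simp add: set_lebesgue_integral_def)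
qed

section \<open>Essentially bounded functions and their primitives\<close>

abbreviation Linf :: "real \<Rightarrow> (real \<Rightarrow> 'b::{banach, second_countable_topology}) set" where
  "Linf T \<equiv> bochner_Linf {0<..<T} UNIV"

definition primitive :: "(real \<Rightarrow> 'b::{banach, second_countable_topology}) \<Rightarrow> real \<Rightarrow> 'b" where
  "primitive f t = (LINT s|lebesgue_on {0<..<t}. f s)"

lemma LinfI:
  "f \<in> borel_measurable (lebesgue_on {0<..<T}) \<Longrightarrow> AE t in lebesgue_on {0<..<T}. norm (f t) \<le> C \<Longrightarrow> f
      \<in> Linf T"
  by (auto simp: bochner_Linf_def)

lemma LinfE:
  assumes "f \<in> Linf T"
  obtains C where "f \<in> borel_measurable (lebesgue_on {0<..<T})" "C \<ge> 0"
    "AE t in lebesgue_on {0<..<T}. norm (f t) \<le> C"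
proof -
  from assms obtain C where C: "f \<in> borel_measurable (lebesgue_on {0<..<T})"
    "AE t in lebesgue_on {0<..<T}. norm (f t) \<le> C"
    by (auto simp: bochner_Linf_def)
  then have "AE t in lebesgue_on {0<..<T}. norm (f t) \<le> max C 0"
    by (auto elim!: eventually_mono)
  with C that[of "max C 0"] show ?thesis by simp
qed

lemma Linf_bounded_linear:
  assumes "bounded_linear L" "f \<in> Linf T"
  shows "(\<lambda>t. L (f t)) \<in> Linf T"
proof -
  obtain C where C: "f \<in> borel_measurable (lebesgue_on {0<..<T})" "C \<ge> 0"
    "AE t in lebesgue_on {0<..<T}. norm (f t) \<le> C"
    using assms(2) by (rule LinfE)
  obtain K where K: "K \<ge> 0" "\<And>x. norm (L x) \<le> norm x * K"
    using bounded_linear.nonneg_bounded[OF assms(1)] by blast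
  have "(\<lambda>t. L (f t)) \<in> borel_measurable (lebesgue_on {0<..<T})"
    by (rule borel_measurable_continuous_on[OF linear_continuous_on[OF assms(1)] C(1)])
  moreover have "AE t in lebesgue_on {0<..<T}. norm (L (f t)) \<le> C * K"
    using C(3) by eventually_elim (rule order_trans[OF K(2) mult_right_mono[OF _ K(1)]])
  ultimately show ?thesis by (rule LinfI)
qed

lemma Linf_diff:
  assumes "f \<in> Linf T" "g \<in> Linf T"
  shows "(\<lambda>t. f t - g t) \<in> Linf T"
proof -
  obtain C where C: "f \<in> borel_measurable (lebesgue_on {0<..<T})" "C \<ge> 0"
    "AE t in lebesgue_on {0<..<T}. norm (f t) \<le> C"
    using assms(1) by (rule LinfE)
  obtain D where D: "g \<in> borel_measurable (lebesgue_on {0<..<T})" "D \<ge> 0"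
    "AE t in lebesgue_on {0<..<T}. norm (g t) \<le> D"
    using assms(2) by (rule LinfE)
  have "AE t in lebesgue_on {0<..<T}. norm (f t - g t) \<le> C + D"
    using C(3) D(3) by eventually_elim (rule order_trans[OF norm_triangle_ineq4 add_mono])
  then show ?thesis using C D by (intro LinfI[of _ _ "C + D"]) auto
qed

lemma Linf_add:
  assumes "f \<in> Linf T" "g \<in> Linf T"
  shows "(\<lambda>t. f t + g t) \<in> Linf T"
  using Linf_diff[OF assms(1) Linf_bounded_linear[OF bounded_linear_minus[OF bounded_linear_ident]
      assms(2)]]
  by simp

lemma Linf_subinterval:
  assumes "f \<in> Linf T" "t \<le> T"
  shows "f \<in> Linf t"
proof -
  obtain C where C: "f \<in> borel_measurable (lebesgue_on {0<..<T})" "C \<ge> 0"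
    "AE t in lebesgue_on {0<..<T}. norm (f t) \<le> C"
    using assms(1) by (rule LinfE)
  have "f \<in> borel_measurable (lebesgue_on {0<..<t})"
    using C(1) by (rule measurable_restrict_mono) (use assms in auto)
  moreover have "AE t in lebesgue_on {0<..<t}. norm (f t) \<le> C"
    using C(3) assms(2) by (simp add: AE_restrict_space_iff) (auto elim!: eventually_mono)
  ultimately show ?thesis by (rule LinfI)
qed

lemma Linf_continuous:
  assumes "continuous_on {0..T} f"
  shows "f \<in> Linf T"
proof -
  have "bounded (f ` {0..T})"
    using compact_continuous_image[OF assms compact_Icc] by (rule compact_imp_bounded)
  then obtain C where C: "\<And>t. t \<in> {0..T} \<Longrightarrow> norm (f t) \<le> C"
    by (force simp: bounded_iff)
  have "f \<in> borel_measurable (lebesgue_on {0<..<T})"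
    by (intro continuous_imp_measurable_on_sets_lebesgue continuous_on_subset[OF assms]) auto
  then show ?thesis
    by (rule LinfI[of _ _ C]) (auto intro!: AE_I2 C)
qed

lemma Linf_integrable:
  assumes "f \<in> Linf T" "t \<le> T"
  shows "integrable (lebesgue_on {0<..<t}) f"
proof -
  obtain C where "f \<in> borel_measurable (lebesgue_on {0<..<t})" "C \<ge> 0"
    "AE t in lebesgue_on {0<..<t}. norm (f t) \<le> C"
    using Linf_subinterval[OF assms] by (rule LinfE)
  moreover have "{0<..<t} \<in> lmeasurable" by (simp add: bounded_set_imp_lmeasurable)
  ultimately show ?thesis
    by (intro finite_measure.integrable_const_bound[OF finite_measure_lebesgue_on]) auto
qed

lemma primitive_bounded_linear:
  assumes "bounded_linear L" "f \<in> Linf T" "t \<le> T"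
  shows "primitive (\<lambda>s. L (f s)) t = L (primitive f t)"
  unfolding primitive_def by (rule integral_bounded_linear[OF assms(1) Linf_integrable[OF assms(2,3)]])

lemma primitive_add:
  assumes "f \<in> Linf T" "g \<in> Linf T" "t \<le> T"
  shows "primitive (\<lambda>s. f s + g s) t = primitive f t + primitive g t"
  unfolding primitive_def
  by (rule Bochner_Integration.integral_add[OF Linf_integrable[OF assms(1,3)]
      Linf_integrable[OF assms(2,3)]])

lemma primitive_0 [simp]: "t \<le> 0 \<Longrightarrow> primitive f t = 0"
  by (simp add: primitive_def integral_restrict_space)

lemma primitive_cong_AE:
  assumes "AE s in lebesgue_on {0<..<T}. f s = g s" "t \<le> T"
    and "f \<in> borel_measurable (lebesgue_on {0<..<T})" "g \<in> borel_measurable (lebesgue_on {0<..<T})"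
  shows "primitive f t = primitive g t"
  unfolding primitive_def
proof (rule integral_cong_AE)
  show "f \<in> borel_measurable (lebesgue_on {0<..<t})" "g \<in> borel_measurable (lebesgue_on {0<..<t})"
    using assms(2) by (auto intro: measurable_restrict_mono[OF assms(3)]
        measurable_restrict_mono[OF assms(4)])
  show "AE s in lebesgue_on {0<..<t}. f s = g s"
    using assms(1,2) by (simp add: AE_restrict_space_iff) (auto elim!: eventually_mono)
qed

text \<open>
  The integrals over \<open>(0, t)\<close> and \<open>(0, s)\<close> differ by an integral over \<open>[s, t]\<close>, on which the
  essential bound of \<open>f\<close> applies.
\<close>

lemma primitive_lipschitz:
  assumes "f \<in> Linf T"
  obtains C where "C-lipschitz_on {0..T} (primitive f)"
proof -
  obtain C where C: "f \<in> borel_measurable (lebesgue_on {0<..<T})" "C \<ge> 0"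
    "AE t in lebesgue_on {0<..<T}. norm (f t) \<le> C"
    using assms(1) by (rule LinfE)
  have less: "norm (primitive f t - primitive f s) \<le> C * (t - s)" if "0 \<le> s" "s \<le> t" "t \<le> T" for s t
  proof -
    have int: "integrable lebesgue (\<lambda>x. indicator {0<..<r} x *\<^sub>R f x)" if "r \<le> T" for r
      using Linf_integrable[OF assms that] by (simp add: integrable_restrict_space)
    have "primitive f t - primitive f s =
        (LINT x|lebesgue. indicator {0<..<t} x *\<^sub>R f x - indicator {0<..<s} x *\<^sub>R f x)"
      unfolding primitive_def using that by
          (simp add: integral_restrict_space Bochner_Integration.integral_diff int)
    also have "norm \<dots> \<le> (LINT x|lebesgue. C * indicator {s..t} x)"
    proof (rule order_trans[OF integral_norm_bound integral_mono_AE])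
      show "integrable lebesgue (\<lambda>x. C * indicator {s..t} x)"
        by (intro integrable_mult_right) (simp add: integrable_indicator_iff that)
      show "integrable lebesgue (\<lambda>x. norm
          (indicator {0<..<t} x *\<^sub>R f x - indicator {0<..<s} x *\<^sub>R f x))"
        using that by (intro integrable_norm Bochner_Integration.integrable_diff int) auto
      have "AE x in lebesgue. x \<in> {0<..<T} \<longrightarrow> norm (f x) \<le> C"
        using C(3) by (simp add: AE_restrict_space_iff)
      then show "AE x in lebesgue. norm (indicator {0<..<t} x *\<^sub>R f x - indicator {0<..<s} x *\<^sub>R f x)
          \<le> C * indicator {s..t} x"
        by eventually_elim (use C(2) that in \<open>auto simp: indicator_def\<close>)
    qed
    also have "\<dots> = C * (t - s)" using that by simp
    finally show ?thesis .
  qed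
  have "C-lipschitz_on {0..T} (primitive f)"
  proof (rule lipschitz_onI)
    fix s t assume "s \<in> {0..T}" "t \<in> {0..T}"
    then show "dist (primitive f s) (primitive f t) \<le> C * dist s t"
      using less[of s t] less[of t s] by (cases
          "s \<le> t") (auto simp: dist_norm norm_minus_commute abs_if)
  qed (rule C)
  then show ?thesis by (rule that)
qed

lemma primitive_continuous:
  assumes "f \<in> Linf T"
  shows "continuous_on {0..T} (primitive f)"
  using primitive_lipschitz[OF assms] lipschitz_on_continuous_on by blast

text \<open>
  The inner products of the two sides with a fixed vector are a Lebesgue and a gauge integral
  of the same real-valued continuous function. The identity makes the fundamental theorem of
  calculus for vector-valued functions, which is about the gauge integral, available for
  primitives.
\<close>

lemma primitive_eq_integral:
  fixes f :: "real \<Rightarrow> 'b::{real_inner, banach, second_countable_topology}"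
  assumes f: "continuous_on {0..T} f" and t: "t \<in> {0..T}"
  shows "primitive f t = integral {0..t} f"
proof -
  have "(primitive f t - integral {0..t} f) \<bullet> w = 0" for w
  proof -
    have ft: "continuous_on {0..t} f" using continuous_on_subset[OF f] t by auto
    have lin: "bounded_linear (\<lambda>x. x \<bullet> w)" by (rule bounded_linear_inner_left)
    have "primitive f t \<bullet> w = primitive (\<lambda>s. f s \<bullet> w) t"
      using primitive_bounded_linear[OF lin Linf_continuous[OF ft]] by simp
    also have "\<dots> = integral {0<..<t} (\<lambda>s. f s \<bullet> w)"
      unfolding primitive_def
      using Linf_integrable[OF Linf_bounded_linear[OF lin Linf_continuous[OF ft]]]
      by (intro lebesgue_integral_eq_integral) auto
    also have "\<dots> = integral {0..t} (\<lambda>s. f s \<bullet> w)"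
      using integral_open_interval[of 0 t "\<lambda>s. f s \<bullet> w"] by (simp add: box_real cbox_interval)
    also have "\<dots> = integral {0..t} f \<bullet> w"
      using integral_linear[OF integrable_continuous_real[OF ft] lin] by (simp add: o_def)
    finally show ?thesis by (simp add: inner_diff_left)
  qed
  from this[of "primitive f t - integral {0..t} f"] show ?thesis by simp
qed

lemma primitive_has_vector_derivative:
  fixes f :: "real \<Rightarrow> 'b::{real_inner, banach, second_countable_topology}"
  assumes f: "continuous_on {0..T} f" and t: "t \<in> {0..T}"
  shows "(primitive f has_vector_derivative f t) (at t within {0..T})"
proof -
  have "((\<lambda>u. integral {0..u} f) has_vector_derivative f t) (at t within {0..T})"
    by (rule integral_has_vector_derivative[OF f t])
  then show ?thesis
    by (rule has_vector_derivative_transform[OF t, rotated]) (simp add: primitive_eq_integral[OF f])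
qed

lemma primitive_eq_imp_eq:
  fixes f g :: "real \<Rightarrow> 'b::{real_inner, banach, second_countable_topology}"
  assumes "continuous_on {0..T} f" "continuous_on {0..T} g" "T > 0"
    and eq: "\<And>t. 0 < t \<Longrightarrow> t < T \<Longrightarrow> primitive f t = primitive g t"
    and t: "t \<in> {0..T}"
  shows "f t = g t"
proof -
  have eq': "primitive f s = primitive g s" if "s \<in> {0..T}" for s
  proof -
    have "continuous_on (closure {0<..<T}) (\<lambda>s. primitive f s - primitive g s)"
      using assms(1-3) by (auto intro!: continuous_on_diff primitive_continuous Linf_continuous)
    then have "primitive f s - primitive g s = 0"
      by (rule continuous_constant_on_closure) (use eq that assms(3) in auto)
    then show ?thesis by simp
  qed
  have "(primitive g has_vector_derivative f t) (at t within {0..T})"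
    by (rule has_vector_derivative_transform[OF t _ primitive_has_vector_derivative[OF assms(1) t]])
      (simp add: eq')
  then show ?thesis
    using primitive_has_vector_derivative[OF assms(2) t] t assms(3)
    by (intro vector_derivative_unique_within_closed_interval[of 0 T t "primitive g"])
        (auto simp: cbox_interval)
qed

section \<open>Weak derivatives of bounded measurable functions\<close>

text \<open>
  Iterated integrals are exchanged on the Borel sets of the plane, hence the passage from a
  Lebesgue measurable function to a Borel one. Truncation at \<open>\<plusminus> b\<close> turns the bound from almost
  everywhere to everywhere, which preserves the limit at \<open>0\<close> when \<open>b\<close> has one.
\<close>

lemma borel_representative:
  fixes q :: "real \<Rightarrow> real"
  assumes q: "q \<in> borel_measurable (lebesgue_on {0<..<T})"
    and bound: "AE t in lebesgue_on {0<..<T}. \<bar>q t\<bar> \<le> b t"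
    and b [measurable]: "b \<in> borel_measurable borel" and b_nonneg: "\<And>t. 0 \<le> b t"
  obtains q' where "q' \<in> borel_measurable borel" "\<And>t. \<bar>q' t\<bar> \<le> b t" "\<And>t. t \<notin> {0<..<T} \<Longrightarrow> q' t = 0"
    "AE t in lebesgue_on {0<..<T}. q t = q' t"
proof -
  have "(\<lambda>t. if t \<in> {0<..<T} then q t else 0) \<in> borel_measurable lebesgue"
    using q by (intro borel_measurable_if_I) auto
  then obtain g where g [measurable]: "g \<in> borel_measurable lborel"
    and ae: "AE t in lborel. (if t \<in> {0<..<T} then q t else 0) = g t"
    using completion_ex_borel_measurable_real by blast
  define q' where "q' t = (if t \<in> {0<..<T} then max (- b t) (min (b t) (g t)) else 0)" for t
  show ?thesis
  proof (rule that[of q'])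
    show "q' \<in> borel_measurable borel" 
      using g unfolding q'_def by measurable
    show "\<bar>q' t\<bar> \<le> b t" for t using b_nonneg[of t] by (auto simp: q'_def)
    show "q' t = 0" if "t \<notin> {0<..<T}" for t using that by (auto simp: q'_def)
    have "AE t in lebesgue. (if t \<in> {0<..<T} then q t else 0) = g t"
      using ae by (rule AE_completion)
    moreover have "AE t in lebesgue. t \<in> {0<..<T} \<longrightarrow> \<bar>q t\<bar> \<le> b t"
      using bound by (simp add: AE_restrict_space_iff)
    ultimately have "AE t in lebesgue. t \<in> {0<..<T} \<longrightarrow> q t = q' t"
      by eventually_elim (auto simp: q'_def)
    then show "AE t in lebesgue_on {0<..<T}. q t = q' t"
      by (simp add: AE_restrict_space_iff)
  qed
qed

lemma integral_borel_representative:
  fixes q q' w :: "real \<Rightarrow> real"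
  assumes "q \<in> borel_measurable (lebesgue_on {0<..<T})" "AE t in lebesgue_on {0<..<T}. q t = q' t"
    and [measurable]: "q' \<in> borel_measurable borel" "w \<in> borel_measurable borel" and "t \<le> T"
  shows "(LINT s|lebesgue_on {0<..<t}. w s * q s) = (LBINT s:{0<..<t}. w s * q' s)"
proof -
  have "(LINT s|lebesgue_on {0<..<t}. w s * q s) = (LINT s|lebesgue_on {0<..<t}. w s * q' s)"
  proof (rule integral_cong_AE)
    have w': "w \<in> borel_measurable lebesgue" "q' \<in> borel_measurable lebesgue"
      by (auto intro!: measurable_completion)
    have q: "q \<in> borel_measurable (lebesgue_on {0<..<t})"
      using assms(1) by (rule measurable_restrict_mono) (use \<open>t \<le> T\<close> in auto)
    show "(\<lambda>s. w s * q s) \<in> borel_measurable (lebesgue_on {0<..<t})"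
        "(\<lambda>s. w s * q' s) \<in> borel_measurable (lebesgue_on {0<..<t})"
      using q w'[THEN measurable_restrict_space1, of "{0<..<t}"]
          by (auto intro!: borel_measurable_times)
    have "AE s in lebesgue. s \<in> {0<..<T} \<longrightarrow> q s = q' s"
      using assms(2) by (simp add: AE_restrict_space_iff)
    then have "AE s in lebesgue. s \<in> {0<..<t} \<longrightarrow> w s * q s = w s * q' s"
      by eventually_elim (use \<open>t \<le> T\<close> in auto)
    then show "AE s in lebesgue_on {0<..<t}. w s * q s = w s * q' s"
      by (simp add: AE_restrict_space_iff)
  qed
  also have "\<dots> = (LINT s|lebesgue. indicator {0<..<t} s *\<^sub>R (w s * q' s))"
    by (simp add: integral_restrict_space)
  also have "\<dots> = (LBINT s:{0<..<t}. w s * q' s)"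
    unfolding set_lebesgue_integral_def by (rule integral_completion) measurable
  finally show ?thesis .
qed

lemma integral_lebesgue_on_borel:
  fixes F :: "real \<Rightarrow> real"
  assumes "F \<in> borel_measurable borel" "\<And>s. 0 < s \<Longrightarrow> s < t \<Longrightarrow> f s = F s"
  shows "(LINT s|lebesgue_on {0<..<t}. f s) = (LBINT s:{0<..<t}. F s)"
proof -
  have "(LINT s|lebesgue_on {0<..<t}. f s) = (LINT s|lebesgue_on {0<..<t}. F s)"
    using assms(2) by (intro Bochner_Integration.integral_cong) auto
  also have "\<dots> = (LINT s|lebesgue. indicator {0<..<t} s *\<^sub>R F s)"
    by (simp add: integral_restrict_space)
  also have "\<dots> = (LBINT s:{0<..<t}. F s)"
    unfolding set_lebesgue_integral_def using assms(1) by (intro integral_completion) measurable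
  finally show ?thesis .
qed

text \<open>
  The variable interval of integration is written as a product of indicators of Borel sets of
  the plane, which makes measurability in \<open>s\<close> an instance of the parameter integral theorem.
\<close>

lemma borel_measurable_LBINT_convolution:
  fixes \<kappa> q :: "real \<Rightarrow> real"
  assumes [measurable]: "\<kappa> \<in> borel_measurable borel" "q \<in> borel_measurable borel"
  shows "(\<lambda>s. LBINT r:{0<..<s}. \<kappa> (s - r) * q r) \<in> borel_measurable borel"
proof -
  have "(LBINT r:{0<..<s}. \<kappa> (s - r) * q r)
      = (LBINT r. indicator {0<..} r * indicator {0<..} (s - r) * (\<kappa> (s - r) * q r))" for s
    unfolding set_lebesgue_integral_def
    by (intro Bochner_Integration.integral_cong) (auto simp: indicator_def)
  moreover have "(\<lambda>s. LBINT r. indicator {0<..} r * indicator {0<..} (s - r) * (\<kappa> (s - r) * q r))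
      \<in> borel_measurable borel"
    by measurable
  ultimately show ?thesis by simp
qed

text \<open>
  Integration in time commutes with the convolution: \<open>1 * (\<kappa> * q) = \<kappa> * (1 * q)\<close>. Only the
  values of the kernel on \<open>(0, T)\<close> enter, so integrability is required there.
\<close>

lemma primitive_convolution:
  fixes \<kappa> q :: "real \<Rightarrow> real"
  assumes q: "q \<in> Linf T" and t: "t \<le> T"
    and \<kappa>_borel [measurable]: "\<kappa> \<in> borel_measurable borel"
    and \<kappa>: "integrable lborel (\<lambda>x. indicator {0<..<T} x * \<kappa> x)"
  shows "primitive (convolution \<kappa> q) t = convolution \<kappa> (primitive q) t"
proof -
  obtain C where C: "q \<in> borel_measurable (lebesgue_on {0<..<T})" "C \<ge> 0"
    "AE t in lebesgue_on {0<..<T}. norm (q t) \<le> C"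
    using q by (rule LinfE)
  obtain q' where q' [measurable]: "q' \<in> borel_measurable borel" 
    and q'_C: "\<And>t. \<bar>q' t\<bar> \<le> C" and q'_0: "\<And>t. t \<notin> {0<..<T} \<Longrightarrow> q' t = 0"
    and ae: "AE t in lebesgue_on {0<..<T}. q t = q' t"
    by (rule borel_representative[OF C(1) C(3)[unfolded real_norm_def] borel_measurable_const C(2)],
        rule that)
  let ?\<kappa> = "\<lambda>x. indicator {0<..<T} x * \<kappa> x"
  have q'_int: "integrable lborel q'"
  proof (rule Bochner_Integration.integrable_bound)
    show "integrable lborel (\<lambda>x::real. C * indicator {0<..<T} x)"
      by (cases "T \<ge> 0") (auto intro!: integrable_mult_right simp: integrable_indicator_iff)
    show "AE x in lborel. norm (q' x) \<le> norm (C * indicator {0<..<T} x)"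
    proof (rule AE_I2)
      fix x show "norm (q' x) \<le> norm (C * indicator {0<..<T} x)"
        using q'_C[of x] q'_0[of x] by (cases "x \<in> {0<..<T}") auto
    qed
  qed simp
  have conv: "convolution \<kappa> q s = (LBINT r:{0<..<s}. ?\<kappa> (s - r) * q' r)" if "s \<le> T" for s
  proof -
    have "convolution \<kappa> q s = (LBINT r:{0<..<s}. \<kappa> (s - r) * q' r)"
      unfolding convolution_def using integral_borel_representative[OF C(1) ae q', of
          "\<lambda>r. \<kappa> (s - r)" s] that
      by simp
    also have "\<dots> = (LBINT r:{0<..<s}. ?\<kappa> (s - r) * q' r)"
      using that by (intro set_lebesgue_integral_cong allI impI) auto
    finally show ?thesis .
  qed
  have prim: "primitive q s = (LBINT r:{0<..<s}. q' r)" if "s \<le> T" for s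
    unfolding primitive_def using integral_borel_representative[OF C(1) ae q', of "\<lambda>_. 1" s] that
        by simp
  have "primitive (convolution \<kappa> q) t = (LBINT s:{0<..<t}. LBINT r:{0<..<s}. ?\<kappa> (s - r) * q' r)"
    unfolding primitive_def using t
    by (intro integral_lebesgue_on_borel borel_measurable_LBINT_convolution conv) auto
  also have "\<dots> = (LBINT s:{0<..<t}. ?\<kappa> (t - s) * (LBINT r:{0<..<s}. q' r))"
    by (rule Fubini_convolution[OF \<kappa> q'_int])
  also have "\<dots> = convolution \<kappa> (primitive q) t"
  proof -
    have [measurable]: "(\<lambda>s. LBINT r:{0<..<s}. q' r) \<in> borel_measurable borel"
      using borel_measurable_LBINT_convolution[of "\<lambda>_. 1" q'] by simp
    have "convolution \<kappa> (primitive q) t = (LBINT s:{0<..<t}. \<kappa> (t - s) * (LBINT r:{0<..<s}. q' r))"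
      unfolding convolution_def real_scaleR_def using t prim
      by (intro integral_lebesgue_on_borel) auto
    also have "\<dots> = (LBINT s:{0<..<t}. ?\<kappa> (t - s) * (LBINT r:{0<..<s}. q' r))"
      using t by (intro set_lebesgue_integral_cong allI impI) auto
    finally show ?thesis by simp
  qed
  finally show ?thesis .
qed

text \<open>
  The definition provides integrability on compact subintervals; these exhaust \<open>(0, T)\<close>.
\<close>

lemma weak_time_derivative_measurable:
  fixes f g :: "real \<Rightarrow> real"
  assumes "weak_time_derivative T f g" "T > 0"
  shows "f \<in> borel_measurable (lebesgue_on {0<..<T})" "g \<in> borel_measurable (lebesgue_on {0<..<T})"
proof -
  have *: "z \<in> borel_measurable (lebesgue_on {0<..<T})"
    if int: "\<And>s t. 0 < s \<Longrightarrow> t < T \<Longrightarrow> integrable (lebesgue_on {s..t}) z" for z :: "real \<Rightarrow> real"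
  proof -
    define A where "A n = {1 / real (Suc n)..T - 1 / real (Suc n)}" for n
    have z_n: "(\<lambda>x. if x \<in> A n then z x else 0) \<in> borel_measurable lebesgue" for n
      unfolding A_def by (intro borel_measurable_if_I borel_measurable_integrable int) auto
    have "(\<lambda>x. if x \<in> {0<..<T} then z x else 0) \<in> borel_measurable lebesgue"
    proof (rule borel_measurable_LIMSEQ_real[OF _ z_n])
      fix x
      show "(\<lambda>n. if x \<in> A n then z x else 0) \<longlonglongrightarrow> (if x \<in> {0<..<T} then z x else 0)"
      proof (cases "x \<in> {0<..<T}")
        case True
        then have "0 < min x (T - x)" by simp
        then have "\<forall>\<^sub>F n in sequentially. 1 / real (Suc n) < min x (T - x)"
          using order_tendstoD(2)[OF LIMSEQ_inverse_real_of_nat] unfolding inverse_eq_divide by blast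
        then have "\<forall>\<^sub>F n in sequentially. (if x \<in> A n then z x else 0) = z x"
          by eventually_elim (auto simp: A_def)
        then show ?thesis using True by (simp add: tendsto_eventually)
      next
        case False
        have "0 < 1 / real (Suc n)" for n by simp
        then have "x \<notin> A n" for n using False unfolding A_def
            by (smt (verit) atLeastAtMost_iff greaterThanLessThan_iff)
        then show ?thesis using False by auto
      qed
    qed
    then show ?thesis by (rule borel_measurable_if_D)
  qed
  show "f \<in> borel_measurable (lebesgue_on {0<..<T})" "g \<in> borel_measurable (lebesgue_on {0<..<T})"
    using assms(1) by (auto simp: weak_time_derivative_def intro!: *)
qed

text \<open>
  A function that vanishes at \<open>0\<close> is the primitive of its weak derivative. Integrating both
  sides once more gives a statement that holds at every time, whereas \<open>f\<close> itself is determined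
  almost everywhere only.
\<close>

lemma weak_time_derivative_primitive:
  fixes f h b :: "real \<Rightarrow> real"
  assumes weak: "weak_time_derivative T f h"
    and f_b: "AE t in lebesgue_on {0<..<T}. \<bar>f t\<bar> \<le> b t"
    and b [measurable]: "b \<in> borel_measurable borel" and b_nonneg: "\<And>t. 0 \<le> b t" and b_N: "\<And>t. b t \<le> N"
    and b_0: "(b \<longlongrightarrow> 0) (at_right 0)"
    and h_M: "AE t in lebesgue_on {0<..<T}. \<bar>h t\<bar> \<le> M"
    and t: "0 < t" "t < T"
  shows "primitive f t = primitive (primitive h) t"
proof -
  have T: "T > 0" using t by simp
  define C where "C = max N \<bar>M\<bar>"
  have C: "\<And>t. b t \<le> C" "M \<le> C" "0 \<le> C" using b_N unfolding C_def
      by (auto intro: le_max_iff_disj[THEN iffD2])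
  have h_C: "AE t in lebesgue_on {0<..<T}. \<bar>h t\<bar> \<le> C"
    using h_M by eventually_elim (use C(2) in linarith)
  note fm = weak_time_derivative_measurable(1)[OF weak T] and hm
      = weak_time_derivative_measurable(2)[OF weak T]
  obtain f' where f' [measurable]: "f' \<in> borel_measurable borel" 
    and f'_b: "\<And>t. \<bar>f' t\<bar> \<le> b t" and f'_0: "\<And>t. t \<notin> {0<..<T} \<Longrightarrow> f' t = 0"
    and f_ae: "AE t in lebesgue_on {0<..<T}. f t = f' t"
    by (rule borel_representative[OF fm f_b b b_nonneg], rule that)
  obtain h' where h' [measurable]: "h' \<in> borel_measurable borel" 
    and h'_C: "\<And>t. \<bar>h' t\<bar> \<le> C" and h'_0: "\<And>t. t \<notin> {0<..<T} \<Longrightarrow> h' t = 0"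
    and h_ae: "AE t in lebesgue_on {0<..<T}. h t = h' t"
    by (rule borel_representative[OF hm h_C borel_measurable_const C(3)], rule that)
  have whole: "(LBINT x:{0<..<T}. w x * q x) = (LBINT x. w x * q x)" if
      "\<And>x. x \<notin> {0<..<T} \<Longrightarrow> q x = 0" for w q :: "real \<Rightarrow> real"
    unfolding set_lebesgue_integral_def using that
    by (intro Bochner_Integration.integral_cong) (auto simp: indicator_def)
  have "(LBINT x. deriv \<psi> x * f' x) = - (LBINT x. \<psi> x * h' x)" if \<psi>: "\<psi> \<in> test_functions {0<..<T}" for \<psi>
  proof -
    have Ck: "C_k 0 \<psi>" "C_k (Suc 0) \<psi>" using \<psi> unfolding test_functions_def by blast+
    have "C_k 0 (deriv \<psi>)" by (rule C_k_SucE[OF Ck(2)])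
    with Ck(1) have [measurable]: "\<psi> \<in> borel_measurable borel" "deriv \<psi> \<in> borel_measurable borel"
      by (auto intro: borel_measurable_continuous_onI)
    have "(LINT t|lebesgue_on {0<..<T}. deriv \<psi> t * f t) = - (LINT t|lebesgue_on {0<..<T}. \<psi> t * h t)"
      using weak \<psi> by (simp add: weak_time_derivative_def)
    moreover have "(LINT t|lebesgue_on {0<..<T}. deriv \<psi> t * f t) = (LBINT x. deriv \<psi> x * f' x)"
      using integral_borel_representative[OF fm f_ae, of "deriv \<psi>" T] whole[OF f'_0] by simp
    moreover have "(LINT t|lebesgue_on {0<..<T}. \<psi> t * h t) = (LBINT x. \<psi> x * h' x)"
      using integral_borel_representative[OF hm h_ae, of \<psi> T] whole[OF h'_0] by simp
    ultimately show ?thesis by simp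
  qed
  from weak_derivative_weighted_integral[OF f' h' f'_b C(1) h'_C b_0 f'_0 h'_0 this t]
  have "(LBINT x:{0<..<t}. f' x) = (LBINT x:{0<..<t}. (t - x) * h' x)" .
  also have "\<dots> = (LBINT s:{0<..<t}. LBINT r:{0<..<s}. h' r)"
  proof (rule iterated_integral_eq_weighted[symmetric])
    show "integrable lborel h'"
    proof (rule Bochner_Integration.integrable_bound)
      show "integrable lborel (\<lambda>x::real. C * indicator {0<..<T} x)"
        using T by (intro integrable_mult_right) (simp add: integrable_indicator_iff)
      show "AE x in lborel. norm (h' x) \<le> norm (C * indicator {0<..<T} x)"
      proof (rule AE_I2)
        fix x show "norm (h' x) \<le> norm (C * indicator {0<..<T} x)"
          using h'_C[of x] h'_0[of x] by (cases "x \<in> {0<..<T}") auto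
      qed
    qed simp
  qed
  also have "\<dots> = primitive (primitive h) t"
  proof -
    have "(\<lambda>s. LBINT r:{0<..<s}. h' r) \<in> borel_measurable borel"
      using borel_measurable_LBINT_convolution[of "\<lambda>_. 1" h'] by simp
    moreover have "primitive h s = (LBINT r:{0<..<s}. h' r)" if "s \<le> T" for s
      unfolding primitive_def using integral_borel_representative[OF hm h_ae h', of "\<lambda>_. 1" s] that
          by simp
    ultimately show ?thesis
      unfolding primitive_def[of "primitive h"] using t
          by (intro integral_lebesgue_on_borel[symmetric]) auto
  qed
  also have "(LBINT x:{0<..<t}. f' x) = primitive f t"
    unfolding primitive_def using integral_borel_representative[OF fm f_ae f', of "\<lambda>_. 1" t] t by simp
  finally show ?thesis .
qed

lemma weak_time_derivative_bounded_linear: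
  assumes L: "bounded_linear L" and weak: "weak_time_derivative T f g" and "f \<in> Linf T" "g \<in> Linf T"
  shows "weak_time_derivative T (\<lambda>t. L (f t)) (\<lambda>t. L (g t))"
  unfolding weak_time_derivative_def
proof (intro conjI allI impI ballI)
  fix s t :: real assume "0 < s" "t < T"
  then show "integrable (lebesgue_on {s..t}) (\<lambda>t. L (f t))"
      "integrable (lebesgue_on {s..t}) (\<lambda>t. L (g t))"
    using weak by (auto simp: weak_time_derivative_def intro!: integrable_bounded_linear[OF L])
next
  fix \<psi> :: "real \<Rightarrow> real" assume \<psi>: "\<psi> \<in> test_functions {0<..<T}"
  have Ck: "C_k 0 \<psi>" "C_k (Suc 0) \<psi>" using \<psi> unfolding test_functions_def by blast+
  have "C_k 0 (deriv \<psi>)" by (rule C_k_SucE[OF Ck(2)])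
  with Ck(1) have cont: "continuous_on {0..T} \<psi>" "continuous_on {0..T} (deriv \<psi>)"
    by (auto intro: continuous_on_subset)
  have int: "integrable (lebesgue_on {0<..<T}) (\<lambda>t. w t *\<^sub>R z t)"
    if w: "continuous_on {0..T} w" and z: "z \<in> Linf T" for w :: "real \<Rightarrow> real" and z :: "real \<Rightarrow> 'a"
  proof -
    obtain C where C: "w \<in> borel_measurable (lebesgue_on {0<..<T})" "C \<ge> 0"
      "AE t in lebesgue_on {0<..<T}. norm (w t) \<le> C"
      using Linf_continuous[OF w] by (rule LinfE)
    obtain D where D: "z \<in> borel_measurable (lebesgue_on {0<..<T})" "D \<ge> 0"
      "AE t in lebesgue_on {0<..<T}. norm (z t) \<le> D"
      using z by (rule LinfE)
    have "AE t in lebesgue_on {0<..<T}. norm (w t *\<^sub>R z t) \<le> C * D"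
      using C(3) D(3) by eventually_elim (auto intro!: mult_mono C(2))
    then have "(\<lambda>t. w t *\<^sub>R z t) \<in> Linf T"
      using C D by (intro LinfI[of _ _ "C * D"]) auto
    then show ?thesis by (rule Linf_integrable) simp
  qed
  interpret L: bounded_linear L by (rule L)
  have "(LINT t|lebesgue_on {0<..<T}. deriv \<psi> t *\<^sub>R f t) = - (LINT t|lebesgue_on {0<..<T}. \<psi> t *\<^sub>R g t)"
    using weak \<psi> by (simp add: weak_time_derivative_def)
  then have "L (LINT t|lebesgue_on {0<..<T}. deriv \<psi> t *\<^sub>R f t)
      = - L (LINT t|lebesgue_on {0<..<T}. \<psi> t *\<^sub>R g t)"
    by (simp add: linear_neg[OF L.linear])
  then show "(LINT t|lebesgue_on {0<..<T}. deriv \<psi> t *\<^sub>R L (f t))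
      = - (LINT t|lebesgue_on {0<..<T}. \<psi> t *\<^sub>R L (g t))"
    using integral_bounded_linear[OF L int[OF cont(2) assms(3)]]
        integral_bounded_linear[OF L int[OF cont(1) assms(4)]]
    by (simp add: L.scaleR)
qed

section \<open>Positivity of the fractional kernel\<close>

lemma powr_integral_Ioo:
  fixes s \<beta> :: real
  assumes "\<beta> < 1" "0 \<le> s"
  shows "has_bochner_integral lborel (\<lambda>x. indicator {0<..<s} x * x powr (-\<beta>))
      (s powr (1 - \<beta>) / (1 - \<beta>))"
proof -
  have "((\<lambda>x. x powr (-\<beta>)) has_integral (s powr (-\<beta> + 1) / (-\<beta> + 1))) {0..s}"
    using assms by (intro has_integral_powr_from_0) auto
  then have "((\<lambda>x. x powr (-\<beta>)) has_integral (s powr (1 - \<beta>) / (1 - \<beta>))) {0..s}"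
    by (simp add: add.commute)
  then have "integral\<^sup>N lborel (\<lambda>x. indicator {0..s} x * (x powr (-\<beta>)))
      = ennreal (s powr (1 - \<beta>) / (1 - \<beta>))"
    by (intro nn_integral_has_integral_lebesgue) auto
  also have "integral\<^sup>N lborel (\<lambda>x. indicator {0..s} x * (x powr (-\<beta>)))
      = integral\<^sup>N lborel (\<lambda>x. ennreal (indicator {0<..<s} x * x powr (-\<beta>)))"
  proof (rule nn_integral_cong_AE)
    have "AE x in lborel. x \<noteq> s" by (rule AE_lborel_singleton)
    then show "AE x in lborel. ennreal (indicator {0..s} x * x powr (-\<beta>))
        = ennreal (indicator {0<..<s} x * x powr (-\<beta>))"
      by eventually_elim (auto simp: indicator_def)
  qed
  finally show ?thesis
    using assms by (intro has_bochner_integral_nn_integral) auto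
qed

text \<open>
  The Bernstein representation of the power kernel as a superposition of exponentials with the
  nonnegative weight \<open>l powr (\<alpha> - 1) / Gamma \<alpha>\<close>. It follows from the integral for the Gamma
  function by the substitution \<open>t = x l\<close>.
\<close>

lemma Laplace_transform_powr:
  fixes \<alpha> x :: real
  assumes "\<alpha> > 0" "x > 0"
  shows "has_bochner_integral lborel (\<lambda>l. indicator {0<..} l * (l powr (\<alpha> - 1) * exp (- l * x)))
      (Gamma \<alpha> * x powr (-\<alpha>))"
proof -
  have "has_bochner_integral lborel (\<lambda>t. indicator {0..} t * t powr (\<alpha> - 1) / exp t) (Gamma \<alpha>)"
    using Gamma_conv_nn_integral_real[OF assms(1)] Gamma_real_pos[OF assms(1)]
    by (intro has_bochner_integral_nn_integral) auto
  then have "has_bochner_integral lborel (\<lambda>l. indicator {0..} (0 + x * l) * (0 + x * l) powr (\<alpha> - 1)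
      / exp (0 + x * l)) (Gamma \<alpha> /\<^sub>R \<bar>x\<bar>)"
    using assms by (subst lborel_has_bochner_integral_real_affine_iff[of x _ _ 0, symmetric]) auto
  then have "has_bochner_integral lborel (\<lambda>l. x powr (1 - \<alpha>)
      * (indicator {0..} (0 + x * l) * (0 + x * l) powr (\<alpha> - 1) / exp (0 + x * l))) (x powr (1 - \<alpha>)
      * (Gamma \<alpha> /\<^sub>R \<bar>x\<bar>))"
    by (rule has_bochner_integral_mult_right)
  moreover have "x powr (1 - \<alpha>) * (indicator {0..} (0 + x * l) * (0 + x * l) powr (\<alpha> - 1)
      / exp (0 + x * l))
      = indicator {0<..} l * (l powr (\<alpha> - 1) * exp (- l * x))" for l
  proof (cases "l > 0")
    case True
    then have "(x * l) powr (\<alpha> - 1) = x powr (\<alpha> - 1) * l powr (\<alpha> - 1)"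
      using assms by (simp add: powr_mult)
    moreover have "x powr (1 - \<alpha>) * x powr (\<alpha> - 1) = 1"
      using assms by (simp flip: powr_add)
    ultimately show ?thesis
      using True assms by (simp add: exp_minus field_simps)
  next
    case False
    then show ?thesis using assms by (auto simp: indicator_def zero_le_mult_iff)
  qed
  moreover have "x powr (1 - \<alpha>) * (Gamma \<alpha> /\<^sub>R \<bar>x\<bar>) = Gamma \<alpha> * x powr (-\<alpha>)"
    using assms by (simp add: powr_diff powr_minus field_simps)
  ultimately show ?thesis by (simp only:)
qed

lemma borel_measurable_fst_snd:
  fixes h :: "'x \<Rightarrow> real \<times> real"
  assumes "h \<in> borel_measurable M"
  shows "(\<lambda>x. fst (h x)) \<in> borel_measurable M" "(\<lambda>x. snd (h x)) \<in> borel_measurable M"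
  by (rule measurable_compose[OF assms borel_measurable_continuous_onI]; intro continuous_intros)+

lemma triangle_integral:
  fixes W :: "real \<Rightarrow> real" and k :: "real \<times> real \<Rightarrow> real"
  assumes "integrable lborel (\<lambda>p::real \<times> real. indicator {0<..<s} (fst p)
      * indicator {0<..<fst p} (snd p) * (W (fst p - snd p) * k p))"
  shows "(LBINT p. indicator {0<..<s} (fst p) * indicator {0<..<fst p} (snd p)
      * (W (fst p - snd p) * k p)) = (LBINT t:{0<..<s}. LBINT r:{0<..<t}. W (t - r) * k (t, r))"
proof -
  let ?f = "\<lambda>p::real \<times> real. indicator {0<..<s} (fst p) * indicator {0<..<fst p} (snd p)
      * (W (fst p - snd p) * k p)"
  have "(LBINT p. ?f p) = (LBINT t. LBINT r. ?f (t, r))"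
    using lborel_pair.integral_fst'[of ?f] assms by (simp add: lborel_prod)
  also have "\<dots> = (LBINT t:{0<..<s}. LBINT r:{0<..<t}. W (t - r) * k (t, r))"
    unfolding set_lebesgue_integral_def
    by (intro Bochner_Integration.integral_cong refl, subst integral_scaleR_right[symmetric],
        intro Bochner_Integration.integral_cong)
       (auto simp: mult.assoc)
  finally show ?thesis .
qed

text \<open>
  By the Bernstein representation the integral over the triangle \<open>0 < r < t < s\<close> against the
  power kernel is a mixture of the same integrals against \<open>exp (- l (t - r))\<close>. The exchange of
  the integral over \<open>l\<close> with the one over the triangle is justified by the integrability of the
  power kernel itself.
\<close>

lemma powr_kernel_nonneg:
  fixes k :: "real \<times> real \<Rightarrow> real"
  assumes k [measurable]: "k \<in> borel_measurable borel" and M: "\<And>p. \<bar>k p\<bar> \<le> M"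
    and \<alpha>: "0 < \<alpha>" "\<alpha> < 1" and s: "0 \<le> s"
    and exp_nonneg: "\<And>l. l > 0 \<Longrightarrow> 0 \<le> (LBINT t:{0<..<s}. LBINT r:{0<..<t}. exp (- l * (t - r))
        * k (t, r))"
  shows "0 \<le> (LBINT t:{0<..<s}. LBINT r:{0<..<t}. (t - r) powr (-\<alpha>) * k (t, r))"
proof -
  note [measurable] = borel_measurable_fst_snd
  define D :: "real \<times> real \<Rightarrow> real" where "D p
      = indicator {0<..<s} (fst p) * indicator {0<..} (snd p) * indicator {0<..} (fst p - snd p)" for p
  have D_eq: "D p = indicator {0<..<s} (fst p) * indicator {0<..<fst p} (snd p)" for p
    by (auto simp: D_def indicator_def)
  have [measurable]: "D \<in> borel_measurable borel"
    unfolding D_def by measurable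
  have M0: "0 \<le> M" using M[of undefined] by linarith
  let ?\<kappa> = "\<lambda>x. indicator {0<..<s} x * x powr (-\<alpha>)"
  have \<kappa>: "integrable lborel ?\<kappa>"
    using powr_integral_Ioo[of \<alpha> s] \<alpha> s by (auto simp: has_bochner_integral_iff)
  have \<kappa>_shift: "integrable lborel (\<lambda>r. ?\<kappa> (t - r))" "(LBINT r. ?\<kappa> (t - r)) = (LBINT x. ?\<kappa> x)" for t
    using lborel_integrable_real_affine[OF \<kappa>, of "-1" t] lborel_integral_real_affine[of "-1" ?\<kappa> t]
        by simp_all
  have "integrable (lborel \<Otimes>\<^sub>M lborel) (\<lambda>(t, r). indicator {0<..<s} t * ?\<kappa> (t - r))"
  proof (rule lborel_pair.Fubini_integrable)
    have "(LBINT r. norm (case (t, r) of (t, r) \<Rightarrow> indicator {0<..<s} t * ?\<kappa> (t - r)))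
        = indicator {0<..<s} t * (LBINT x. ?\<kappa> x)" for t
      by (simp add: abs_mult \<kappa>_shift)
    moreover have "integrable lborel (\<lambda>t. indicator {0<..<s} t * (LBINT x. ?\<kappa> x))"
      using s by (intro integrable_mult_left) (simp add: integrable_indicator_iff)
    ultimately show "integrable lborel (\<lambda>t. LBINT r. norm
        (case (t, r) of (t, r) \<Rightarrow> indicator {0<..<s} t * ?\<kappa> (t - r)))"
      by (simp only:)
  qed (auto intro!: AE_I2 \<kappa>_shift)
  then have int0: "integrable lborel (\<lambda>p::real \<times> real. indicator {0<..<s} (fst p) * ?\<kappa> (fst p - snd p))"
    by (simp add: lborel_prod case_prod_unfold)
  have int1: "integrable lborel (\<lambda>p. D p * ((fst p - snd p) powr (-\<alpha>) * k p))"
  proof (rule Bochner_Integration.integrable_bound)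
    show "integrable lborel (\<lambda>p::real \<times> real. M * (indicator {0<..<s} (fst p) * ?\<kappa> (fst p - snd p)))"
      by (rule integrable_mult_right[OF int0])
    show "AE p in lborel. norm (D p * ((fst p - snd p) powr (-\<alpha>) * k p))
        \<le> norm (M * (indicator {0<..<s} (fst p) * ?\<kappa> (fst p - snd p)))"
    proof (rule AE_I2)
      fix p :: "real \<times> real"
      have "\<bar>k p\<bar> * (fst p - snd p) powr (-\<alpha>) \<le> M * (fst p - snd p) powr (-\<alpha>)"
        using M by (rule mult_right_mono) simp
      then show "norm (D p * ((fst p - snd p) powr (-\<alpha>) * k p))
          \<le> norm (M * (indicator {0<..<s} (fst p) * ?\<kappa> (fst p - snd p)))"
        using M0 by (auto simp: D_def indicator_def abs_mult mult.commute)
    qed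
  qed measurable
  have int2: "integrable lborel (\<lambda>p. D p * (exp (- l * (fst p - snd p)) * k p))" if l: "l > 0" for l
  proof (rule Bochner_Integration.integrable_bound)
    have "integrable lborel (indicator ({0<..<s} \<times> {0<..<s}) :: real \<times> real \<Rightarrow> real)"
      using s by (intro integrable_real_indicator)
          (auto simp: lborel_prod[symmetric] lborel.emeasure_pair_measure_Times ennreal_mult_less_top)
    then show "integrable lborel (\<lambda>p::real \<times> real. M * indicator ({0<..<s} \<times> {0<..<s}) p)"
      by (rule integrable_mult_right)
    show "AE p in lborel. norm (D p * (exp (- l * (fst p - snd p)) * k p))
        \<le> norm (M * indicator ({0<..<s} \<times> {0<..<s}) p)"
    proof (rule AE_I2)
      fix p :: "real \<times> real"
      have "exp (- l * (fst p - snd p)) * \<bar>k p\<bar> \<le> 1 * M" if "fst p > snd p"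
        using that l M[of p] by (intro mult_mono) (auto simp: mult_le_0_iff)
      then show "norm (D p * (exp (- l * (fst p - snd p)) * k p))
          \<le> norm (M * indicator ({0<..<s} \<times> {0<..<s}) p)"
        using M0 by (cases p) (auto simp: D_def indicator_def abs_mult)
    qed
  qed measurable
  define f where "f p l = D p * k p * (indicator {0<..} l *
      (l powr (\<alpha> - 1) * exp (- l * (fst p - snd p))))" for p :: "real \<times> real" and l :: real
  have inner: "has_bochner_integral lborel (f p) (Gamma \<alpha> * (D p * ((fst p - snd p) powr (-\<alpha>) * k p)))"
      for p
  proof (cases "D p = 0")
    case False
    then have "fst p - snd p > 0" by (auto simp: D_def indicator_def split: if_splits)
    from has_bochner_integral_mult_right[OF Laplace_transform_powr[OF \<alpha>(1) this], of "D p * k p"]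
    show ?thesis unfolding f_def by (simp add: mult_ac)
  qed (simp add: f_def[abs_def] has_bochner_integral_zero)
  have f_abs: "\<bar>f p l\<bar> = f p l * sgn (D p * k p)" for p l
  proof -
    have "\<bar>x * w\<bar> = x * w * sgn x" if "w \<ge> 0" for x w :: real
      using that abs_sgn[of x] by (simp add: abs_mult mult_ac)
    then show ?thesis unfolding f_def by simp
  qed
  \<comment> \<open>The integral of \<open>\<bar>f p l\<bar>\<close> over \<open>l\<close> reproduces, up to \<open>Gamma \<alpha>\<close>, the integrand with the power kernel.\<close>
  have f_int: "integrable (lborel \<Otimes>\<^sub>M lborel) (case_prod f)"
  proof (rule lborel_pair.Fubini_integrable)
    show "case_prod f \<in> borel_measurable (lborel \<Otimes>\<^sub>M lborel)"
      unfolding f_def by measurable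
    have "(LBINT l. norm (case (p, l) of (p, l) \<Rightarrow> f p l))
        = \<bar>Gamma \<alpha> * (D p * ((fst p - snd p) powr (-\<alpha>) * k p))\<bar>" for p
    proof -
      have "(LBINT l. \<bar>f p l\<bar>) = (LBINT l. f p l) * sgn (D p * k p)"
        by (simp add: f_abs)
      also have "\<dots> = Gamma \<alpha> * (D p * ((fst p - snd p) powr (-\<alpha>) * k p)) * sgn (D p * k p)"
        using inner[of p] by (simp add: has_bochner_integral_iff)
      also have "\<dots> = \<bar>Gamma \<alpha> * (D p * ((fst p - snd p) powr (-\<alpha>) * k p))\<bar>"
        using Gamma_real_pos[OF \<alpha>(1)] by (auto simp: abs_mult sgn_if D_def indicator_def)
      finally show ?thesis by simp
    qed
    then show "integrable lborel (\<lambda>p. LBINT l. norm (case (p, l) of (p, l) \<Rightarrow> f p l))"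
      using int1 by simp
  qed (use inner in \<open>auto simp: has_bochner_integral_iff\<close>)
  have "0 \<le> (LBINT l. LBINT p. f p l)"
  proof (rule Bochner_Integration.integral_nonneg)
    fix l :: real
    show "0 \<le> (LBINT p. f p l)"
    proof (cases "l > 0")
      case True
      have "(LBINT p. f p l) = l powr (\<alpha> - 1) * (LBINT p. D p * (exp (- l * (fst p - snd p)) * k p))"
        using True by (simp add: f_def mult_ac flip: integral_mult_right_zero)
      also have "(LBINT p. D p * (exp (- l * (fst p - snd p)) * k p))
          = (LBINT t:{0<..<s}. LBINT r:{0<..<t}. exp (- l * (t - r)) * k (t, r))"
        using triangle_integral[of s "\<lambda>x. exp (- l * x)" k] int2[OF True] unfolding D_eq by simp
      finally show ?thesis using exp_nonneg[OF True] by simp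
    qed (simp add: f_def)
  qed
  also have "\<dots> = (LBINT p. LBINT l. f p l)"
    by (rule lborel_pair.Fubini_integral[OF f_int])
  also have "\<dots> = Gamma \<alpha> * (LBINT p. D p * ((fst p - snd p) powr (-\<alpha>) * k p))"
    using inner by (simp add: has_bochner_integral_iff)
  also have "(LBINT p. D p * ((fst p - snd p) powr (-\<alpha>) * k p))
      = (LBINT t:{0<..<s}. LBINT r:{0<..<t}. (t - r) powr (-\<alpha>) * k (t, r))"
    using triangle_integral[of s "\<lambda>x. x powr (-\<alpha>)" k] int1 unfolding D_eq by simp
  finally show ?thesis
    using Gamma_real_pos[OF \<alpha>(1)] by (simp add: zero_le_mult_iff)
qed

text \<open>
  Both functions are extended from \<open>[0, T]\<close> to the line by clamping the argument, which yields
  one bounded continuous function \<open>k\<close> on the plane.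
\<close>

lemma primitive_convolution_eq_LBINT:
  fixes u y :: "real \<Rightarrow> 'h::real_inner" and W :: "real \<Rightarrow> real"
  assumes u: "continuous_on {0..T} u" and y: "continuous_on {0..T} y"
    and W [measurable]: "W \<in> borel_measurable borel" and s: "0 \<le> s" "s \<le> T"
    and k_def: "k = (\<lambda>p. u (max 0 (min T (snd p))) \<bullet> y (max 0 (min T (fst p))))"
  shows "primitive (\<lambda>t. convolution W (\<lambda>r. u r \<bullet> y t) t) s
      = (LBINT t:{0<..<s}. LBINT r:{0<..<t}. W (t - r) * k (t, r))"
    and "k \<in> borel_measurable borel" and "\<exists>M. \<forall>p. \<bar>k p\<bar> \<le> M"
proof -
  have T: "0 \<le> T" using s by linarith
  have clamp: "max 0 (min T x) \<in> {0..T}" for x using T by auto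
  have "continuous_on UNIV k"
    unfolding k_def
    by (intro continuous_on_inner continuous_on_compose2[OF u] continuous_on_compose2[OF y]
        continuous_intros) (use T in auto)
  then show k [measurable]: "k \<in> borel_measurable borel" by (rule borel_measurable_continuous_onI)
  have bdd: "\<exists>N. \<forall>x\<in>{0..T}. norm (v x) \<le> N" if "continuous_on {0..T} v" for v :: "real \<Rightarrow> 'h"
    using compact_imp_bounded[OF compact_continuous_image[OF that compact_Icc]]
        by (simp add: bounded_iff)
  obtain N1 N2 where N: "\<And>x. x \<in> {0..T} \<Longrightarrow> norm (u x) \<le> N1" "\<And>x. x \<in> {0..T} \<Longrightarrow> norm (y x) \<le> N2"
    using bdd[OF u] bdd[OF y] by blast
  have "\<bar>k p\<bar> \<le> N1 * N2" for p
  proof -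
    have "\<bar>k p\<bar> \<le> norm (u (max 0 (min T (snd p)))) * norm (y (max 0 (min T (fst p))))"
      unfolding k_def by (rule Cauchy_Schwarz_ineq2)
    also have "\<dots> \<le> N1 * N2"
      using N(1)[OF clamp] N(2)[OF clamp]
          by (intro mult_mono) (auto intro: order_trans[OF norm_ge_zero])
    finally show ?thesis .
  qed
  then show "\<exists>M. \<forall>p. \<bar>k p\<bar> \<le> M" by blast
  have [measurable]: "(\<lambda>r. k (t, r)) \<in> borel_measurable borel" for t
    by measurable
  have "convolution W (\<lambda>r. u r \<bullet> y t) t = (LBINT r:{0<..<t}. W (t - r) * k (t, r))" if "0 < t"
      "t < s" for t
    unfolding convolution_def real_scaleR_def
  proof (rule integral_lebesgue_on_borel)
    fix r assume "0 < r" "r < t"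
    then show "W (t - r) * (u r \<bullet> y t) = W (t - r) * k (t, r)" 
      using that s by (simp add: k_def min_def max_def)
  qed measurable
  moreover have "(\<lambda>t. LBINT r:{0<..<t}. W (t - r) * k (t, r)) \<in> borel_measurable borel"
  proof -
    have "(LBINT r:{0<..<t}. W (t - r) * k (t, r))
        = (LBINT r. indicator {0<..} r * indicator {0<..} (t - r) * (W (t - r) * k (t, r)))" for t
      unfolding set_lebesgue_integral_def
      by (intro Bochner_Integration.integral_cong) (auto simp: indicator_def)
    moreover have "(\<lambda>t. LBINT r. indicator {0<..} r * indicator {0<..} (t - r) * (W (t - r) * k (t, r)))
        \<in> borel_measurable borel"
      by measurable
    ultimately show ?thesis by simp
  qed
  ultimately show "primitive (\<lambda>t. convolution W (\<lambda>r. u r \<bullet> y t) t) s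
      = (LBINT t:{0<..<s}. LBINT r:{0<..<t}. W (t - r) * k (t, r))"
    unfolding primitive_def by (intro integral_lebesgue_on_borel)
qed

lemma g_kernel_nonneg_of_exp_kernels:
  fixes u y :: "real \<Rightarrow> 'h::real_inner"
  assumes u: "continuous_on {0..T} u" and y: "continuous_on {0..T} y" and \<alpha>: "0 < \<alpha>" "\<alpha> < 1" and s:
      "0 \<le> s" "s \<le> T"
    and exp_nonneg: "\<And>l. l > 0 \<Longrightarrow> 0 \<le> primitive (\<lambda>t. convolution (\<lambda>x. exp (- l * x)) (\<lambda>r. u r \<bullet> y t) t)
        s"
  shows "0 \<le> primitive (\<lambda>t. convolution (g_kernel \<alpha>) (\<lambda>r. u r \<bullet> y t) t) s"
proof -
  define k where "k = (\<lambda>p. u (max 0 (min T (snd p))) \<bullet> y (max 0 (min T (fst p))))"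
  note eq = primitive_convolution_eq_LBINT[OF u y _ s k_def]
  obtain M where M: "\<And>p. \<bar>k p\<bar> \<le> M" using eq(3)[of "\<lambda>_. 0"] by auto
  have k: "k \<in> borel_measurable borel" using eq(2)[of "\<lambda>_. 0"] by auto
  have "0 \<le> (LBINT t:{0<..<s}. LBINT r:{0<..<t}. (t - r) powr (-\<alpha>) * k (t, r))"
  proof (rule powr_kernel_nonneg[OF k M \<alpha> s(1)])
    fix l :: real assume "l > 0"
    then show "0 \<le> (LBINT t:{0<..<s}. LBINT r:{0<..<t}. exp (- l * (t - r)) * k (t, r))"
      using exp_nonneg[of l] eq(1)[of "\<lambda>x. exp (- l * x)"] by simp
  qed
  moreover have "primitive (\<lambda>t. convolution (g_kernel \<alpha>) (\<lambda>r. u r \<bullet> y t) t) s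
      = (LBINT t:{0<..<s}. LBINT r:{0<..<t}. (t - r) powr (-\<alpha>) * k (t, r)) / Gamma (1 - \<alpha>)"
  proof -
    have "g_kernel \<alpha> \<in> borel_measurable borel"
      unfolding g_kernel_def[abs_def] by measurable
    from eq(1)[OF this] show ?thesis
      by (simp add: g_kernel_def flip: set_integral_divide_zero)
  qed
  moreover have "Gamma (1 - \<alpha>) > 0" using \<alpha> by (intro Gamma_real_pos) simp
  ultimately show ?thesis by simp
qed

text \<open>
  The convolution of \<open>u\<close> with \<open>exp (- l x)\<close>. The factor \<open>exp (- l t)\<close> stands outside of the
  integral, so that the differential equation \<open>x' = u - l x\<close> is the product rule.
\<close>

definition exp_convolution :: "real \<Rightarrow> (real \<Rightarrow> 'h::{banach, second_countable_topology}) \<Rightarrow> real \<Rightarrow> 'h"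
    where
  "exp_convolution l u t = exp (- l * t) *\<^sub>R primitive (\<lambda>r. exp (l * r) *\<^sub>R u r) t"

lemma exp_convolution_has_vector_derivative:
  fixes u :: "real \<Rightarrow> 'h::{real_inner, banach, second_countable_topology}"
  assumes u: "continuous_on {0..T} u" and t: "t \<in> {0..T}"
  shows "(exp_convolution l u has_vector_derivative u t - l *\<^sub>R exp_convolution l u t)
      (at t within {0..T})"
proof -
  have "((\<lambda>t. exp (- l * t)) has_real_derivative - l * exp (- l * t)) (at t within {0..T})"
    by (auto intro!: derivative_eq_intros)
  moreover have "continuous_on {0..T} (\<lambda>r. exp (l * r) *\<^sub>R u r)"
    by (intro continuous_intros u)
  then have "(primitive (\<lambda>r. exp (l * r) *\<^sub>R u r) has_vector_derivative exp (l * t) *\<^sub>R u t)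
      (at t within {0..T})"
    using t by (rule primitive_has_vector_derivative)
  ultimately have "((\<lambda>t. exp (- l * t) *\<^sub>R primitive (\<lambda>r. exp (l * r) *\<^sub>R u r) t) has_vector_derivative
      exp (- l * t) *\<^sub>R (exp (l * t) *\<^sub>R u t)
          + (- l * exp (- l * t)) *\<^sub>R primitive (\<lambda>r. exp (l * r) *\<^sub>R u r) t) (at t within {0..T})"
    by (rule has_vector_derivative_scaleR)
  moreover have "exp (- l * t) *\<^sub>R (exp (l * t) *\<^sub>R u t) = u t"
    by (simp flip: exp_add)
  ultimately show ?thesis
    by (simp add: exp_convolution_def[abs_def])
qed

lemma exp_convolution_0 [simp]: "exp_convolution l u 0 = 0"
  by (simp add: exp_convolution_def)

lemma convolution_exp_inner:
  fixes u :: "real \<Rightarrow> 'h::{real_inner, banach, second_countable_topology}"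
  assumes u: "continuous_on {0..T} u" and t: "t \<le> T"
  shows "convolution (\<lambda>x. exp (- l * x)) (\<lambda>r. u r \<bullet> w) t = exp_convolution l u t \<bullet> w"
proof -
  have lin: "bounded_linear (\<lambda>x. exp (- l * t) * (x \<bullet> w))"
    by (intro bounded_linear_intros)
  have "continuous_on {0..T} (\<lambda>r. exp (l * r) *\<^sub>R u r)"
    by (intro continuous_intros u)
  from primitive_bounded_linear[OF lin Linf_continuous[OF this] t]
  have "primitive (\<lambda>s. exp (- l * t) * ((exp (l * s) *\<^sub>R u s) \<bullet> w)) t = exp_convolution l u t \<bullet> w"
    by (simp add: exp_convolution_def)
  moreover have "exp (- l * t) * ((exp (l * s) *\<^sub>R u s) \<bullet> w) = exp (- l * (t - s)) *\<^sub>R (u s \<bullet> w)" for s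
    by (simp add: exp_diff exp_minus field_simps)
  ultimately show ?thesis unfolding convolution_def primitive_def by (simp only:)
qed

lemma nonneg_derivative_imp_nonneg:
  fixes \<Phi> \<phi> :: "real \<Rightarrow> real"
  assumes d: "\<And>t. t \<in> {0..T} \<Longrightarrow> (\<Phi> has_vector_derivative \<phi> t) (at t within {0..T})"
    and "\<And>t. t \<in> {0..T} \<Longrightarrow> 0 \<le> \<phi> t" "\<Phi> 0 = 0" and s: "s \<in> {0..T}"
  shows "0 \<le> \<Phi> s"
proof -
  have "(\<phi> has_integral \<Phi> s - \<Phi> 0) {0..s}"
    using s by (intro fundamental_theorem_of_calculus has_vector_derivative_within_subset[OF d]) auto
  then show ?thesis
    using assms(2,3) s by (auto dest!: has_integral_nonneg)
qed

text \<open>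
  The derivative of \<open>- d \<bullet> d\<close> is \<open>2 l (d \<bullet> d) \<ge> 0\<close>.
\<close>

lemma linear_ode_unique:
  fixes d :: "real \<Rightarrow> 'h::{real_inner, banach, second_countable_topology}"
  assumes d: "\<And>t. t \<in> {0..T} \<Longrightarrow> (d has_vector_derivative - l *\<^sub>R d t) (at t within {0..T})"
    and "l \<ge> 0" "d 0 = 0" and s: "s \<in> {0..T}"
  shows "d s = 0"
proof -
  have "0 \<le> - (d s \<bullet> d s)"
  proof (rule nonneg_derivative_imp_nonneg[OF _ _ _ s])
    fix t assume t: "t \<in> {0..T}"
    show "((\<lambda>t. - (d t \<bullet> d t)) has_vector_derivative - (d t \<bullet> (- l *\<^sub>R d t) + (- l *\<^sub>R d t) \<bullet> d t))
        (at t within {0..T})"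
      by (intro has_vector_derivative_minus
          bounded_bilinear.has_vector_derivative[OF bounded_bilinear_inner] d t)
    show "0 \<le> - (d t \<bullet> (- l *\<^sub>R d t) + (- l *\<^sub>R d t) \<bullet> d t)"
      using \<open>l \<ge> 0\<close> by simp
  qed (use assms in auto)
  then show ?thesis using inner_gt_zero_iff[of "d s"] by (simp add: not_less[symmetric])
qed

text \<open>
  With \<open>y\<close> the primitive of \<open>u\<close>, the function \<open>x = exp (- l \<cdot>) * y\<close> solves \<open>x' = y - l x\<close>.
  Integration by parts in the convolution gives \<open>exp (- l \<cdot>) * u = x'\<close>, so the integrand is
  \<open>(A x' + B x) \<bullet> (x' + l x) = A (x' \<bullet> x') + B l (x \<bullet> x) + (A l + B) (x \<bullet> x')\<close>. The first two
  terms are nonnegative and the last one is the derivative of \<open>(A l + B) (x \<bullet> x) / 2\<close>, where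
  \<open>x 0 = 0\<close>. In the proof \<open>q\<close> is \<open>x'\<close>.
\<close>

lemma exp_kernel_nonneg:
  fixes u :: "real \<Rightarrow> 'h::{real_inner, banach, second_countable_topology}"
  assumes u: "continuous_on {0..T} u" and s: "s \<in> {0..T}" and AB: "A \<ge> 0" "B \<ge> 0" and l: "l > 0"
  shows "0 \<le> primitive (\<lambda>t. convolution (\<lambda>x. exp (- l * x))
      (\<lambda>r. (A *\<^sub>R u r + B *\<^sub>R primitive u r) \<bullet> primitive u t) t) s"
proof -
  let ?y = "primitive u"
  let ?v = "\<lambda>r. A *\<^sub>R u r + B *\<^sub>R ?y r"
  note inner_deriv = bounded_bilinear.has_vector_derivative[OF bounded_bilinear_inner]
  have y: "continuous_on {0..T} ?y" by (rule primitive_continuous[OF Linf_continuous[OF u]])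
  have v: "continuous_on {0..T} ?v" by (intro continuous_intros u y)
  define x where "x = exp_convolution l ?y"
  define z where "z = exp_convolution l ?v"
  define q where "q t = ?y t - l *\<^sub>R x t" for t
  have x': "(x has_vector_derivative q t) (at t within {0..T})" if "t \<in> {0..T}" for t
    using exp_convolution_has_vector_derivative[OF y that] by (simp add: x_def q_def)
  have z': "(z has_vector_derivative ?v t - l *\<^sub>R z t) (at t within {0..T})" if "t \<in> {0..T}" for t
    using exp_convolution_has_vector_derivative[OF v that] by (simp add: z_def)
  have y': "(?y has_vector_derivative u t) (at t within {0..T})" if "t \<in> {0..T}" for t
    by (rule primitive_has_vector_derivative[OF u that])
  have q': "(q has_vector_derivative u t - l *\<^sub>R q t) (at t within {0..T})" if "t \<in> {0..T}" for t
    unfolding q_def[abs_def] using that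
    by (intro has_vector_derivative_diff y'
        bounded_linear.has_vector_derivative[OF bounded_linear_scaleR_right] x'[unfolded q_def])
  \<comment> \<open>Both sides solve the equation for \<open>z'\<close> and vanish at \<open>0\<close>.\<close>
  have z_eq: "z t = A *\<^sub>R q t + B *\<^sub>R x t" if "t \<in> {0..T}" for t
  proof -
    have "z t - (A *\<^sub>R q t + B *\<^sub>R x t) = 0"
    proof (rule linear_ode_unique[OF _ _ _ that, of "\<lambda>t. z t - (A *\<^sub>R q t + B *\<^sub>R x t)" l])
      fix t assume t: "t \<in> {0..T}"
      have "((\<lambda>t. z t - (A *\<^sub>R q t + B *\<^sub>R x t)) has_vector_derivative
          (?v t - l *\<^sub>R z t) - (A *\<^sub>R (u t - l *\<^sub>R q t) + B *\<^sub>R q t)) (at t within {0..T})"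
        by (intro has_vector_derivative_diff has_vector_derivative_add
            bounded_linear.has_vector_derivative[OF bounded_linear_scaleR_right] x' z' q' t)
      moreover have "(?v t - l *\<^sub>R z t) - (A *\<^sub>R (u t - l *\<^sub>R q t) + B *\<^sub>R q t)
          = - l *\<^sub>R (z t - (A *\<^sub>R q t + B *\<^sub>R x t))"
        by (simp add: q_def algebra_simps)
      ultimately show "((\<lambda>t. z t - (A *\<^sub>R q t + B *\<^sub>R x t)) has_vector_derivative
          - l *\<^sub>R (z t - (A *\<^sub>R q t + B *\<^sub>R x t))) (at t within {0..T})"
        by simp
    qed (use l in \<open>simp_all add: z_def q_def x_def\<close>)
    then show ?thesis by simp
  qed
  have z_cont: "continuous_on {0..T} z"
    using z' by (rule continuous_on_vector_derivative)
  have zy_cont: "continuous_on {0..T} (\<lambda>t. z t \<bullet> ?y t)"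
    by (intro continuous_intros z_cont y)
  have "0 \<le> primitive (\<lambda>t. z t \<bullet> ?y t) s - ((A * l + B) / 2) * (x s \<bullet> x s)"
  proof (rule nonneg_derivative_imp_nonneg[OF _ _ _ s])
    fix t assume t: "t \<in> {0..T}"
    show "((\<lambda>t. primitive (\<lambda>t. z t \<bullet> ?y t) t - ((A * l + B) / 2) * (x t \<bullet> x t)) has_vector_derivative
        z t \<bullet> ?y t - ((A * l + B) / 2) * (x t \<bullet> q t + q t \<bullet> x t)) (at t within {0..T})"
      by (intro has_vector_derivative_diff primitive_has_vector_derivative[OF zy_cont t]
          bounded_linear.has_vector_derivative[OF bounded_linear_mult_right] inner_deriv x' t)
    have "z t \<bullet> ?y t - ((A * l + B) / 2) * (x t \<bullet> q t + q t \<bullet> x t)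
        = A * (q t \<bullet> q t) + B * l * (x t \<bullet> x t)"
    proof -
      have "?y t = q t + l *\<^sub>R x t" by (simp add: q_def)
      then show ?thesis
        unfolding z_eq[OF t] by (simp add: inner_simps inner_commute[of "q t" "x t"] field_simps)
    qed
    also have "\<dots> \<ge> 0" using AB l by simp
    finally show "0 \<le> z t \<bullet> ?y t - ((A * l + B) / 2) * (x t \<bullet> q t + q t \<bullet> x t)" .
  qed (simp add: x_def)
  moreover have "0 \<le> ((A * l + B) / 2) * (x s \<bullet> x s)" using AB l by simp
  ultimately have "0 \<le> primitive (\<lambda>t. z t \<bullet> ?y t) s" by linarith
  also have "primitive (\<lambda>t. z t \<bullet> ?y t) s
      = primitive (\<lambda>t. convolution (\<lambda>x. exp (- l * x)) (\<lambda>r. ?v r \<bullet> ?y t) t) s"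
    unfolding primitive_def[of _ s]
  proof (intro Bochner_Integration.integral_cong refl)
    fix t assume "t \<in> space (lebesgue_on {0<..<s})"
    then have "t \<le> T" using s by simp
    then show "z t \<bullet> ?y t = convolution (\<lambda>x. exp (- l * x)) (\<lambda>r. ?v r \<bullet> ?y t) t"
      by (simp only: z_def convolution_exp_inner[OF v])
  qed
  finally show ?thesis .
qed

section \<open>The energy argument\<close>

text \<open>
  The equation, integrated over \<open>(0, s)\<close>, says that three nonnegative quantities add up to \<open>0\<close>:
  the convolution term, by positivity of the kernel; \<open>C\<close> times the integral of the square of
  \<open>y = primitive u\<close>; and the integral of \<open>L Z Y\<close>, which is \<open>L Z Z / 2\<close> at time \<open>s\<close> because \<open>Z\<close>
  has the derivative \<open>Y\<close> and \<open>L\<close> is symmetric. So \<open>y\<close> vanishes, and so does its derivative \<open>u\<close>.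
\<close>

lemma energy_uniqueness:
  fixes u :: "real \<Rightarrow> 'h::{real_inner, banach, second_countable_topology}"
    and Y :: "real \<Rightarrow> 'w::{real_inner, banach, second_countable_topology}"
    and L :: "'w \<Rightarrow> 'w \<Rightarrow> real"
  assumes u: "continuous_on {0..T} u" and Y: "continuous_on {0..T} Y" and T: "T > 0" and \<alpha>: "0 < \<alpha>"
      "\<alpha> < 1"
    and AB: "A \<ge> 0" "B \<ge> 0" and C: "C > 0"
    and L: "bounded_bilinear L" and L_sym: "\<And>x y. L x y = L y x" and L_nonneg: "\<And>x. 0 \<le> L x x"
    and eq: "\<And>t. 0 < t \<Longrightarrow> t < T \<Longrightarrow>
      convolution (g_kernel \<alpha>) (\<lambda>r. (A *\<^sub>R u r + B *\<^sub>R primitive u r) \<bullet> primitive u t) t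
        + C * (primitive u t \<bullet> primitive u t) + L (primitive Y t) (Y t) = 0"
    and t: "t \<in> {0..T}"
  shows "u t = 0"
proof -
  let ?y = "primitive u" and ?Z = "primitive Y"
  have y: "continuous_on {0..T} ?y" by (rule primitive_continuous[OF Linf_continuous[OF u]])
  have v: "continuous_on {0..T} (\<lambda>r. A *\<^sub>R u r + B *\<^sub>R ?y r)" by (intro continuous_intros u y)
  have Z: "continuous_on {0..T} ?Z" by (rule primitive_continuous[OF Linf_continuous[OF Y]])
  have yy: "continuous_on {0..T} (\<lambda>t. C * (?y t \<bullet> ?y t))" by (intro continuous_intros y)
  have LZY: "continuous_on {0..T} (\<lambda>t. L (?Z t) (Y t))"
    by (rule bounded_bilinear.continuous_on[OF L Z Y])
  have zero: "primitive (\<lambda>t. C * (?y t \<bullet> ?y t)) s = 0" if s: "0 < s" "s < T" for s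
  proof -
    have s': "s \<in> {0..T}" using s by simp
    have "0 \<le> primitive (\<lambda>t. convolution (g_kernel \<alpha>) (\<lambda>r. (A *\<^sub>R u r + B *\<^sub>R ?y r) \<bullet> ?y t) t) s"
      using s by (intro g_kernel_nonneg_of_exp_kernels[OF v y \<alpha>] exp_kernel_nonneg[OF u s' AB]) auto
    also have "\<dots> = primitive (\<lambda>t. - (C * (?y t \<bullet> ?y t) + L (?Z t) (Y t))) s"
      unfolding primitive_def[of _ s] using s eq
      by (intro Bochner_Integration.integral_cong refl) (simp, smt (verit))
    also have "\<dots> = - (primitive (\<lambda>t. C * (?y t \<bullet> ?y t)) s + primitive (\<lambda>t. L (?Z t) (Y t)) s)"
      using s by (subst primitive_bounded_linear[OF bounded_linear_minus[OF bounded_linear_ident]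
          Linf_add[OF Linf_continuous[OF yy] Linf_continuous[OF LZY]]])
        (simp_all add: primitive_add[OF Linf_continuous[OF yy] Linf_continuous[OF LZY]])
    finally have le: "primitive (\<lambda>t. C * (?y t \<bullet> ?y t)) s + primitive (\<lambda>t. L (?Z t) (Y t)) s \<le> 0"
        by simp
    have "0 \<le> primitive (\<lambda>t. L (?Z t) (Y t)) s - L (?Z s) (?Z s) / 2"
    proof (rule nonneg_derivative_imp_nonneg[OF _ _ _ s'])
      fix t assume t: "t \<in> {0..T}"
      have "((\<lambda>t. primitive (\<lambda>t. L (?Z t) (Y t)) t - L (?Z t) (?Z t) / 2) has_vector_derivative
         L (?Z t) (Y t) - (L (?Z t) (Y t) + L (Y t) (?Z t)) / 2) (at t within {0..T})"
        by (intro has_vector_derivative_diff primitive_has_vector_derivative[OF LZY t]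
          bounded_linear.has_vector_derivative[OF bounded_linear_divide]
          bounded_bilinear.has_vector_derivative[OF L] primitive_has_vector_derivative[OF Y t])
      then show "((\<lambda>t. primitive (\<lambda>t. L (?Z t) (Y t)) t - L (?Z t) (?Z t) / 2) has_vector_derivative 0)
          (at t within {0..T})"
        by (simp add: L_sym[of "Y t"])
    qed (simp_all add: bounded_bilinear.zero_left[OF L])
    with L_nonneg[of "?Z s"] have "0 \<le> primitive (\<lambda>t. L (?Z t) (Y t)) s" by simp
    moreover have "0 \<le> primitive (\<lambda>t. C * (?y t \<bullet> ?y t)) s"
      by (rule nonneg_derivative_imp_nonneg[OF primitive_has_vector_derivative[OF yy] _ _ s'])
          (use C in auto)
    ultimately show ?thesis using le by linarith
  qed
  have y0: "?y s = 0" if "s \<in> {0..T}" for s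
  proof -
    have "C * (?y s \<bullet> ?y s) = 0"
      by (rule primitive_eq_imp_eq[OF yy continuous_on_const T _ that])
          (simp add: zero, simp add: primitive_def)
    then show ?thesis using C by simp
  qed
  show ?thesis
    by (rule primitive_eq_imp_eq[OF u continuous_on_const T _ t])
        (simp add: y0, simp add: primitive_def)
qed

section \<open>The fractional equation integrated in time\<close>

text \<open>
  Integrability up to the ends of \<open>(0, T)\<close> is assumed, since the integrals in the definition
  range over the whole interval and have to be split.
\<close>

lemma weak_time_derivative_diff:
  assumes weak: "weak_time_derivative T f1 g1" "weak_time_derivative T f2 g2"
    and int: "integrable (lebesgue_on {0<..<T}) f1" "integrable (lebesgue_on {0<..<T}) g1"
      "integrable (lebesgue_on {0<..<T}) f2" "integrable (lebesgue_on {0<..<T}) g2"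
  shows "weak_time_derivative T (\<lambda>t. f1 t - f2 t) (\<lambda>t. g1 t - g2 t)"
  unfolding weak_time_derivative_def
proof (intro conjI allI impI ballI)
  fix s t :: real assume "0 < s" "t < T"
  then show "integrable (lebesgue_on {s..t}) (\<lambda>t. f1 t - f2 t)"
      "integrable (lebesgue_on {s..t}) (\<lambda>t. g1 t - g2 t)"
    using weak by (auto simp: weak_time_derivative_def)
next
  fix \<psi> :: "real \<Rightarrow> real" assume \<psi>: "\<psi> \<in> test_functions {0<..<T}"
  have Ck: "C_k 0 \<psi>" "C_k (Suc 0) \<psi>" using \<psi> unfolding test_functions_def by blast+
  have "C_k 0 (deriv \<psi>)" by (rule C_k_SucE[OF Ck(2)])
  with Ck(1) have cont: "continuous_on {0..T} \<psi>" "continuous_on {0..T} (deriv \<psi>)"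
    by (auto intro: continuous_on_subset)
  have prod: "integrable (lebesgue_on {0<..<T}) (\<lambda>t. w t *\<^sub>R z t)"
    if w: "continuous_on {0..T} w" and z: "integrable (lebesgue_on {0<..<T}) z" for w ::
        "real \<Rightarrow> real" and z :: "real \<Rightarrow> 'a"
  proof -
    obtain C where C: "w \<in> borel_measurable (lebesgue_on {0<..<T})" "C \<ge> 0"
      "AE t in lebesgue_on {0<..<T}. norm (w t) \<le> C"
      using Linf_continuous[OF w] by (rule LinfE)
    show ?thesis
    proof (rule Bochner_Integration.integrable_bound)
      show "integrable (lebesgue_on {0<..<T}) (\<lambda>t. C *\<^sub>R z t)" using z by simp
      show "AE t in lebesgue_on {0<..<T}. norm (w t *\<^sub>R z t) \<le> norm (C *\<^sub>R z t)"
        using C(3) by eventually_elim (use C(2) in \<open>auto intro!: mult_right_mono\<close>)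
    qed (use C(1) borel_measurable_integrable[OF z] in measurable)
  qed
  show "(LINT t|lebesgue_on {0<..<T}. deriv \<psi> t *\<^sub>R (f1 t - f2 t))
      = - (LINT t|lebesgue_on {0<..<T}. \<psi> t *\<^sub>R (g1 t - g2 t))"
    using weak \<psi> prod[OF cont(2) int(1)] prod[OF cont(2) int(3)] prod[OF cont(1) int(2)]
        prod[OF cont(1) int(4)]
    by (simp add: weak_time_derivative_def scaleR_diff_right Bochner_Integration.integral_diff)
qed

text \<open>
  For each vector \<open>w\<close> the real function \<open>u \<bullet> w\<close> is continuous and \<open>0\<close> at \<open>0\<close>, so it is its own
  bound near \<open>0\<close>; continuity then permits undoing the additional integration.
\<close>

lemma continuous_weak_time_derivative_eq_primitive:
  fixes u v :: "real \<Rightarrow> 'h::{real_inner, banach, second_countable_topology}"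
  assumes weak: "weak_time_derivative T u v" and u: "continuous_on {0..T} u" and u0: "u 0 = 0"
    and v: "v \<in> Linf T" and T: "T > 0" and t: "t \<in> {0..T}"
  shows "u t = primitive v t"
proof -
  have "(u t - primitive v t) \<bullet> w = 0" for w
  proof -
    have lin: "bounded_linear (\<lambda>x. x \<bullet> w)" by (rule bounded_linear_inner_left)
    let ?p = "\<lambda>t. u t \<bullet> w" and ?q = "\<lambda>t. v t \<bullet> w"
    have p: "continuous_on {0..T} ?p" by (intro continuous_intros u)
    have q: "?q \<in> Linf T" by (rule Linf_bounded_linear[OF lin v])
    define b where "b t = \<bar>u (max 0 (min T t)) \<bullet> w\<bar>" for t
    have b_cont: "continuous_on UNIV b"
      unfolding b_def
      by (intro continuous_intros continuous_on_compose2[OF u]) (use T in auto)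
    obtain N where N: "\<And>x. x \<in> {0..T} \<Longrightarrow> norm (?p x) \<le> N"
      using compact_imp_bounded[OF compact_continuous_image[OF p compact_Icc]]
          by (force simp: bounded_iff)
    obtain M where M: "AE t in lebesgue_on {0<..<T}. norm (?q t) \<le> M"
      using q by (rule LinfE)
    have "primitive ?p s = primitive (primitive ?q) s" if "0 < s" "s < T" for s
    proof (rule weak_time_derivative_primitive[OF
        weak_time_derivative_bounded_linear[OF lin weak Linf_continuous[OF u] v]])
      show "AE t in lebesgue_on {0<..<T}. \<bar>?p t\<bar> \<le> b t"
        by (intro AE_I2) (auto simp: b_def min_def max_def)
      show "b \<in> borel_measurable borel" by (rule borel_measurable_continuous_onI[OF b_cont])
      show "0 \<le> b t" for t by (simp add: b_def)
      show "b t \<le> N" for t using N[of "max 0 (min T t)"] T by (simp add: b_def)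
      have "(b \<longlongrightarrow> b 0) (at 0)" using b_cont by (simp add: continuous_on_eq_continuous_at isCont_def)
      then show "(b \<longlongrightarrow> 0) (at_right 0)"
        using T u0 by (auto simp: b_def intro: tendsto_mono[OF at_le])
      show "AE t in lebesgue_on {0<..<T}. \<bar>?q t\<bar> \<le> M" using M by simp
    qed (use that in auto)
    then have "?p t = primitive ?q t"
      by (rule primitive_eq_imp_eq[OF p primitive_continuous[OF q] T _ t])
    then show ?thesis
      using primitive_bounded_linear[OF lin v] t by (simp add: inner_diff_left)
  qed
  from this[of "u t - primitive v t"] show ?thesis by simp
qed

lemma convolution_integrable:
  fixes z :: "real \<Rightarrow> 'b::{banach, second_countable_topology}"
  assumes z: "z \<in> Linf T" and t: "t \<le> T" and [measurable]: "\<kappa> \<in> borel_measurable borel"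
    and \<kappa>: "integrable lborel (\<lambda>x. indicator {0<..<T} x * \<kappa> x)"
  shows "integrable (lebesgue_on {0<..<t}) (\<lambda>s. \<kappa> (t - s) *\<^sub>R z s)"
proof -
  obtain C where C: "z \<in> borel_measurable (lebesgue_on {0<..<t})" "C \<ge> 0"
    "AE t in lebesgue_on {0<..<t}. norm (z t) \<le> C"
    using Linf_subinterval[OF z t] by (rule LinfE)
  have "integrable lborel (\<lambda>s. indicator {0<..<T} (t - s) * \<kappa> (t - s))"
    using lborel_integrable_real_affine[OF \<kappa>, of "-1" t] by simp
  then have "integrable lborel (\<lambda>s. indicator {0<..<t} s * (indicator {0<..<T} (t - s) * \<kappa> (t - s)))"
    by (rule Bochner_Integration.integrable_bound) (auto simp: indicator_def)
  moreover have "indicator {0<..<t} s * (indicator {0<..<T} (t - s) * \<kappa> (t - s))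
      = indicator {0<..<t} s *\<^sub>R \<kappa> (t - s)" for s
    using t by (auto simp: indicator_def)
  ultimately have "integrable lebesgue (\<lambda>s. indicator {0<..<t} s *\<^sub>R \<kappa> (t - s))"
    by (subst integrable_completion) auto
  then have int: "integrable (lebesgue_on {0<..<t}) (\<lambda>s. \<kappa> (t - s))"
    by (simp add: integrable_restrict_space)
  show ?thesis
  proof (rule Bochner_Integration.integrable_bound)
    show "integrable (lebesgue_on {0<..<t}) (\<lambda>s. C * \<kappa> (t - s))" using int by simp
    show "AE s in lebesgue_on {0<..<t}. norm (\<kappa> (t - s) *\<^sub>R z s) \<le> norm (C * \<kappa> (t - s))"
      using C(3) by eventually_elim (use C(2)
          in \<open>auto simp: abs_mult mult.commute intro!: mult_right_mono\<close>)
  qed (use C(1) borel_measurable_integrable[OF int] in measurable)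
qed

lemma g_kernel_facts:
  assumes \<alpha>: "0 < \<alpha>" "\<alpha> < 1" and s: "0 \<le> s"
  shows "g_kernel \<alpha> \<in> borel_measurable borel" "0 \<le> g_kernel \<alpha> x"
    and "has_bochner_integral lborel (\<lambda>x. indicator {0<..<s} x * g_kernel \<alpha> x)
        (s powr (1 - \<alpha>) / (1 - \<alpha>) / Gamma (1 - \<alpha>))"
proof -
  have G: "Gamma (1 - \<alpha>) > 0" using \<alpha> by (intro Gamma_real_pos) simp
  then show "0 \<le> g_kernel \<alpha> x" by (simp add: g_kernel_def)
  show "g_kernel \<alpha> \<in> borel_measurable borel" unfolding g_kernel_def[abs_def] by measurable
  show "has_bochner_integral lborel (\<lambda>x. indicator {0<..<s} x * g_kernel \<alpha> x)
      (s powr (1 - \<alpha>) / (1 - \<alpha>) / Gamma (1 - \<alpha>))"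
    using has_bochner_integral_divide_zero[OF powr_integral_Ioo[OF \<alpha>(2) s], of "Gamma (1 - \<alpha>)"]
        by (simp add: g_kernel_def)
qed

text \<open>
  The integral of the kernel over \<open>(0, t)\<close> is a multiple of \<open>t powr (1 - \<alpha>)\<close>. In particular the
  fractional integral of a bounded function has the initial value \<open>0\<close>.
\<close>

lemma g_convolution_bound:
  fixes z :: "real \<Rightarrow> real"
  assumes z: "AE t in lebesgue_on {0<..<T}. \<bar>z t\<bar> \<le> M" "z \<in> borel_measurable (lebesgue_on {0<..<T})" 
    and M: "M \<ge> 0" and \<alpha>: "0 < \<alpha>" "\<alpha> < 1" and t: "0 \<le> t" "t \<le> T"
  shows "\<bar>convolution (g_kernel \<alpha>) z t\<bar> \<le> M / (1 - \<alpha>) / Gamma (1 - \<alpha>) * t powr (1 - \<alpha>)"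
proof -
  note g = g_kernel_facts[OF \<alpha>]
  have zL: "z \<in> Linf T" using z by (intro LinfI[of _ _ M]) auto
  have gT: "integrable lborel (\<lambda>x. indicator {0<..<T} x * g_kernel \<alpha> x)"
    using g(3)[of T] t by (auto simp: has_bochner_integral_iff)
  have cM: "(\<lambda>_. M) \<in> Linf T" by (intro Linf_continuous continuous_intros)
  have reflect: "(LBINT x. F x) = (LBINT x. F (t - x))" for F :: "real \<Rightarrow> real"
    using lborel_integral_real_affine[of "-1" F t] by simp
  have "\<bar>convolution (g_kernel \<alpha>) z t\<bar> \<le> (LINT s|lebesgue_on {0<..<t}. norm
      (g_kernel \<alpha> (t - s) *\<^sub>R z s))"
    unfolding convolution_def real_norm_def[symmetric] by (rule integral_norm_bound)
  also have "\<dots> \<le> (LINT s|lebesgue_on {0<..<t}. g_kernel \<alpha> (t - s) *\<^sub>R M)"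
  proof (rule integral_mono_AE)
    show "integrable (lebesgue_on {0<..<t}) (\<lambda>s. norm (g_kernel \<alpha> (t - s) *\<^sub>R z s))"
      by (intro integrable_norm convolution_integrable[OF zL t(2) g(1)[OF t(1)] gT])
    show "integrable (lebesgue_on {0<..<t}) (\<lambda>s. g_kernel \<alpha> (t - s) *\<^sub>R M)"
      by (intro convolution_integrable[OF cM t(2) g(1)[OF t(1)] gT])
    have "AE s in lebesgue_on {0<..<t}. \<bar>z s\<bar> \<le> M"
      using z(1) t(2) by (simp add: AE_restrict_space_iff) (auto elim!: eventually_mono)
    then show "AE s in lebesgue_on {0<..<t}. norm (g_kernel \<alpha> (t - s) *\<^sub>R z s)
        \<le> g_kernel \<alpha> (t - s) *\<^sub>R M"
      by eventually_elim (use g(2)[OF t(1)] in \<open>auto simp: abs_mult intro!: mult_left_mono\<close>)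
  qed
  also have "\<dots> = (LBINT s:{0<..<t}. g_kernel \<alpha> (t - s) * M)"
    using g(1)[OF t(1)] by (intro integral_lebesgue_on_borel) auto
  also have "\<dots> = (LBINT x. (indicator {0<..<t} x * g_kernel \<alpha> x) * M)"
    unfolding set_lebesgue_integral_def
    unfolding set_lebesgue_integral_def
    by (subst reflect, intro Bochner_Integration.integral_cong refl) (auto simp: indicator_def)
  also have "\<dots> = M / (1 - \<alpha>) / Gamma (1 - \<alpha>) * t powr (1 - \<alpha>)"
    using g(3)[OF t(1)] by (simp add: has_bochner_integral_iff)
  finally show ?thesis .
qed

text \<open>
  Here \<open>f\<close> stands for \<open>g * q\<close> and \<open>h\<close> for its weak derivative. Solved for \<open>h\<close>, the equation
  shows that \<open>h\<close> is bounded. As \<open>f\<close> vanishes at \<open>0\<close>, the first term integrates to \<open>A f\<close>, and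
  integration commutes with the convolution, so the twice integrated equation involves \<open>q\<close>
  through its primitives only.
\<close>

lemma fractional_equation_integrated:
  fixes q m f h :: "real \<Rightarrow> real"
  assumes T: "T > 0" and \<alpha>: "0 < \<alpha>" "\<alpha> < 1" and A: "A > 0"
    and q: "q \<in> Linf T" and m: "m \<in> Linf T"
    and f: "\<And>t. 0 < t \<Longrightarrow> t < T \<Longrightarrow> f t = convolution (g_kernel \<alpha>) q t"
    and weak: "weak_time_derivative T f h"
    and eq: "AE t in lebesgue_on {0<..<T}. A * h t + B * f t + C * q t + m t = 0"
    and t: "0 < t" "t < T"
  shows "A * convolution (g_kernel \<alpha>) (primitive q) t
      + B * convolution (g_kernel \<alpha>) (primitive (primitive q)) t
    + C * primitive (primitive q) t + primitive (primitive m) t = 0"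
proof -
  let ?g = "g_kernel \<alpha>"
  have T0: "0 \<le> T" using T by simp
  note g = g_kernel_facts[OF \<alpha> T0]
  have gT: "integrable lborel (\<lambda>x. indicator {0<..<T} x * ?g x)"
    using g(3) by (simp add: has_bochner_integral_iff)
  have fm: "f \<in> borel_measurable (lebesgue_on {0<..<T})" and hm:
      "h \<in> borel_measurable (lebesgue_on {0<..<T})"
    using weak_time_derivative_measurable[OF weak T] by auto
  obtain M where M: "q \<in> borel_measurable (lebesgue_on {0<..<T})" "M \<ge> 0"
      "AE t in lebesgue_on {0<..<T}. norm (q t) \<le> M"
    using q by (rule LinfE)
  define K where "K = M / (1 - \<alpha>) / Gamma (1 - \<alpha>)"
  have "Gamma (1 - \<alpha>) > 0" using \<alpha> by (intro Gamma_real_pos) simp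
  then have K: "K \<ge> 0" using M(2) \<alpha> by (simp add: K_def)
  define b where "b t = K * (max 0 (min T t)) powr (1 - \<alpha>)" for t
  have f_b: "\<bar>f t\<bar> \<le> b t" if "0 < t" "t < T" for t
    using g_convolution_bound[OF M(3)[unfolded real_norm_def] M(1,2) \<alpha>, of t] that f[OF that]
    by (simp add: b_def K_def)
  have b_N: "b t \<le> K * T powr (1 - \<alpha>)" for t
    unfolding b_def using K \<alpha> T by (intro mult_left_mono powr_mono2) auto
  have fL: "f \<in> Linf T"
    using fm by (rule LinfI[of _ _ "K * T powr (1 - \<alpha>)"]) (auto intro!: AE_I2 order_trans[OF f_b b_N])
  define h' where "h' t = - (1 / A) * (B * f t + C * q t + m t)" for t
  have h'_eq: "AE t in lebesgue_on {0<..<T}. h t = h' t"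
    using eq by eventually_elim (use A in \<open>simp add: h'_def field_simps\<close>)
  have lin: "bounded_linear (\<lambda>x::real. c * x)" for c by (rule bounded_linear_mult_right)
  note mult = Linf_bounded_linear[OF lin]
  note sums = Linf_add[OF Linf_add[OF mult[OF fL, of B] mult[OF q, of C]] m]
  have h'L: "h' \<in> Linf T"
    unfolding h'_def[abs_def] by (rule mult[OF sums])
  obtain N where N: "AE t in lebesgue_on {0<..<T}. norm (h' t) \<le> N"
    using h'L by (rule LinfE)
  have h_bound: "AE t in lebesgue_on {0<..<T}. \<bar>h t\<bar> \<le> N"
    using h'_eq N by eventually_elim simp
  have prim_f: "primitive f s = convolution ?g (primitive q) s" if "s \<le> T" for s
  proof -
    have "primitive f s = primitive (convolution ?g q) s"
      unfolding primitive_def using that f by (intro Bochner_Integration.integral_cong) auto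
    also have "\<dots> = convolution ?g (primitive q) s"
      by (rule primitive_convolution[OF q that g(1) gT])
    finally show ?thesis .
  qed
  have prim_h: "primitive h s = - (1 / A) * (B * primitive f s + C * primitive q s + primitive m s)"
      if s: "s \<le> T" for s
  proof -
    have "primitive h s = primitive h' s"
      using h'L by (intro primitive_cong_AE[OF h'_eq s hm]) (auto elim: LinfE)
    also have "\<dots> = - (1 / A) * primitive (\<lambda>t. B * f t + C * q t + m t) s"
      unfolding h'_def[abs_def] by (rule primitive_bounded_linear[OF lin sums s])
    also have "primitive (\<lambda>t. B * f t + C * q t + m t) s
        = B * primitive f s + C * primitive q s + primitive m s"
      using s by (simp add: primitive_add[OF Linf_add[OF mult[OF fL] mult[OF q]] m]
          primitive_add[OF mult[OF fL] mult[OF q]]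
          primitive_bounded_linear[OF lin fL] primitive_bounded_linear[OF lin q])
    finally show ?thesis .
  qed
  have pf: "primitive f \<in> Linf T" and pq: "primitive q \<in> Linf T" and pl: "primitive m \<in> Linf T"
    using fL q m by (auto intro!: Linf_continuous primitive_continuous)
  have "primitive f t = primitive (primitive h) t"
  proof (rule weak_time_derivative_primitive[OF weak _ _ _ b_N _ h_bound t])
    show "AE t in lebesgue_on {0<..<T}. \<bar>f t\<bar> \<le> b t" by (intro AE_I2) (auto intro: f_b)
    show "b \<in> borel_measurable borel" unfolding b_def[abs_def] by measurable
    show "0 \<le> b t" for t using K by (simp add: b_def)
    have "((\<lambda>t. K * (max 0 (min T t)) powr (1 - \<alpha>)) \<longlongrightarrow> K * 0 powr (1 - \<alpha>)) (at_right 0)"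
    proof (intro tendsto_mult tendsto_const tendsto_powr2)
      have "((\<lambda>t::real. max 0 (min T t)) \<longlongrightarrow> max 0 (min T 0)) (at_right 0)"
        by (intro tendsto_intros)
      then show "((\<lambda>t::real. max 0 (min T t)) \<longlongrightarrow> 0) (at_right 0)" using T by simp
    qed (use \<alpha> in auto)
    then show "(b \<longlongrightarrow> 0) (at_right 0)" by (simp add: b_def[abs_def])
  qed
  also have "\<dots> = primitive (\<lambda>s. - (1 / A) * (B * primitive f s + C * primitive q s + primitive m s)) t"
    unfolding primitive_def[of _ t] using t prim_h by (intro Bochner_Integration.integral_cong) auto
  also have "\<dots> = - (1 / A) * primitive (\<lambda>s. B * primitive f s + C * primitive q s + primitive m s) t"
    using t by (intro primitive_bounded_linear[OF lin
        Linf_add[OF Linf_add[OF mult[OF pf] mult[OF pq]] pl]]) simp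
  also have "primitive (\<lambda>s. B * primitive f s + C * primitive q s + primitive m s) t
      = B * primitive (primitive f) t + C * primitive (primitive q) t + primitive (primitive m) t"
    using t by (simp add: primitive_add[OF Linf_add[OF mult[OF pf] mult[OF pq]] pl]
        primitive_add[OF mult[OF pf] mult[OF pq]]
          primitive_bounded_linear[OF lin pf] primitive_bounded_linear[OF lin pq])
  also have "primitive (primitive f) t = convolution ?g (primitive (primitive q)) t"
  proof -
    have "primitive (primitive f) t = primitive (convolution ?g (primitive q)) t"
      unfolding primitive_def[of _ t] using t prim_f by (intro Bochner_Integration.integral_cong) auto
    also have "\<dots> = convolution ?g (primitive (primitive q)) t"
      using t by (intro primitive_convolution[OF pq _ g(1) gT]) simp
    finally show ?thesis .
  qed
  finally show ?thesis
    using A prim_f[of t] t by (simp add: field_simps)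
qed

section \<open>The elliptic form\<close>

lemma rep_L2_add: "AE x in lebesgue. rep_L2 (f + g) x = rep_L2 f x + rep_L2 g x"
proof -
  have "f + g = abs_L2 (\<lambda>x. rep_L2 f x + rep_L2 g x)"
    using plus_L2.abs_eq[of "rep_L2 f" "rep_L2 g"]
    by (simp add: L2_rel_def square_integrable_rep abs_rep_L2)
  then show ?thesis
    using rep_abs_L2[OF square_integrable_add[OF square_integrable_rep square_integrable_rep]]
    by metis
qed

lemma rep_L2_scaleR: "AE x in lebesgue. rep_L2 (c *\<^sub>R f) x = c *\<^sub>R rep_L2 f x"
proof -
  have "c *\<^sub>R f = abs_L2 (\<lambda>x. c *\<^sub>R rep_L2 f x)"
    using scaleR_L2.abs_eq[of "rep_L2 f" c]
    by (simp add: L2_rel_def square_integrable_rep abs_rep_L2)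
  then show ?thesis
    using rep_abs_L2[OF square_integrable_scaleR[OF square_integrable_rep]]
    by metis
qed

lemma norm_L2_power2: "integrable lebesgue (\<lambda>x. (norm (rep_L2 f x))\<^sup>2)"
    "(LINT x|lebesgue. (norm (rep_L2 f x))\<^sup>2) = (norm f)\<^sup>2"
  using square_integrable_rep[of f] inner_L2_eq[of f f]
  by (auto simp: square_integrable_def power2_norm_eq_inner)

definition coefficient_form :: "(real^'n) set \<Rightarrow> (real^'n \<Rightarrow> real^'n^'n) \<Rightarrow> (real^'n::finite, real^'n)
    L2 \<Rightarrow> (real^'n, real^'n) L2 \<Rightarrow> real" where
  "coefficient_form \<Omega> k G H = (LINT x|lebesgue_on \<Omega>. (k x *v rep_L2 G x) \<bullet> rep_L2 H x)"

lemma AE_lebesgue_on: "S \<in> sets lebesgue \<Longrightarrow> AE x in lebesgue. P x \<Longrightarrow> AE x in lebesgue_on S. P x"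
  by (simp add: AE_restrict_space_iff) (auto elim!: eventually_mono)

text \<open>
  Entrywise boundedness of \<open>k\<close> and Young's inequality. The quadratic bound is turned into the
  product of the norms once bilinearity is available.
\<close>

lemma coefficient_form_integrand:
  fixes k :: "real^'n::finite \<Rightarrow> real^'n^'n" and \<Omega> :: "(real^'n) set"
  assumes k: "symmetric_elliptic_coefficient \<Omega> k" and \<Omega>: "\<Omega> \<in> sets lebesgue"
  shows "integrable (lebesgue_on \<Omega>) (\<lambda>x. (k x *v rep_L2 G x) \<bullet> rep_L2 H x)"
    and "\<exists>K\<ge>0. \<forall>G H. \<bar>coefficient_form \<Omega> k G H\<bar> \<le> K * ((norm G)\<^sup>2 + (norm H)\<^sup>2)"
proof -
  have k_meas: "(\<lambda>x. k x $ i $ j) \<in> borel_measurable (lebesgue_on \<Omega>)" for i j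
    using k by (auto simp: symmetric_elliptic_coefficient_def)
  have "\<forall>i j. \<exists>C. AE x in lebesgue_on \<Omega>. \<bar>k x $ i $ j\<bar> \<le> C"
    using k by (auto simp: symmetric_elliptic_coefficient_def)
  then obtain C where C: "\<And>i j. AE x in lebesgue_on \<Omega>. \<bar>k x $ i $ j\<bar> \<le> C i j"
    by metis
  define K where "K = (\<Sum>i\<in>UNIV. \<Sum>j\<in>UNIV. \<bar>C i j\<bar>)"
  have K: "K \<ge> 0" unfolding K_def by (intro sum_nonneg) auto
  have C_all: "AE x in lebesgue_on \<Omega>. \<forall>i j. \<bar>k x $ i $ j\<bar> \<le> C i j"
    using C by (simp add: AE_all_countable)
  have expand: "(k x *v g) \<bullet> h = (\<Sum>i\<in>UNIV. \<Sum>j\<in>UNIV. k x $ i $ j * (g $ j * h $ i))" for x and g h ::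
      "real^'n"
    by (simp add: inner_vec_def matrix_vector_mult_def sum_distrib_right mult.assoc)
  have bound: "\<bar>(k x *v g) \<bullet> h\<bar> \<le> K * ((norm g)\<^sup>2 + (norm h)\<^sup>2)" if
      "\<forall>i j. \<bar>k x $ i $ j\<bar> \<le> C i j" for x and g h :: "real^'n"
  proof -
    have "\<bar>(k x *v g) \<bullet> h\<bar> \<le> (\<Sum>i\<in>UNIV. \<Sum>j\<in>UNIV. \<bar>k x $ i $ j * (g $ j * h $ i)\<bar>)"
      unfolding expand by (intro order_trans[OF sum_abs] sum_mono sum_abs)
    also have "\<dots> \<le> (\<Sum>i\<in>UNIV. \<Sum>j\<in>UNIV. \<bar>C i j\<bar> * ((norm g)\<^sup>2 + (norm h)\<^sup>2))"
    proof (intro sum_mono)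
      fix i j
      have "\<bar>g $ j * h $ i\<bar> \<le> norm g * norm h"
        unfolding abs_mult by (intro mult_mono component_le_norm_cart) auto
      also have "\<dots> \<le> (norm g)\<^sup>2 + (norm h)\<^sup>2"
        using sum_squares_bound[of "norm g"
            "norm h"] mult_nonneg_nonneg[OF norm_ge_zero[of g] norm_ge_zero[of h]] by linarith
      finally show "\<bar>k x $ i $ j * (g $ j * h $ i)\<bar> \<le> \<bar>C i j\<bar> * ((norm g)\<^sup>2 + (norm h)\<^sup>2)"
        unfolding abs_mult[of "k x $ i $ j"] using that
            by (intro mult_mono) (auto intro: order_trans[OF _ abs_ge_self])
    qed
    also have "\<dots> = K * ((norm g)\<^sup>2 + (norm h)\<^sup>2)"
      by (simp add: K_def sum_distrib_right)
    finally show ?thesis .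
  qed
  have rep_meas: "rep_L2 F \<in> borel_measurable lebesgue" for F :: "(real^'n, real^'n) L2"
    using square_integrable_rep[of F] by (simp add: square_integrable_def)
  have comp_meas: "(\<lambda>x. rep_L2 F x $ i) \<in> borel_measurable (lebesgue_on \<Omega>)" for F ::
      "(real^'n, real^'n) L2" and i
    using borel_measurable_continuous_on[OF linear_continuous_on[OF bounded_linear_vec_nth]
        rep_meas[of F]]
    by (rule measurable_restrict_space1)
  have sq_int: "integrable lebesgue (\<lambda>x. K * ((norm (rep_L2 G x))\<^sup>2 + (norm (rep_L2 H x))\<^sup>2))"
      for G H :: "(real^'n, real^'n) L2"
    by (intro integrable_mult_right Bochner_Integration.integrable_add norm_L2_power2)
  have sq_int': "integrable (lebesgue_on \<Omega>) (\<lambda>x. K * ((norm (rep_L2 G x))\<^sup>2 + (norm (rep_L2 H x))\<^sup>2))"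
      for G H :: "(real^'n, real^'n) L2"
  proof -
    have "\<Omega> \<inter> space lebesgue \<in> sets lebesgue" using \<Omega> by simp
    from integrable_restrict_space[OF this] show ?thesis
      using integrable_mult_indicator[OF \<Omega> sq_int] by blast
  qed
  have AE_bound: "AE x in lebesgue_on \<Omega>. norm ((k x *v rep_L2 G x) \<bullet> rep_L2 H x)
      \<le> K * ((norm (rep_L2 G x))\<^sup>2 + (norm (rep_L2 H x))\<^sup>2)" for G H
    using C_all by eventually_elim (simp add: bound)
  show int: "integrable (lebesgue_on \<Omega>) (\<lambda>x. (k x *v rep_L2 G x) \<bullet> rep_L2 H x)" for G H
  proof (rule Bochner_Integration.integrable_bound[OF sq_int'])
    show "(\<lambda>x. (k x *v rep_L2 G x) \<bullet> rep_L2 H x) \<in> borel_measurable (lebesgue_on \<Omega>)"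
      unfolding expand by (intro borel_measurable_sum borel_measurable_times k_meas comp_meas)
    show "AE x in lebesgue_on \<Omega>. norm ((k x *v rep_L2 G x) \<bullet> rep_L2 H x)
        \<le> norm (K * ((norm (rep_L2 G x))\<^sup>2 + (norm (rep_L2 H x))\<^sup>2))"
      using AE_bound[of G H] by eventually_elim
          (erule order_trans, simp only: real_norm_def abs_ge_self)
  qed
  have "\<bar>coefficient_form \<Omega> k G H\<bar> \<le> K * ((norm G)\<^sup>2 + (norm H)\<^sup>2)" for G H
  proof -
    have "\<bar>coefficient_form \<Omega> k G H\<bar> \<le> (LINT x|lebesgue_on \<Omega>. norm ((k x *v rep_L2 G x) \<bullet> rep_L2 H x))"
      unfolding coefficient_form_def real_norm_def[symmetric] by (rule integral_norm_bound)
    also have "\<dots> \<le> (LINT x|lebesgue_on \<Omega>. K * ((norm (rep_L2 G x))\<^sup>2 + (norm (rep_L2 H x))\<^sup>2))"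
      by (rule integral_mono_AE[OF integrable_norm[OF int] sq_int' AE_bound])
    also have "\<dots> \<le> (LINT x|lebesgue. K * ((norm (rep_L2 G x))\<^sup>2 + (norm (rep_L2 H x))\<^sup>2))"
    proof -
      have \<Omega>': "\<Omega> \<inter> space lebesgue \<in> sets lebesgue" using \<Omega> by simp
      show ?thesis
        unfolding integral_restrict_space[OF \<Omega>']
        by (rule integral_mono[OF integrable_mult_indicator[OF \<Omega> sq_int] sq_int])
            (use K in \<open>simp add: indicator_def\<close>)
    qed
    also have "\<dots> = K * ((norm G)\<^sup>2 + (norm H)\<^sup>2)"
      by (simp add: norm_L2_power2 Bochner_Integration.integral_add)
    finally show ?thesis .
  qed
  with K show "\<exists>K\<ge>0. \<forall>G H. \<bar>coefficient_form \<Omega> k G H\<bar> \<le> K * ((norm G)\<^sup>2 + (norm H)\<^sup>2)" by blast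
qed

lemma coefficient_form_sym:
  assumes "symmetric_elliptic_coefficient \<Omega> k"
  shows "coefficient_form \<Omega> k G H = coefficient_form \<Omega> k H G"
  unfolding coefficient_form_def
proof (rule Bochner_Integration.integral_cong[OF refl])
  fix x assume "x \<in> space (lebesgue_on \<Omega>)"
  then have "transpose (k x) = k x" using assms by (simp add: symmetric_elliptic_coefficient_def)
  then have "(k x *v g) \<bullet> h = g \<bullet> (k x *v h)" for g h
    by (metis dot_lmul_matrix transpose_matrix_vector)
  then show "(k x *v rep_L2 G x) \<bullet> rep_L2 H x = (k x *v rep_L2 H x) \<bullet> rep_L2 G x"
    by (simp add: inner_commute)
qed

lemma coefficient_form_nonneg:
  assumes "symmetric_elliptic_coefficient \<Omega> k"
  shows "0 \<le> coefficient_form \<Omega> k G G"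
  unfolding coefficient_form_def
proof (rule Bochner_Integration.integral_nonneg)
  obtain k0 where k0: "k0 > 0" "\<And>x \<xi>. x \<in> \<Omega> \<Longrightarrow> \<xi> \<bullet> (k x *v \<xi>) \<ge> k0 * (norm \<xi>)\<^sup>2"
    using assms by (auto simp: symmetric_elliptic_coefficient_def)
  fix x assume "x \<in> space (lebesgue_on \<Omega>)"
  then have "k0 * (norm (rep_L2 G x))\<^sup>2 \<le> (k x *v rep_L2 G x) \<bullet> rep_L2 G x"
    using k0(2)[of x] by (simp add: inner_commute)
  moreover have "0 \<le> k0 * (norm (rep_L2 G x))\<^sup>2" using k0(1) by simp
  ultimately show "0 \<le> (k x *v rep_L2 G x) \<bullet> rep_L2 G x" by linarith
qed

text \<open>
  Boundedness follows from the quadratic bound applied to normalised arguments; additivity in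
  the second argument follows from the one in the first by symmetry.
\<close>

lemma bounded_bilinear_coefficient_form:
  fixes k :: "real^'n::finite \<Rightarrow> real^'n^'n" and \<Omega> :: "(real^'n) set"
  assumes k: "symmetric_elliptic_coefficient \<Omega> k" and \<Omega>: "\<Omega> \<in> sets lebesgue"
  shows "bounded_bilinear (coefficient_form \<Omega> k)"
proof -
  note int = coefficient_form_integrand(1)[OF k \<Omega>]
  have meas: "f \<in> borel_measurable (lebesgue_on \<Omega>)" if "integrable (lebesgue_on \<Omega>) f" for f ::
      "real^'n \<Rightarrow> real"
    using that by simp
  have addl: "coefficient_form \<Omega> k (G + G') H = coefficient_form \<Omega> k G H + coefficient_form \<Omega> k G' H"
      for G G' H
  proof -
    have "coefficient_form \<Omega> k (G + G') H
        = (LINT x|lebesgue_on \<Omega>. (k x *v rep_L2 G x) \<bullet> rep_L2 H x + (k x *v rep_L2 G' x) \<bullet> rep_L2 H x)"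
      unfolding coefficient_form_def
      by (intro integral_cong_AE meas int Bochner_Integration.integrable_add)
         (use AE_lebesgue_on[OF \<Omega> rep_L2_add[of G G']] in \<open>eventually_elim,
             simp add: matrix_vector_right_distrib inner_add_left\<close>)
    then show ?thesis using int by (simp add: coefficient_form_def Bochner_Integration.integral_add)
  qed
  have scalel: "coefficient_form \<Omega> k (r *\<^sub>R G) H = r * coefficient_form \<Omega> k G H" for r G H
  proof -
    have "coefficient_form \<Omega> k (r *\<^sub>R G) H
        = (LINT x|lebesgue_on \<Omega>. r * ((k x *v rep_L2 G x) \<bullet> rep_L2 H x))"
      unfolding coefficient_form_def
      by (intro integral_cong_AE meas int integrable_mult_right)
         (use AE_lebesgue_on[OF \<Omega> rep_L2_scaleR[of r G]] in \<open>eventually_elim,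
             simp add: matrix_vector_mult_scaleR\<close>)
    then show ?thesis using int by (simp add: coefficient_form_def)
  qed
  note sym = coefficient_form_sym[OF k]
  obtain K where K: "K \<ge> 0" "\<And>G H. \<bar>coefficient_form \<Omega> k G H\<bar> \<le> K * ((norm G)\<^sup>2 + (norm H)\<^sup>2)"
    using coefficient_form_integrand(2)[OF k \<Omega>] by blast
  show ?thesis
  proof
    show "coefficient_form \<Omega> k (G + G') H = coefficient_form \<Omega> k G H + coefficient_form \<Omega> k G' H"
        for G G' H
      by (rule addl)
    show "coefficient_form \<Omega> k G (H + H') = coefficient_form \<Omega> k G H + coefficient_form \<Omega> k G H'"
        for G H H'
      unfolding sym[of G] by (rule addl)
    show "coefficient_form \<Omega> k (r *\<^sub>R G) H = r *\<^sub>R coefficient_form \<Omega> k G H" for r G H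
      by (simp add: scalel)
    show "coefficient_form \<Omega> k G (r *\<^sub>R H) = r *\<^sub>R coefficient_form \<Omega> k G H" for r G H
      unfolding sym[of G] by (simp add: scalel)
    have "norm (coefficient_form \<Omega> k G H) \<le> norm G * norm H * (2 * K)" for G H
    proof (cases "G = 0 \<or> H = 0")
      case True
      then show ?thesis using scalel[of 0 G H] scalel[of 0 H G] sym[of G H] by auto
    next
      case False
      let ?G = "(1 / norm G) *\<^sub>R G" and ?H = "(1 / norm H) *\<^sub>R H"
      have "\<bar>coefficient_form \<Omega> k ?G ?H\<bar> \<le> K * 2"
        using K(2)[of ?G ?H] False by simp
      moreover have "coefficient_form \<Omega> k ?G ?H = coefficient_form \<Omega> k G H / (norm G * norm H)"
        unfolding scalel sym[of G] by (simp add: scalel)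
      ultimately show ?thesis
        using False by (simp add: abs_mult divide_simps mult_ac)
    qed
    then show "\<exists>K. \<forall>G H. norm (coefficient_form \<Omega> k G H) \<le> norm G * norm H * K" by blast
  qed
qed

lemma spl_form_eq: "spl_form \<Omega> k a p q = coefficient_form \<Omega> k (snd p) (snd q) + a * (fst p \<bullet> fst q)"
  by (simp add: spl_form_def coefficient_form_def case_prod_unfold)

lemma bounded_bilinear_spl_form:
  fixes k :: "real^'n::finite \<Rightarrow> real^'n^'n" and \<Omega> :: "(real^'n) set"
  assumes k: "symmetric_elliptic_coefficient \<Omega> k" and \<Omega>: "\<Omega> \<in> sets lebesgue"
  shows "bounded_bilinear (spl_form \<Omega> k a)"
proof -
  interpret b: bounded_bilinear "coefficient_form \<Omega> k"
    by (rule bounded_bilinear_coefficient_form[OF k \<Omega>])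
  interpret c: bounded_bilinear "\<lambda>(p :: 'n H1) (q :: 'n H1). coefficient_form \<Omega> k (snd p) (snd q)"
    by (rule bounded_bilinear.comp[OF bounded_bilinear_coefficient_form[OF k \<Omega>]
        bounded_linear_snd bounded_linear_snd])
  interpret i: bounded_bilinear "\<lambda>(p :: 'n H1) (q :: 'n H1). fst p \<bullet> fst q"
    by (rule bounded_bilinear.comp[OF bounded_bilinear_inner bounded_linear_fst bounded_linear_fst])
  obtain K1 K2 where K: "\<And>(p :: 'n H1) (q :: 'n H1). norm (coefficient_form \<Omega> k (snd p) (snd q))
      \<le> norm p * norm q * K1"
    "\<And>(p :: 'n H1) (q :: 'n H1). norm (fst p \<bullet> fst q) \<le> norm p * norm q * K2"
    using c.bounded i.bounded by blast
  show ?thesis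
    unfolding spl_form_eq[abs_def]
  proof
    have bound: "norm (coefficient_form \<Omega> k (snd p) (snd q) + a * (fst p \<bullet> fst q))
        \<le> norm p * norm q * (K1 + \<bar>a\<bar> * K2)" for p q :: "'n H1"
    proof -
      have "norm (coefficient_form \<Omega> k (snd p) (snd q) + a * (fst p \<bullet> fst q))
          \<le> norm p * norm q * K1 + \<bar>a\<bar> * (norm p * norm q * K2)"
        using K(1)[of p q] mult_left_mono[OF K(2)[of p q] abs_ge_zero[of a]]
        by (intro norm_triangle_le add_mono) (auto simp: abs_mult)
      then show "norm (coefficient_form \<Omega> k (snd p) (snd q) + a * (fst p \<bullet> fst q))
          \<le> norm p * norm q * (K1 + \<bar>a\<bar> * K2)"
        by (simp add: algebra_simps)
    qed
    then show "\<exists>K. \<forall>(p :: 'n H1) (q :: 'n H1). norm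
        (coefficient_form \<Omega> k (snd p) (snd q) + a * (fst p \<bullet> fst q)) \<le> norm p * norm q * K"
      by blast
  qed (simp_all add: b.add_left b.add_right b.scaleR_left b.scaleR_right inner_add_left inner_add_right
      algebra_simps)
qed

section \<open>Uniqueness of weak solutions\<close>

lemma convolution_bounded_linear:
  assumes L: "bounded_linear L" and z: "z \<in> Linf T" and t: "t \<le> T" and \<kappa>: "\<kappa> \<in> borel_measurable borel"
    "integrable lborel (\<lambda>x. indicator {0<..<T} x * \<kappa> x)"
  shows "convolution \<kappa> (\<lambda>s. L (z s)) t = L (convolution \<kappa> z t)"
  using integral_bounded_linear[OF L convolution_integrable[OF z t \<kappa>]]
  by (simp add: convolution_def linear_scale[OF bounded_linear.linear[OF L]])

lemma convolution_lincomb: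
  assumes z: "z1 \<in> Linf T" "z2 \<in> Linf T" and t: "t \<le> T" and \<kappa>: "\<kappa> \<in> borel_measurable borel"
    "integrable lborel (\<lambda>x. indicator {0<..<T} x * \<kappa> x)"
  shows "convolution \<kappa> (\<lambda>s. A *\<^sub>R z1 s + B *\<^sub>R z2 s) t
      = A *\<^sub>R convolution \<kappa> z1 t + B *\<^sub>R convolution \<kappa> z2 t"
proof -
  note int = convolution_integrable[OF z(1) t \<kappa>] convolution_integrable[OF z(2) t \<kappa>]
  have "convolution \<kappa> (\<lambda>s. A *\<^sub>R z1 s + B *\<^sub>R z2 s) t
      = (LINT s|lebesgue_on {0<..<t}. A *\<^sub>R (\<kappa> (t - s) *\<^sub>R z1 s) + B *\<^sub>R (\<kappa> (t - s) *\<^sub>R z2 s))"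
    unfolding convolution_def by (intro Bochner_Integration.integral_cong refl)
        (simp add: scaleR_add_right mult.commute)
  also have "\<dots> = A *\<^sub>R convolution \<kappa> z1 t + B *\<^sub>R convolution \<kappa> z2 t"
    using int by (simp add: convolution_def Bochner_Integration.integral_add del: scaleR_scaleR)
  finally show ?thesis .
qed

lemma convolution_cong:
  assumes "\<And>s. 0 < s \<Longrightarrow> s < t \<Longrightarrow> z s = z' s"
  shows "convolution \<kappa> z t = convolution \<kappa> z' t"
  unfolding convolution_def using assms by (intro Bochner_Integration.integral_cong) auto

lemma primitive_cong:
  assumes "\<And>s. 0 < s \<Longrightarrow> s < t \<Longrightarrow> z s = z' s"
  shows "primitive z t = primitive z' t"
  unfolding primitive_def using assms by (intro Bochner_Integration.integral_cong) auto

text \<open>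
  At a fixed time \<open>t\<close> the left-hand side of the equation, as a function of \<open>\<phi>\<close>, is the
  restriction of a bounded linear functional \<open>\<Lambda>\<close> on the whole product space. It vanishes at
  \<open>U1 s\<close> and at \<open>U2 s\<close> for almost every \<open>s\<close>, hence at \<open>U1 s - U2 s\<close>, and integration over \<open>s\<close>
  shows that it vanishes at \<open>Y t = primitive (\<lambda>s. U1 s - U2 s) t\<close>. This is the test element of
  the energy argument.
\<close>

lemma uniqueness_of_integrated_equation:
  fixes U1 U2 :: "real \<Rightarrow> 'h::{real_inner, banach, second_countable_topology} \<times> 'd::{real_inner, banach,
      second_countable_topology}"
    and L :: "'h \<times> 'd \<Rightarrow> 'h \<times> 'd \<Rightarrow> real"
  assumes T: "T > 0" and \<alpha>: "0 < \<alpha>" "\<alpha> < 1" and AB: "A \<ge> 0" "B \<ge> 0" and C: "C > 0"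
    and L: "bounded_bilinear L" and L_sym: "\<And>x y. L x y = L y x" and L_nonneg: "\<And>x. 0 \<le> L x x"
    and U1: "U1 \<in> bochner_Linf {0<..<T} V" and U2: "U2 \<in> bochner_Linf {0<..<T} V"
    and u: "continuous_on {0..T} u" and u_eq: "\<And>t. 0 < t \<Longrightarrow> t < T \<Longrightarrow> u t = fst (U1 t) - fst (U2 t)"
    and eq: "\<And>\<phi> t. \<phi> \<in> V \<Longrightarrow> 0 < t \<Longrightarrow> t < T \<Longrightarrow>
      A * convolution (g_kernel \<alpha>) (\<lambda>r. u r \<bullet> fst \<phi>) t
          + B * convolution (g_kernel \<alpha>) (\<lambda>r. primitive u r \<bullet> fst \<phi>) t
        + C * (primitive u t \<bullet> fst \<phi>) + L (primitive (primitive (\<lambda>s. U1 s - U2 s)) t) \<phi> = 0"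
    and t: "t \<in> {0..T}"
  shows "u t = 0"
proof -
  let ?g = "g_kernel \<alpha>"
  have T0: "0 \<le> T" using T by simp
  note g = g_kernel_facts[OF \<alpha> T0]
  have gT: "integrable lborel (\<lambda>x. indicator {0<..<T} x * ?g x)"
    using g(3) by (simp add: has_bochner_integral_iff)
  define Y where "Y = primitive (\<lambda>s. U1 s - U2 s)"
  have UL: "U1 \<in> Linf T" "U2 \<in> Linf T" using U1 U2 by (auto simp: bochner_Linf_def)
  have U: "(\<lambda>s. U1 s - U2 s) \<in> Linf T" by (rule Linf_diff[OF UL])
  have V: "AE s in lebesgue_on {0<..<T}. U1 s \<in> V" "AE s in lebesgue_on {0<..<T}. U2 s \<in> V"
    using U1 U2 by (auto simp: bochner_Linf_def)
  have Y: "continuous_on {0..T} Y" unfolding Y_def by (rule primitive_continuous[OF U])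
  have uL: "u \<in> Linf T" by (rule Linf_continuous[OF u])
  have y: "continuous_on {0..T} (primitive u)" by (rule primitive_continuous[OF uL])
  have yL: "primitive u \<in> Linf T" by (rule Linf_continuous[OF y])
  have Y_fst: "fst (Y s) = primitive u s" if "s \<le> T" for s
  proof -
    have "fst (Y s) = primitive (\<lambda>r. fst (U1 r - U2 r)) s"
      unfolding Y_def by (rule primitive_bounded_linear[OF bounded_linear_fst U that, symmetric])
    also have "\<dots> = primitive u s"
      by (rule primitive_cong) (use u_eq that in auto)
    finally show ?thesis .
  qed
  let ?v = "\<lambda>r. A *\<^sub>R u r + B *\<^sub>R primitive u r"
  have vL: "?v \<in> Linf T" by (intro Linf_continuous continuous_intros u y)
  have "convolution ?g (\<lambda>r. ?v r \<bullet> primitive u t) t + C * (primitive u t \<bullet> primitive u t)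
      + L (primitive Y t) (Y t) = 0"
    if t: "0 < t" "t < T" for t
  proof -
    define \<Lambda> where "\<Lambda> \<phi> = convolution ?g ?v t \<bullet> fst \<phi> + C * (primitive u t \<bullet> fst \<phi>)
        + L (primitive Y t) \<phi>" for \<phi> :: "'h \<times> 'd"
    have conv_inner: "convolution ?g (\<lambda>r. z r \<bullet> w) t = convolution ?g z t \<bullet> w" if "z \<in> Linf T" for z ::
        "real \<Rightarrow> 'h" and w
      using t by (intro convolution_bounded_linear[OF bounded_linear_inner_left that _ g(1) gT]) simp
    have \<Lambda>_lin: "bounded_linear \<Lambda>"
      unfolding \<Lambda>_def[abs_def]
      by (intro bounded_linear_intros bounded_bilinear.bounded_linear_right[OF L])
    have \<Lambda>_V: "\<Lambda> \<phi> = 0" if "\<phi> \<in> V" for \<phi>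
    proof -
      have "convolution ?g ?v t = A *\<^sub>R convolution ?g u t + B *\<^sub>R convolution ?g (primitive u) t"
        using t by (intro convolution_lincomb[OF uL yL _ g(1) gT]) simp
      then show ?thesis
        using eq[OF that t] by (simp add: \<Lambda>_def Y_def conv_inner[OF uL] conv_inner[OF yL]
            inner_add_left)
    qed
    have "AE s in lebesgue_on {0<..<T}. \<Lambda> (U1 s - U2 s) = 0"
      using V by eventually_elim (simp add: \<Lambda>_V linear_diff[OF bounded_linear.linear[OF \<Lambda>_lin]])
    then have "primitive (\<lambda>s. \<Lambda> (U1 s - U2 s)) t = primitive (\<lambda>_. 0) t"
      using Linf_bounded_linear[OF \<Lambda>_lin U] t by (intro primitive_cong_AE) (auto elim: LinfE)
    then have "\<Lambda> (Y t) = 0"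
      unfolding Y_def using primitive_bounded_linear[OF \<Lambda>_lin U, of t] t by (simp add: primitive_def)
    then show ?thesis
      using Y_fst[of t] t by (simp add: \<Lambda>_def conv_inner[OF vL])
  qed
  from energy_uniqueness[OF u Y T \<alpha> AB C L L_sym L_nonneg this t] show ?thesis .
qed

lemma g_convolution_Linf_bound:
  fixes z :: "real \<Rightarrow> real"
  assumes z: "z \<in> Linf T" and \<alpha>: "0 < \<alpha>" "\<alpha> < 1"
  obtains N where "\<And>t. 0 < t \<Longrightarrow> t < T \<Longrightarrow> \<bar>convolution (g_kernel \<alpha>) z t\<bar> \<le> N"
proof -
  obtain M where M: "z \<in> borel_measurable (lebesgue_on {0<..<T})" "M \<ge> 0"
      "AE t in lebesgue_on {0<..<T}. norm (z t) \<le> M"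
    using z by (rule LinfE)
  have G: "Gamma (1 - \<alpha>) > 0" using \<alpha> by (intro Gamma_real_pos) simp
  show ?thesis
  proof (rule that[of "M / (1 - \<alpha>) / Gamma (1 - \<alpha>) * T powr (1 - \<alpha>)"])
    fix t assume t: "0 < t" "t < T"
    then have "\<bar>convolution (g_kernel \<alpha>) z t\<bar> \<le> M / (1 - \<alpha>) / Gamma (1 - \<alpha>) * t powr (1 - \<alpha>)"
      by (intro g_convolution_bound[OF M(3)[unfolded real_norm_def] M(1,2) \<alpha>]) auto
    also have "\<dots> \<le> M / (1 - \<alpha>) / Gamma (1 - \<alpha>) * T powr (1 - \<alpha>)"
      using t G M(2) \<alpha> by (intro mult_left_mono powr_mono2) auto
    finally show "\<bar>convolution (g_kernel \<alpha>) z t\<bar> \<le> M / (1 - \<alpha>) / Gamma (1 - \<alpha>) * T powr (1 - \<alpha>)" .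
  qed
qed

text \<open>
  All terms of the equation except the one with \<open>h\<close> are bounded or, like the source \<open>F\<close>,
  integrable.
\<close>

lemma weak_solution_derivative_integrable:
  fixes h F :: "real \<Rightarrow> real"
  assumes weak: "weak_time_derivative T f h" and T: "T > 0" and \<alpha>: "0 < \<alpha>" "\<alpha> < 1" and A: "A > 0"
    and q: "q \<in> Linf T" and m: "m \<in> Linf T" and q0: "q0 \<in> Linf T"
    and f: "\<And>t. 0 < t \<Longrightarrow> t < T \<Longrightarrow> f t = convolution (g_kernel \<alpha>) q0 t"
    and F: "integrable (lebesgue_on {0<..<T}) F"
    and eq: "AE t in lebesgue_on {0<..<T}. A * h t + B * convolution (g_kernel \<alpha>) q t + C * q t + m t
        = F t"
  shows "integrable (lebesgue_on {0<..<T}) f" "integrable (lebesgue_on {0<..<T}) h"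
proof -
  obtain N where N: "\<And>t. 0 < t \<Longrightarrow> t < T \<Longrightarrow> \<bar>convolution (g_kernel \<alpha>) q0 t\<bar> \<le> N"
    using g_convolution_Linf_bound[OF q0 \<alpha>] by blast
  have "f \<in> Linf T"
    using weak_time_derivative_measurable(1)[OF weak T]
    by (rule LinfI[of _ _ N]) (auto intro!: AE_I2 simp: f N)
  then show "integrable (lebesgue_on {0<..<T}) f" by (rule Linf_integrable) simp
  obtain N' where N': "\<And>t. 0 < t \<Longrightarrow> t < T \<Longrightarrow> \<bar>convolution (g_kernel \<alpha>) q t\<bar> \<le> N'"
    using g_convolution_Linf_bound[OF q \<alpha>] by blast
  obtain M1 where M1: "AE t in lebesgue_on {0<..<T}. norm (q t) \<le> M1" using q by (rule LinfE)
  obtain M2 where M2: "AE t in lebesgue_on {0<..<T}. norm (m t) \<le> M2" using m by (rule LinfE)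
  have "(\<lambda>_. \<bar>B\<bar> * N' + \<bar>C\<bar> * M1 + M2) \<in> Linf T" by (intro Linf_continuous continuous_intros)
  then have const: "integrable (lebesgue_on {0<..<T}) (\<lambda>_. \<bar>B\<bar> * N' + \<bar>C\<bar> * M1 + M2)"
    by (rule Linf_integrable) simp
  show "integrable (lebesgue_on {0<..<T}) h"
  proof (rule Bochner_Integration.integrable_bound)
    show "integrable (lebesgue_on {0<..<T}) (\<lambda>t. (1 / A) * (\<bar>F t\<bar> + (\<bar>B\<bar> * N' + \<bar>C\<bar> * M1 + M2)))"
      by (intro integrable_mult_right Bochner_Integration.integrable_add integrable_abs F const)
    show "h \<in> borel_measurable (lebesgue_on {0<..<T})"
      by (rule weak_time_derivative_measurable(2)[OF weak T])
    have "AE t in lebesgue_on {0<..<T}. t \<in> {0<..<T}" by (intro AE_I2) simp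
    with eq M1 M2 show "AE t in lebesgue_on {0<..<T}. norm (h t)
        \<le> norm ((1 / A) * (\<bar>F t\<bar> + (\<bar>B\<bar> * N' + \<bar>C\<bar> * M1 + M2)))"
    proof eventually_elim
      case (elim t)
      have "\<bar>B * convolution (g_kernel \<alpha>) q t\<bar> \<le> \<bar>B\<bar> * N'" "\<bar>C * q t\<bar> \<le> \<bar>C\<bar> * M1"
        unfolding abs_mult using N'[of t] elim by (auto intro!: mult_left_mono)
      moreover have "\<bar>m t\<bar> \<le> M2" using elim by simp
      ultimately have "\<bar>A * h t\<bar> \<le> \<bar>F t\<bar> + (\<bar>B\<bar> * N' + \<bar>C\<bar> * M1 + M2)"
        using elim(1) by linarith
      then have "\<bar>h t\<bar> \<le> (1 / A) * (\<bar>F t\<bar> + (\<bar>B\<bar> * N' + \<bar>C\<bar> * M1 + M2))"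
        using A by (simp add: abs_mult field_simps)
      then show ?case by (metis abs_ge_self order_trans real_norm_def)
    qed
  qed
qed

text \<open>
  On a bounded interval \<open>norm x \<le> 1 + (norm x)\<^sup>2\<close> suffices as a majorant.
\<close>

lemma bochner_L2_inner_integrable:
  fixes F :: "real \<Rightarrow> 'h::{real_inner, banach, second_countable_topology}"
  assumes "F \<in> bochner_L2 {0..T} V"
  shows "integrable (lebesgue_on {0<..<T}) (\<lambda>t. F t \<bullet> w)"
proof -
  have F: "F \<in> borel_measurable (lebesgue_on {0..T})"
      "integrable (lebesgue_on {0..T}) (\<lambda>t. (norm (F t))\<^sup>2)"
    using assms by (auto simp: bochner_L2_def)
  have "integrable (lebesgue_on {0..T}) (\<lambda>t. F t \<bullet> w)"
  proof (rule Bochner_Integration.integrable_bound)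
    show "integrable (lebesgue_on {0..T}) (\<lambda>t. norm w * (1 + (norm (F t))\<^sup>2))"
      by (intro integrable_mult_right Bochner_Integration.integrable_add F(2)) simp
    show "(\<lambda>t. F t \<bullet> w) \<in> borel_measurable (lebesgue_on {0..T})"
      by (rule borel_measurable_continuous_on[OF linear_continuous_on[OF bounded_linear_inner_left]
          F(1)])
    have "\<bar>x \<bullet> w\<bar> \<le> norm w * (1 + (norm x)\<^sup>2)" for x :: 'h
    proof -
      have "norm x \<le> 1 + (norm x)\<^sup>2" using sum_squares_bound[of "norm x" 1] norm_ge_zero[of x]
          by (simp, linarith)
      then have "norm x * norm w \<le> (1 + (norm x)\<^sup>2) * norm w" by (intro mult_right_mono) auto
      then show ?thesis using Cauchy_Schwarz_ineq2[of x w] by (simp add: mult.commute)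
    qed
    then show "AE t in lebesgue_on {0..T}. norm (F t \<bullet> w) \<le> norm (norm w * (1 + (norm (F t))\<^sup>2))"
      by (intro AE_I2) (metis abs_ge_self order_trans real_norm_def)
  qed
  then have "integrable lebesgue (\<lambda>t. indicator {0<..<T} t *\<^sub>R (indicator {0..T} t *\<^sub>R (F t \<bullet> w)))"
    by - (rule integrable_mult_indicator, simp_all add: integrable_restrict_space del: real_scaleR_def)
  moreover have "indicator {0<..<T} t *\<^sub>R (indicator {0..T} t *\<^sub>R (F t \<bullet> w))
      = indicator {0<..<T} t *\<^sub>R (F t \<bullet> w)" for t
    by (auto simp: indicator_def)
  ultimately have "integrable lebesgue (\<lambda>t. indicator {0<..<T} t *\<^sub>R (F t \<bullet> w))" by (simp only:)
  then show ?thesis by (simp add: integrable_restrict_space)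
qed

text \<open>
  The form of the weak equation used below, with the test pair as a single variable.
\<close>

lemma spl_weak_solutionE:
  fixes \<Omega> :: "(real^'n::finite) set"
  assumes "spl_weak_solution \<Omega> T \<alpha> \<rho> c \<tau> a k F U0 V0 u"
  obtains Du v w where "continuous_on {0..T} u" "u 0 = U0"
    "(\<lambda>t. (u t, Du t)) \<in> bochner_Linf {0<..<T} (H1_0 \<Omega>)" "v \<in> Linf T" "weak_time_derivative T u v"
    "weak_time_derivative_dual T (H1_0 \<Omega>)
        (\<lambda>t. L2_functional (convolution (g_kernel \<alpha>) (\<lambda>s. v s - V0) t)) w"
    "AE t in lebesgue_on {0<..<T}. \<forall>\<phi>\<in>H1_0 \<Omega>. \<rho> * c * \<tau> powr \<alpha> * w t \<phi>
       + a * \<tau> powr \<alpha> * (convolution (g_kernel \<alpha>) v t \<bullet> fst \<phi>)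
       + \<rho> * c * (v t \<bullet> fst \<phi>) + spl_form \<Omega> k a (u t, Du t) \<phi> = F t \<bullet> fst \<phi>"
proof -
  from assms obtain Du v w where *: "continuous_on {0..T} u" "u 0 = U0"
    "(\<lambda>t. (u t, Du t)) \<in> bochner_Linf {0<..<T} (H1_0 \<Omega>)" "v \<in> bochner_Linf {0<..<T} (L2_on \<Omega>)"
        "weak_time_derivative T u v"
    "weak_time_derivative_dual T (H1_0 \<Omega>)
        (\<lambda>t. L2_functional (convolution (g_kernel \<alpha>) (\<lambda>s. v s - V0) t)) w"
    and eq: "AE t in lebesgue_on {0<..<T}. \<forall>(\<phi>, D\<phi>)\<in>H1_0 \<Omega>.
       \<rho> * c * \<tau> powr \<alpha> * w t (\<phi>, D\<phi>) + a * \<tau> powr \<alpha> * (convolution (g_kernel \<alpha>) v t \<bullet> \<phi>)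
       + \<rho> * c * (v t \<bullet> \<phi>) + spl_form \<Omega> k a (u t, Du t) (\<phi>, D\<phi>) = F t \<bullet> \<phi>"
    unfolding spl_weak_solution_def by blast
  have "AE t in lebesgue_on {0<..<T}. \<forall>\<phi>\<in>H1_0 \<Omega>. \<rho> * c * \<tau> powr \<alpha> * w t \<phi>
       + a * \<tau> powr \<alpha> * (convolution (g_kernel \<alpha>) v t \<bullet> fst \<phi>)
       + \<rho> * c * (v t \<bullet> fst \<phi>) + spl_form \<Omega> k a (u t, Du t) \<phi> = F t \<bullet> fst \<phi>"
    using eq by eventually_elim auto
  moreover have "v \<in> Linf T" using *(4) by (auto simp: bochner_Linf_def)
  ultimately show ?thesis using * that by blast
qed

text \<open>
  In the difference of the two equations, tested with the same \<open>\<phi>\<close>, the source \<open>F\<close> and the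
  initial velocity \<open>V0\<close> cancel. What remains is the scalar fractional equation for
  \<open>q = (v1 - v2) \<bullet> fst \<phi>\<close>, whose primitive is \<open>u \<bullet> fst \<phi>\<close>.
\<close>

lemma integrated_difference_equation:
  fixes \<Omega> :: "(real^'n::finite) set" and u1 u2 :: "real \<Rightarrow> (real^'n, real) L2" and L ::
      "'n H1 \<Rightarrow> 'n H1 \<Rightarrow> real"
  assumes T: "T > 0" and \<alpha>: "0 < \<alpha>" "\<alpha> < 1" and A: "A > 0" and L: "bounded_bilinear L"
    and F: "F \<in> bochner_L2 {0..T} W"
    and u: "continuous_on {0..T} u1" "continuous_on {0..T} u2" "u1 0 = u2 0"
    and U: "(\<lambda>t. (u1 t, D1 t)) \<in> Linf T" "(\<lambda>t. (u2 t, D2 t)) \<in> Linf T"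
    and v12: "v1 \<in> Linf T" "v2 \<in> Linf T"
    and weak: "weak_time_derivative T u1 v1" "weak_time_derivative T u2 v2"
    and weak_w: "weak_time_derivative T (\<lambda>t. convolution (g_kernel \<alpha>) (\<lambda>s. v1 s - V0) t \<bullet> fst \<phi>) w1"
      "weak_time_derivative T (\<lambda>t. convolution (g_kernel \<alpha>) (\<lambda>s. v2 s - V0) t \<bullet> fst \<phi>) w2"
    and eq: "AE t in lebesgue_on {0<..<T}. A * w1 t + B * (convolution (g_kernel \<alpha>) v1 t \<bullet> fst \<phi>)
       + C * (v1 t \<bullet> fst \<phi>) + L (u1 t, D1 t) \<phi> = F t \<bullet> fst \<phi>"
      "AE t in lebesgue_on {0<..<T}. A * w2 t + B * (convolution (g_kernel \<alpha>) v2 t \<bullet> fst \<phi>)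
       + C * (v2 t \<bullet> fst \<phi>) + L (u2 t, D2 t) \<phi> = F t \<bullet> fst \<phi>"
    and t: "0 < t" "t < T"
  defines "u \<equiv> \<lambda>t. u1 t - u2 t"
  shows "A * convolution (g_kernel \<alpha>) (\<lambda>r. u r \<bullet> fst \<phi>) t
      + B * convolution (g_kernel \<alpha>) (\<lambda>r. primitive u r \<bullet> fst \<phi>) t
        + C * (primitive u t \<bullet> fst \<phi>) + L (primitive (primitive (\<lambda>s. (u1 s, D1 s) - (u2 s, D2 s))) t) \<phi>
            = 0"
proof -
  let ?g = "g_kernel \<alpha>" and ?\<phi> = "fst \<phi>"
  have T0: "0 \<le> T" using T by simp
  note g = g_kernel_facts[OF \<alpha> T0]
  have gT: "integrable lborel (\<lambda>x. indicator {0<..<T} x * ?g x)"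
    using g(3) by (simp add: has_bochner_integral_iff)
  note inner_lin = bounded_linear_inner_left[of ?\<phi>]
  have L_lin: "bounded_linear (\<lambda>p. L p \<phi>)" by (rule bounded_bilinear.bounded_linear_left[OF L])
  have uL: "u1 \<in> Linf T" "u2 \<in> Linf T" using u by (auto intro: Linf_continuous)
  have constL: "(\<lambda>_. V0) \<in> Linf T" by (intro Linf_continuous continuous_intros)
  have v0L: "(\<lambda>s. v1 s - V0) \<in> Linf T" "(\<lambda>s. v2 s - V0) \<in> Linf T"
    using v12 constL by (auto intro: Linf_diff)
  have conv_inner: "convolution ?g (\<lambda>s. z s \<bullet> ?\<phi>) t = convolution ?g z t \<bullet> ?\<phi>" if "z \<in> Linf T"
      "t \<le> T" for z :: "real \<Rightarrow> (real^'n, real) L2" and t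
    by (rule convolution_bounded_linear[OF inner_lin that g(1) gT])
  have Fint: "integrable (lebesgue_on {0<..<T}) (\<lambda>t. F t \<bullet> ?\<phi>)"
    by (rule bochner_L2_inner_integrable[OF F])
  have int: "integrable (lebesgue_on {0<..<T}) (\<lambda>t. convolution ?g (\<lambda>s. vi s - V0) t \<bullet> ?\<phi>)"
      "integrable (lebesgue_on {0<..<T}) wi"
    if vi: "vi \<in> Linf T" "(\<lambda>s. vi s - V0) \<in> Linf T" and Ui: "Ui \<in> Linf T"
      and weak_i: "weak_time_derivative T (\<lambda>t. convolution ?g (\<lambda>s. vi s - V0) t \<bullet> ?\<phi>) wi"
      and eq_i: "AE t in lebesgue_on {0<..<T}. A * wi t + B * (convolution ?g vi t \<bullet> ?\<phi>)
       + C * (vi t \<bullet> ?\<phi>) + L (Ui t) \<phi> = F t \<bullet> ?\<phi>" for vi wi Ui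
  proof -
    have "AE t in lebesgue_on {0<..<T}. t \<in> {0<..<T}" by (intro AE_I2) simp
    with eq_i have eq': "AE t in lebesgue_on {0<..<T}. A * wi t + B * convolution ?g (\<lambda>s. vi s \<bullet> ?\<phi>) t
       + C * (vi t \<bullet> ?\<phi>) + L (Ui t) \<phi> = F t \<bullet> ?\<phi>"
      by eventually_elim (simp add: conv_inner[OF vi(1)])
    have f: "convolution ?g (\<lambda>s. vi s - V0) t \<bullet> ?\<phi> = convolution ?g (\<lambda>s. (vi s - V0) \<bullet> ?\<phi>) t" if "0 < t"
        "t < T" for t
      using that by (simp add: conv_inner[OF vi(2)])
    note * = weak_solution_derivative_integrable[OF weak_i T \<alpha> A Linf_bounded_linear[OF inner_lin vi(1)]
        Linf_bounded_linear[OF L_lin Ui] Linf_bounded_linear[OF inner_lin vi(2)] f Fint eq']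
    show "integrable (lebesgue_on {0<..<T}) (\<lambda>t. convolution ?g (\<lambda>s. vi s - V0) t \<bullet> ?\<phi>)"
        "integrable (lebesgue_on {0<..<T}) wi"
      by (rule *, assumption+)+
  qed
  note int1 = int[OF v12(1) v0L(1) U(1) weak_w(1) eq(1)] and int2
      = int[OF v12(2) v0L(2) U(2) weak_w(2) eq(2)]
  define v where "v s = v1 s - v2 s" for s
  define q where "q s = v s \<bullet> ?\<phi>" for s
  define UU where "UU s = (u1 s, D1 s) - (u2 s, D2 s)" for s
  have vL: "v \<in> Linf T" unfolding v_def[abs_def] by (rule Linf_diff[OF v12])
  have qL: "q \<in> Linf T" unfolding q_def[abs_def] by (rule Linf_bounded_linear[OF inner_lin vL])
  have UUL: "UU \<in> Linf T" unfolding UU_def[abs_def] by (rule Linf_diff[OF U])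
  have conv_diff: "convolution ?g z1 s - convolution ?g z2 s = convolution ?g (\<lambda>r. z1 r - z2 r) s"
    if "z1 \<in> Linf T" "z2 \<in> Linf T" "s \<le> T" for z1 z2 :: "real \<Rightarrow> (real^'n, real) L2" and s
    using convolution_lincomb[OF that g(1) gT, of 1 "-1"] by simp
  \<comment> \<open>The constant \<open>V0\<close> cancels in the first difference, so both differences are \<open>g * q\<close>.\<close>
  have conv_q: "convolution ?g (\<lambda>s. v1 s - V0) t \<bullet> ?\<phi> - convolution ?g (\<lambda>s. v2 s - V0) t \<bullet> ?\<phi>
      = convolution ?g q t"
    "convolution ?g v1 t \<bullet> ?\<phi> - convolution ?g v2 t \<bullet> ?\<phi> = convolution ?g q t" if "t \<le> T" for t
    using conv_diff[OF v0L that] conv_diff[OF v12 that] conv_inner[OF vL that]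
    by (simp_all add: q_def[abs_def] v_def[abs_def] flip: inner_diff_left)
  have "AE t in lebesgue_on {0<..<T}. t \<in> {0<..<T}" by (intro AE_I2) simp
  with eq have eq_diff: "AE t in lebesgue_on {0<..<T}. A * (w1 t - w2 t)
      + B * (convolution ?g (\<lambda>s. v1 s - V0) t \<bullet> ?\<phi> - convolution ?g (\<lambda>s. v2 s - V0) t \<bullet> ?\<phi>) + C * q t
          + L (UU t) \<phi> = 0"
  proof eventually_elim
    case (elim t)
    have "L (UU t) \<phi> = L (u1 t, D1 t) \<phi> - L (u2 t, D2 t) \<phi>"
      unfolding UU_def by (rule bounded_bilinear.diff_left[OF L])
    moreover have "C * q t = C * (v1 t \<bullet> ?\<phi>) - C * (v2 t \<bullet> ?\<phi>)"
      by (simp add: q_def v_def inner_diff_left right_diff_distrib)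
    moreover have "A * (w1 t - w2 t) = A * w1 t - A * w2 t" by (rule right_diff_distrib)
    moreover have "B * (convolution ?g (\<lambda>s. v1 s - V0) t \<bullet> ?\<phi> - convolution ?g (\<lambda>s. v2 s - V0) t \<bullet> ?\<phi>)
        = B * (convolution ?g v1 t \<bullet> ?\<phi>) - B * (convolution ?g v2 t \<bullet> ?\<phi>)"
      using conv_q[of t] elim by (simp flip: right_diff_distrib)
    ultimately show ?case using elim(1,2) by linarith
  qed
  have "A * convolution ?g (primitive q) t + B * convolution ?g (primitive (primitive q)) t
    + C * primitive (primitive q) t + primitive (primitive (\<lambda>t. L (UU t) \<phi>)) t = 0"
    by (rule fractional_equation_integrated[OF T \<alpha> A qL Linf_bounded_linear[OF L_lin UUL] _
          weak_time_derivative_diff[OF weak_w int1 int2] eq_diff t]) (use conv_q(1) in simp)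
  moreover have u_cont: "continuous_on {0..T} u" unfolding u_def by (intro continuous_intros u)
  have "weak_time_derivative T u v"
    unfolding u_def v_def[abs_def] using weak uL v12
    by (intro weak_time_derivative_diff) (auto intro: Linf_integrable)
  then have u_v: "u s = primitive v s" if "s \<in> {0..T}" for s
    using u_cont vL T that u(3) by (intro continuous_weak_time_derivative_eq_primitive)
        (auto simp: u_def)
  have pq: "primitive q s = u s \<bullet> ?\<phi>" if "0 < s" "s \<le> T" for s
    using primitive_bounded_linear[OF inner_lin vL that(2)] u_v[of s] that by (simp add: q_def[abs_def])
  have ppq: "primitive (primitive q) s = primitive u s \<bullet> ?\<phi>" if "0 < s" "s \<le> T" for s
  proof -
    have "primitive (primitive q) s = primitive (\<lambda>r. u r \<bullet> ?\<phi>) s"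
      by (rule primitive_cong) (use pq that in auto)
    also have "\<dots> = primitive u s \<bullet> ?\<phi>"
      by (rule primitive_bounded_linear[OF inner_lin Linf_continuous[OF u_cont] that(2)])
    finally show ?thesis .
  qed
  moreover have "convolution ?g (primitive q) t = convolution ?g (\<lambda>r. u r \<bullet> ?\<phi>) t"
    by (rule convolution_cong) (use pq t in auto)
  moreover have "convolution ?g (primitive (primitive q)) t = convolution ?g (\<lambda>r. primitive u r \<bullet> ?\<phi>) t"
    by (rule convolution_cong) (use ppq t in auto)
  moreover have "primitive (primitive (\<lambda>t. L (UU t) \<phi>)) t = L (primitive (primitive UU) t) \<phi>"
  proof -
    have "primitive (primitive (\<lambda>t. L (UU t) \<phi>)) t = primitive (\<lambda>s. L (primitive UU s) \<phi>) t"
      using t by (intro primitive_cong primitive_bounded_linear[OF L_lin UUL]) auto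
    also have "\<dots> = L (primitive (primitive UU) t) \<phi>"
      using t by (intro primitive_bounded_linear[OF L_lin
          Linf_continuous[OF primitive_continuous[OF UUL]]]) simp
    finally show ?thesis .
  qed
  ultimately show ?thesis using t by (simp add: UU_def[abs_def])
qed

theorem theorem4p2:
  fixes \<Omega> :: "(real^'n::finite) set"
    and k :: "real^'n \<Rightarrow> real^'n^'n"
    and T \<alpha> \<rho> c \<tau>\<^sub>q a :: real
    and F :: "real \<Rightarrow> (real^'n, real) L2"
    and U\<^sub>0 V\<^sub>0 :: "(real^'n, real) L2"
    and u\<^sub>1 u\<^sub>2 :: "real \<Rightarrow> (real^'n, real) L2"
  assumes "bounded_lipschitz_domain \<Omega>"
    and "T > 0" and "0 < \<alpha>" and "\<alpha> < 1"
    and "\<rho> > 0" and "c > 0" and "\<tau>\<^sub>q > 0" and "a \<ge> 0"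
    and "symmetric_elliptic_coefficient \<Omega> k"
    and "F \<in> bochner_L2 {0..T} (L2_on \<Omega>)"
    and "U\<^sub>0 \<in> fst ` H1_0 \<Omega>"
    and "V\<^sub>0 \<in> L2_on \<Omega>"
    and "spl_weak_solution \<Omega> T \<alpha> \<rho> c \<tau>\<^sub>q a k F U\<^sub>0 V\<^sub>0 u\<^sub>1"
    and "spl_weak_solution \<Omega> T \<alpha> \<rho> c \<tau>\<^sub>q a k F U\<^sub>0 V\<^sub>0 u\<^sub>2"
  shows "\<forall>t\<in>{0..T}. u\<^sub>1 t = u\<^sub>2 t"
proof
  fix t assume t: "t \<in> {0..T}"
  obtain D1 v1 w1 where s1: "continuous_on {0..T} u\<^sub>1" "u\<^sub>1 0 = U\<^sub>0"
    "(\<lambda>t. (u\<^sub>1 t, D1 t)) \<in> bochner_Linf {0<..<T} (H1_0 \<Omega>)" "v1 \<in> Linf T" "weak_time_derivative T u\<^sub>1 v1"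
    "weak_time_derivative_dual T (H1_0 \<Omega>)
        (\<lambda>t. L2_functional (convolution (g_kernel \<alpha>) (\<lambda>s. v1 s - V\<^sub>0) t)) w1"
    "AE t in lebesgue_on {0<..<T}. \<forall>\<phi>\<in>H1_0 \<Omega>. \<rho> * c * \<tau>\<^sub>q powr \<alpha> * w1 t \<phi>
       + a * \<tau>\<^sub>q powr \<alpha> * (convolution (g_kernel \<alpha>) v1 t \<bullet> fst \<phi>)
       + \<rho> * c * (v1 t \<bullet> fst \<phi>) + spl_form \<Omega> k a (u\<^sub>1 t, D1 t) \<phi> = F t \<bullet> fst \<phi>"
    by (rule spl_weak_solutionE[OF assms(13)], rule that)
  obtain D2 v2 w2 where s2: "continuous_on {0..T} u\<^sub>2" "u\<^sub>2 0 = U\<^sub>0"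
    "(\<lambda>t. (u\<^sub>2 t, D2 t)) \<in> bochner_Linf {0<..<T} (H1_0 \<Omega>)" "v2 \<in> Linf T" "weak_time_derivative T u\<^sub>2 v2"
    "weak_time_derivative_dual T (H1_0 \<Omega>)
        (\<lambda>t. L2_functional (convolution (g_kernel \<alpha>) (\<lambda>s. v2 s - V\<^sub>0) t)) w2"
    "AE t in lebesgue_on {0<..<T}. \<forall>\<phi>\<in>H1_0 \<Omega>. \<rho> * c * \<tau>\<^sub>q powr \<alpha> * w2 t \<phi>
       + a * \<tau>\<^sub>q powr \<alpha> * (convolution (g_kernel \<alpha>) v2 t \<bullet> fst \<phi>)
       + \<rho> * c * (v2 t \<bullet> fst \<phi>) + spl_form \<Omega> k a (u\<^sub>2 t, D2 t) \<phi> = F t \<bullet> fst \<phi>"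
    by (rule spl_weak_solutionE[OF assms(14)], rule that)
  have \<Omega>: "\<Omega> \<in> sets lebesgue" using assms(1) by (simp add: bounded_lipschitz_domain_def)
  have L: "bounded_bilinear (spl_form \<Omega> k a)" by (rule bounded_bilinear_spl_form[OF assms(9) \<Omega>])
  have L_sym: "spl_form \<Omega> k a x y = spl_form \<Omega> k a y x" for x y
    unfolding spl_form_eq using coefficient_form_sym[OF assms(9)] by (simp add: inner_commute)
  have L_nonneg: "0 \<le> spl_form \<Omega> k a x x" for x
    unfolding spl_form_eq using coefficient_form_nonneg[OF assms(9)] assms(8) by simp
  have UL: "(\<lambda>t. (u\<^sub>1 t, D1 t)) \<in> Linf T" "(\<lambda>t. (u\<^sub>2 t, D2 t)) \<in> Linf T"
    using s1(3) s2(3) by (auto simp: bochner_Linf_def)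
  have A: "\<rho> * c * \<tau>\<^sub>q powr \<alpha> > 0" and B: "a * \<tau>\<^sub>q powr \<alpha> \<ge> 0" and C: "\<rho> * c > 0"
    using assms(5-8) by simp_all
  have "(\<lambda>t. u\<^sub>1 t - u\<^sub>2 t) t = 0"
  proof (rule uniqueness_of_integrated_equation[OF assms(2-4) less_imp_le[OF A]
      B C L L_sym L_nonneg s1(3) s2(3) _ _ _ t])
    show "continuous_on {0..T} (\<lambda>t. u\<^sub>1 t - u\<^sub>2 t)" by (intro continuous_intros s1(1) s2(1))
    fix \<phi> :: "'n H1" and t assume \<phi>: "\<phi> \<in> H1_0 \<Omega>" and t: "0 < t" "t < T"
    have weak_w: "weak_time_derivative T (\<lambda>t. convolution (g_kernel \<alpha>) (\<lambda>s. v1 s - V\<^sub>0) t \<bullet> fst \<phi>)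
        (\<lambda>t. w1 t \<phi>)"
      "weak_time_derivative T (\<lambda>t. convolution (g_kernel \<alpha>) (\<lambda>s. v2 s - V\<^sub>0) t \<bullet> fst \<phi>) (\<lambda>t. w2 t \<phi>)"
      using s1(6) s2(6) \<phi> by (auto simp: weak_time_derivative_dual_def L2_functional_def
          case_prod_unfold)
    show "\<rho> * c * \<tau>\<^sub>q powr \<alpha> * convolution (g_kernel \<alpha>) (\<lambda>r. (u\<^sub>1 r - u\<^sub>2 r) \<bullet> fst \<phi>) t
        + a * \<tau>\<^sub>q powr \<alpha> * convolution (g_kernel \<alpha>) (\<lambda>r. primitive (\<lambda>t. u\<^sub>1 t - u\<^sub>2 t) r \<bullet> fst \<phi>) t
        + \<rho> * c * (primitive (\<lambda>t. u\<^sub>1 t - u\<^sub>2 t) t \<bullet> fst \<phi>)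
        + spl_form \<Omega> k a (primitive (primitive (\<lambda>s. (u\<^sub>1 s, D1 s) - (u\<^sub>2 s, D2 s))) t) \<phi> = 0"
    proof (rule integrated_difference_equation[OF assms(2-4) A L assms(10) s1(1) s2(1) _ UL s1(4) s2(4)
        s1(5) s2(5) weak_w _ _ t])
      show "u\<^sub>1 0 = u\<^sub>2 0" using s1(2) s2(2) by simp
    qed ((rule eventually_mono[OF s1(7)] eventually_mono[OF s2(7)], use \<phi> in blast)+)
  qed simp
  then show "u\<^sub>1 t = u\<^sub>2 t" by simp
qed

end
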